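(* Let $m,n\in\mathbb{N}_0$ with $m+n>1$ and let $\Theta=\{\theta_{ij}\in\mathbb{R}:1\le i<j\le m+n\}$. Let $\mathcal{H}^{m,n}=\ell^2(\mathbb{Z})^{\otimes m}\otimes\ell^2(\mathbb{N}_0)^{\otimes n}$ and, for $1\le i\le m+n$, $$T_i^{m,n}=1^{\otimes(i-1)}\otimes S^*\otimes e^{2\pi \mathrm{i}\theta_{i,i+1}N}\otimes e^{2\pi \mathrm{i}\theta_{i,i+2}N}\otimes\cdots\otimes e^{2\pi \mathrm{i}\theta_{i,m+n}N}.$$ Then the representation $\Psi^{m,n}:C_\Theta^{m,n}\to\mathcal{L}(\mathcal{H}^{m,n})$ given by $s_i\mapsto T_i^{m,n}$ for $1\le i\le m+n$ is faithful.
   Context: $\mathbb{N}_0=\mathbb{N}\cup\{0\}$. $C_\Theta^{m,n}$ is the universal (unital) $C^*$-algebra generated by $s_1,\dots,s_{m+n}$ subject to $s_i^*s_j=e^{-2\pi \mathrm{i}\theta_{ij}}s_js_i^*$ for $1\le i<j\le m+n$, $s_i^*s_i=1$ for $1\le i\le m+n$, and $s_is_i^*=1$ for $1\le i\le m$. The operators $T_i^{m,n}$ satisfy these relations, so $\Psi^{m,n}$ is well defined. On $\ell^2(\mathbb{N}_0)$ with standard basis $\{e_l\}$, $S$ is the unilateral shift $e_l\mapsto e_{l-1}$ (with $e_0\mapsto0$), so $S^*e_l=e_{l+1}$; on $\ell^2(\mathbb{Z})$, $S$ is the bilateral shift $e_l\mapsto e_{l-1}$. $N$ is the number operator $e_l\mapsto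 l\,e_l$, so $e^{2\pi \mathrm{i}\theta N}e_l=e^{2\pi \mathrm{i}\theta l}e_l$. *)

theory Defs
  imports
    "HOL-Analysis.Analysis"
    "HOL-Algebra.Module"
    "HOL-Library.Poly_Mapping"
begin

section \<open>Unital complex *-algebras and their homomorphisms\<close>

record 'a star_algebra = "(complex, 'a) module" +
  star :: "'a \<Rightarrow> 'a"
  cnorm :: "'a \<Rightarrow> real"

definition star_hom :: "('a, 'm) star_algebra_scheme \<Rightarrow> ('b, 'n) star_algebra_scheme \<Rightarrow> ('a \<Rightarrow> 'b) set" where
  "star_hom A B = {h \<in> ring_hom A B.
     (\<forall>c. \<forall>x\<in>carrier A. h (c \<odot>\<^bsub>A\<^esub> x) = c \<odot>\<^bsub>B\<^esub> h x) \<and>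
     (\<forall>x\<in>carrier A. h (star A x) = star B (h x))}"


section \<open>The free unital *-algebra on a set of generators\<close>

text \<open>The letter \<open>(g, False)\<close> stands for the generator \<open>g\<close> and \<open>(g, True)\<close> for its adjoint.
  The monoid of words is written additively, because the convolution product of
  \<open>Poly_Mapping\<close> uses addition of exponents; it is not commutative.\<close>

datatype 'g word = Word (letters: "('g \<times> bool) list")

instantiation word :: (type) monoid_add
begin
definition zero_word :: "'a word" where "0 = Word []"
definition plus_word :: "'a word \<Rightarrow> 'a word \<Rightarrow> 'a word" where
  "u + v = Word (letters u @ letters v)"
instance
  by standard (simp_all add: zero_word_def plus_word_def)
end

type_synonym 'g star_poly = "'g word \<Rightarrow>\<^sub>0 complex"

definition free_star_algebra :: "'g set \<Rightarrow> 'g star_poly set" where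
  "free_star_algebra G = {p. \<forall>w\<in>Poly_Mapping.keys p. fst ` set (letters w) \<subseteq> G}"

definition gen :: "'g \<Rightarrow> 'g star_poly" where
  "gen g = Poly_Mapping.single (Word [(g, False)]) 1"

definition pscale :: "complex \<Rightarrow> 'g star_poly \<Rightarrow> 'g star_poly" where
  "pscale c p = Poly_Mapping.single 0 c * p"

definition word_star :: "'g word \<Rightarrow> 'g word" where
  "word_star w = Word (rev (map (\<lambda>(g, b). (g, \<not> b)) (letters w)))"

definition pstar :: "'g star_poly \<Rightarrow> 'g star_poly" where
  "pstar p = (\<Sum>w\<in>Poly_Mapping.keys p.
     Poly_Mapping.single (word_star w) (cnj (Poly_Mapping.lookup p w)))"


section \<open>The universal unital C*-algebra on generators and relations\<close>

text \<open>A relation is a *-polynomial that is required to vanish.  The C*-seminorms vanishing on the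
  relations \<open>R\<close> are exactly the maps \<open>p \<mapsto> \<parallel>p(t)\<parallel>\<close>, where \<open>t\<close> ranges over the families of elements
  of C*-algebras that satisfy \<open>R\<close>.\<close>

definition cstar_seminorm :: "'g set \<Rightarrow> 'g star_poly set \<Rightarrow> ('g star_poly \<Rightarrow> real) \<Rightarrow> bool" where
  "cstar_seminorm G R \<nu> \<longleftrightarrow>
     (\<forall>p\<in>free_star_algebra G. \<forall>q\<in>free_star_algebra G.
        \<nu> (p + q) \<le> \<nu> p + \<nu> q \<and> \<nu> (p * q) \<le> \<nu> p * \<nu> q) \<and>
     (\<forall>p\<in>free_star_algebra G. (\<forall>c. \<nu> (pscale c p) = cmod c * \<nu> p) \<and> \<nu> (pstar p * p) = (\<nu> p)\<^sup>2) \<and>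
     (\<forall>r\<in>R. \<nu> r = 0)"

text \<open>The largest C*-seminorm vanishing on \<open>R\<close>.  The supremum is meaningful only if it is finite for
  every \<open>p\<close>, which is the case whenever \<open>R\<close> forces bounds on the norms of the generators (as it does
  when every generator is required to be an isometry).\<close>

definition univ_norm :: "'g set \<Rightarrow> 'g star_poly set \<Rightarrow> 'g star_poly \<Rightarrow> real" where
  "univ_norm G R p = (SUP \<nu>\<in>{\<nu>. cstar_seminorm G R \<nu>}. \<nu> p)"

text \<open>The universal C*-algebra is the Hausdorff completion of the free *-algebra in this seminorm:
  Cauchy sequences modulo null sequences.\<close>

definition cauchy_seqs :: "'g set \<Rightarrow> 'g star_poly set \<Rightarrow> (nat \<Rightarrow> 'g star_poly) set" where
  "cauchy_seqs G R = {x. range x \<subseteq> free_star_algebra G \<and>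
     (\<forall>e>0. \<exists>N. \<forall>k\<ge>N. \<forall>l\<ge>N. univ_norm G R (x k - x l) < e)}"

definition null_rel :: "'g set \<Rightarrow> 'g star_poly set \<Rightarrow> ((nat \<Rightarrow> 'g star_poly) \<times> (nat \<Rightarrow> 'g star_poly)) set" where
  "null_rel G R = {(x, y). x \<in> cauchy_seqs G R \<and> y \<in> cauchy_seqs G R \<and>
     (\<lambda>k. univ_norm G R (x k - y k)) \<longlonglongrightarrow> 0}"

definition univ_cstar :: "'g set \<Rightarrow> 'g star_poly set \<Rightarrow> (nat \<Rightarrow> 'g star_poly) set star_algebra" where
  "univ_cstar G R = \<lparr>
     carrier = cauchy_seqs G R // null_rel G R,
     monoid.mult = (\<lambda>X Y. \<Union>x\<in>X. \<Union>y\<in>Y. null_rel G R `` {\<lambda>k. x k * y k}),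
     one = null_rel G R `` {\<lambda>k. 1},
     zero = null_rel G R `` {\<lambda>k. 0},
     add = (\<lambda>X Y. \<Union>x\<in>X. \<Union>y\<in>Y. null_rel G R `` {\<lambda>k. x k + y k}),
     smult = (\<lambda>c X. \<Union>x\<in>X. null_rel G R `` {\<lambda>k. pscale c (x k)}),
     star = (\<lambda>X. \<Union>x\<in>X. null_rel G R `` {\<lambda>k. pstar (x k)}),
     cnorm = (\<lambda>X. THE r. \<forall>x\<in>X. (\<lambda>k. univ_norm G R (x k)) \<longlonglongrightarrow> r)\<rparr>"

definition univ_gen :: "'g set \<Rightarrow> 'g star_poly set \<Rightarrow> 'g \<Rightarrow> (nat \<Rightarrow> 'g star_poly) set" where
  "univ_gen G R g = null_rel G R `` {\<lambda>k. gen g}"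


section \<open>Bounded operators on \<open>\<ell>\<^sup>2\<close> of an index set\<close>

text \<open>Vectors are functions vanishing outside the index set; operators are extensional on the
  space of vectors, so that operators which are equal as maps on \<open>\<ell>\<^sup>2\<close> are equal in the logic.\<close>

definition ell2 :: "'i set \<Rightarrow> ('i \<Rightarrow> complex) set" where
  "ell2 I = {f. (\<forall>i. i \<notin> I \<longrightarrow> f i = 0) \<and> (\<lambda>i. (cmod (f i))\<^sup>2) summable_on I}"

definition ell2_inner :: "'i set \<Rightarrow> ('i \<Rightarrow> complex) \<Rightarrow> ('i \<Rightarrow> complex) \<Rightarrow> complex" where
  "ell2_inner I f g = (\<Sum>\<^sub>\<infinity>i\<in>I. cnj (f i) * g i)"

definition ell2_norm :: "'i set \<Rightarrow> ('i \<Rightarrow> complex) \<Rightarrow> real" where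
  "ell2_norm I f = sqrt (\<Sum>\<^sub>\<infinity>i\<in>I. (cmod (f i))\<^sup>2)"

type_synonym 'i op = "('i \<Rightarrow> complex) \<Rightarrow> ('i \<Rightarrow> complex)"

definition bounded_ops :: "'i set \<Rightarrow> 'i op set" where
  "bounded_ops I = {A \<in> ell2 I \<rightarrow>\<^sub>E ell2 I.
     (\<forall>f\<in>ell2 I. \<forall>g\<in>ell2 I. A (\<lambda>i. f i + g i) = (\<lambda>i. A f i + A g i)) \<and>
     (\<forall>c. \<forall>f\<in>ell2 I. A (\<lambda>i. c * f i) = (\<lambda>i. c * A f i)) \<and>
     (\<exists>C. \<forall>f\<in>ell2 I. ell2_norm I (A f) \<le> C * ell2_norm I f)}"

definition op_adj :: "'i set \<Rightarrow> 'i op \<Rightarrow> 'i op" where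
  "op_adj I A = (THE B. B \<in> bounded_ops I \<and>
     (\<forall>f\<in>ell2 I. \<forall>g\<in>ell2 I. ell2_inner I (B f) g = ell2_inner I f (A g)))"

definition op_algebra :: "'i set \<Rightarrow> 'i op star_algebra" where
  "op_algebra I = \<lparr>
     carrier = bounded_ops I,
     monoid.mult = (\<lambda>A B. compose (ell2 I) A B),
     one = (\<lambda>f\<in>ell2 I. f),
     zero = (\<lambda>f\<in>ell2 I. \<lambda>i. 0),
     add = (\<lambda>A B. \<lambda>f\<in>ell2 I. \<lambda>i. A f i + B f i),
     smult = (\<lambda>c A. \<lambda>f\<in>ell2 I. \<lambda>i. c * A f i),
     star = op_adj I,
     cnorm = (\<lambda>A. SUP f\<in>{f \<in> ell2 I. ell2_norm I f \<le> 1}. ell2_norm I (A f))\<rparr>"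

text \<open>The Hilbert space tensor product of the \<open>\<ell>\<^sup>2(I j)\<close>, for \<open>j\<close> in a finite set \<open>J\<close>, is \<open>\<ell>\<^sup>2\<close> of the
  product of the index sets, with the elementary tensors given by \<open>tensor_vec\<close>.\<close>

definition tensor_vec :: "'j set \<Rightarrow> ('j \<Rightarrow> 'i set) \<Rightarrow> ('j \<Rightarrow> 'i \<Rightarrow> complex) \<Rightarrow> ('j \<Rightarrow> 'i) \<Rightarrow> complex" where
  "tensor_vec J I f = (\<lambda>k. if k \<in> Pi\<^sub>E J I then \<Prod>j\<in>J. f j (k j) else 0)"

definition tensor_op :: "'j set \<Rightarrow> ('j \<Rightarrow> 'i set) \<Rightarrow> ('j \<Rightarrow> 'i op) \<Rightarrow> ('j \<Rightarrow> 'i) op" where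
  "tensor_op J I A = (THE B. B \<in> bounded_ops (Pi\<^sub>E J I) \<and>
     (\<forall>f. (\<forall>j\<in>J. f j \<in> ell2 (I j)) \<longrightarrow>
        B (tensor_vec J I f) = tensor_vec J I (\<lambda>j. A j (f j))))"


section \<open>The algebra \<open>C\<^sub>\<Theta>\<close> and its representation by twisted shifts\<close>

text \<open>Only the values \<open>\<theta> i j\<close> with \<open>1 \<le> i < j \<le> m + n\<close> are used.\<close>

definition twist_relations :: "nat \<Rightarrow> nat \<Rightarrow> (nat \<Rightarrow> nat \<Rightarrow> real) \<Rightarrow> nat star_poly set" where
  "twist_relations m n \<theta> =
     {pstar (gen i) * gen j - pscale (exp (- 2 * of_real pi * \<i> * of_real (\<theta> i j))) (gen j * pstar (gen i))
       | i j. 1 \<le> i \<and> i < j \<and> j \<le> m + n} \<union>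
     {pstar (gen i) * gen i - 1 | i. 1 \<le> i \<and> i \<le> m + n} \<union>
     {gen i * pstar (gen i) - 1 | i. 1 \<le> i \<and> i \<le> m}"

definition C_Theta :: "nat \<Rightarrow> nat \<Rightarrow> (nat \<Rightarrow> nat \<Rightarrow> real) \<Rightarrow> (nat \<Rightarrow> nat star_poly) set star_algebra" where
  "C_Theta m n \<theta> = univ_cstar {1..m+n} (twist_relations m n \<theta>)"

definition s_gen :: "nat \<Rightarrow> nat \<Rightarrow> (nat \<Rightarrow> nat \<Rightarrow> real) \<Rightarrow> nat \<Rightarrow> (nat \<Rightarrow> nat star_poly) set" where
  "s_gen m n \<theta> = univ_gen {1..m+n} (twist_relations m n \<theta>)"

text \<open>The shift \<open>e\<^sub>l \<mapsto> e\<^sub>l\<^sub>-\<^sub>1\<close>, with \<open>e\<^sub>l\<^sub>-\<^sub>1\<close> read as \<open>0\<close> if \<open>l - 1 \<notin> I\<close>: bilateral for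
  \<open>I = UNIV\<close>, unilateral for \<open>I = {0..}\<close>.\<close>

definition shift_op :: "int set \<Rightarrow> int op" where
  "shift_op I = (\<lambda>f\<in>ell2 I. \<lambda>l. if l \<in> I then f (l + 1) else 0)"

text \<open>The operator \<open>e\<^bsup>2\<pi>i\<theta>N\<^esup>\<close>.\<close>

definition phase_op :: "int set \<Rightarrow> real \<Rightarrow> int op" where
  "phase_op I \<theta> = (\<lambda>f\<in>ell2 I. \<lambda>l. exp (2 * of_real pi * \<i> * of_real \<theta> * of_int l) * f l)"

definition leg :: "nat \<Rightarrow> nat \<Rightarrow> int set" where
  "leg m j = (if j \<le> m then UNIV else {0..})"

definition H_index :: "nat \<Rightarrow> nat \<Rightarrow> (nat \<Rightarrow> int) set" where
  "H_index m n = Pi\<^sub>E {1..m+n} (leg m)"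

definition T_op :: "nat \<Rightarrow> nat \<Rightarrow> (nat \<Rightarrow> nat \<Rightarrow> real) \<Rightarrow> nat \<Rightarrow> (nat \<Rightarrow> int) op" where
  "T_op m n \<theta> i = tensor_op {1..m+n} (leg m)
     (\<lambda>j. if j < i then (\<lambda>f\<in>ell2 (leg m j). f)
          else if j = i then op_adj (leg m j) (shift_op (leg m j))
          else phase_op (leg m j) (\<theta> i j))"

text \<open>Representations of \<open>C\<^sub>\<Theta>\<close> on \<open>\<ell>\<^sup>2(\<int>)\<^bsup>\<otimes>m\<^esup> \<otimes> \<ell>\<^sup>2(\<nat>\<^sub>0)\<^bsup>\<otimes>n\<^esup>\<close> with \<open>s\<^sub>i \<mapsto> T\<^sub>i\<close>, extensional so that they
  are determined by their values on the algebra.\<close>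

definition twist_reps :: "nat \<Rightarrow> nat \<Rightarrow> (nat \<Rightarrow> nat \<Rightarrow> real) \<Rightarrow>
    ((nat \<Rightarrow> nat star_poly) set \<Rightarrow> (nat \<Rightarrow> int) op) set" where
  "twist_reps m n \<theta> =
     {\<Psi> \<in> star_hom (C_Theta m n \<theta>) (op_algebra (H_index m n)) \<inter> extensional (carrier (C_Theta m n \<theta>)).
       \<forall>i\<in>{1..m+n}. \<Psi> (s_gen m n \<theta> i) = T_op m n \<theta> i}"

end

theory Submission
  imports Defs
begin

text \<open>By the C*-identity, \<open>\<nu>(p)\<^sup>2\<^sup>N = \<nu>((p\<^sup>*p)\<^sup>N)\<close> for every C*-seminorm \<open>\<nu>\<close> and every power
  \<open>N\<close> of two, so factors that are polynomial in \<open>N\<close> do not matter, and it suffices to bound the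
  universal norm of \<open>p\<close> by the operator norm of \<open>p(T)\<close> up to a factor that is polynomial in the degree
  of \<open>p\<close>.  The relations bring every word, up to a phase, into a normal form: the product over \<open>i\<close> of
  a power of \<open>s\<^sub>i\<close> and a power of \<open>s\<^sub>i\<^sup>*\<close>.  There are only polynomially many normal forms of given
  length, each has norm at most one, and their coefficients are recovered from boundedly many matrix
  entries of \<open>p(T)\<close>.  Hence the two norms agree on *-polynomials, and the representation is the
  isometric extension to the completion.  It is unique because *-homomorphisms are contractive:
  \<open>\<parallel>A\<parallel>\<^sup>2\<close> lies in the spectrum of \<open>A\<^sup>*A\<close>, while \<open>\<mu> - x\<^sup>*x\<close> is invertible in the
  completion for \<open>\<mu> > \<parallel>x\<parallel>\<^sup>2\<close>.\<close>

section \<open>Star polynomials\<close>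

text \<open>The relations give only the exchange of \<open>s_i^*\<close> with \<open>s_j\<close>.
  That \<open>s_i s_j\<close> and \<open>s_j s_i\<close> also agree up to a phase is a consequence
  of the C*-identity and holds modulo elements of seminorm zero, so normal forms live modulo that
  kernel. The phases are not computed: a word has one phase in the algebra and one as an operator,
  found independently, and they are matched afterwards because null elements act as zero. On a
  unilateral leg the monomials \<open>s^a s^*b\<close> and \<open>s^(a+1) s^*(b+1)\<close> have the
  same nonzero matrix entries except one, so no single entry isolates a coefficient. Subtracting the
  entries at neighbouring points does; with n such legs this takes 2^n entries, whence the constant
  \<open>2 ^ n\<close>. Each leg has two exponents of size at most the degree D, whence
  \<open>(D + 1) ^ (2 * (m + n))\<close>. The degree of an N-th power is linear in N, so this factor
  stays polynomial in N and is invisible to N-th roots.\<close>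

lemma lookup_pscale: "Poly_Mapping.lookup (pscale c p) w = c * Poly_Mapping.lookup p w"
proof -
  have "pscale c p = Poly_Mapping.map ((*) c) p"
    by (simp add: pscale_def mult_map_scale_conv_mult)
  then show ?thesis by (simp add: Poly_Mapping.map.rep_eq when_def)
qed

lemma star_poly_eq_sum:
  fixes p :: "'a \<Rightarrow>\<^sub>0 complex"
  shows "p = (\<Sum>w\<in>Poly_Mapping.keys p. Poly_Mapping.single w (Poly_Mapping.lookup p w))"
proof (rule poly_mapping_eqI)
  fix v
  show "Poly_Mapping.lookup p v =
      Poly_Mapping.lookup (\<Sum>w\<in>Poly_Mapping.keys p. Poly_Mapping.single w (Poly_Mapping.lookup p w)) v"
    by (cases "v \<in> Poly_Mapping.keys p")
      (auto simp: lookup_sum lookup_single when_def in_keys_iff sum.delta)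
qed

lemma star_poly_induct [case_names single add]:
  fixes p :: "'a \<Rightarrow>\<^sub>0 complex"
  assumes single: "\<And>w c. P (Poly_Mapping.single w c)"
    and add: "\<And>p q. P p \<Longrightarrow> P q \<Longrightarrow> P (p + q)"
  shows "P p"
proof -
  have "P (\<Sum>w\<in>W. Poly_Mapping.single w (Poly_Mapping.lookup p w))" if "finite W" for W
    using that
  proof induction
    case empty
    show ?case using single[of undefined 0] by simp
  next
    case (insert w W)
    then show ?case by (simp add: add single)
  qed
  from this[OF finite_keys, of p] show ?thesis by (simp flip: star_poly_eq_sum)
qed

lemma pscale_single [simp]:
  "pscale c (Poly_Mapping.single w d) = Poly_Mapping.single w (c * d)"
  by (simp add: pscale_def mult_single)

lemma pscale_add: "pscale c (p + q) = pscale c p + pscale c q"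
  by (simp add: pscale_def algebra_simps)

lemma pscale_diff: "pscale c (p - q) = pscale c p - pscale c q"
  by (simp add: pscale_def algebra_simps)

lemma pscale_pscale [simp]: "pscale c (pscale d p) = pscale (c * d) p"
  by (simp add: pscale_def mult_single flip: mult.assoc)

lemma pscale_one [simp]: "pscale 1 p = p"
  by (simp add: pscale_def)

lemma pscale_zero [simp]: "pscale 0 p = 0" "pscale c 0 = 0"
  by (simp_all add: pscale_def)

lemma pscale_minus_one: "pscale (-1) p = - p"
  by (rule poly_mapping_eqI) (simp add: lookup_pscale)

lemma pscale_add_left: "pscale (c + d) p = pscale c p + pscale d p"
  by (rule poly_mapping_eqI) (simp add: lookup_pscale lookup_add algebra_simps)

lemma pscale_mult_left: "pscale c p * q = pscale c (p * q)"
  by (simp add: pscale_def mult.assoc)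

lemma pscale_mult_right: "p * pscale c q = pscale c (p * q)"
proof (induction p rule: star_poly_induct)
  case (single w d)
  then show ?case
    by (induction q rule: star_poly_induct) (simp_all add: mult_single algebra_simps pscale_add)
qed (simp add: algebra_simps pscale_add)

lemma word_star_word_star [simp]: "word_star (word_star w) = w"
  by (cases w) (simp add: word_star_def rev_map comp_def case_prod_beta)

lemma word_star_add: "word_star (v + w) = word_star w + word_star v"
  by (simp add: word_star_def plus_word_def)

lemma lookup_pstar: "Poly_Mapping.lookup (pstar p) w = cnj (Poly_Mapping.lookup p (word_star w))"
proof -
  have *: "word_star v = w \<longleftrightarrow> v = word_star w" for v
    by auto
  show ?thesis
    by (auto simp: pstar_def lookup_sum lookup_single when_def * in_keys_iff)
qed

lemma pstar_single [simp]:
  "pstar (Poly_Mapping.single w c) = Poly_Mapping.single (word_star w) (cnj c)"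
proof (rule poly_mapping_eqI)
  fix v
  have "w = word_star v \<longleftrightarrow> word_star w = v" by auto
  then show "Poly_Mapping.lookup (pstar (Poly_Mapping.single w c)) v =
      Poly_Mapping.lookup (Poly_Mapping.single (word_star w) (cnj c)) v"
    by (auto simp: lookup_pstar lookup_single when_def)
qed

lemma pstar_add: "pstar (p + q) = pstar p + pstar q"
  by (rule poly_mapping_eqI) (simp add: lookup_pstar lookup_add)

lemma pstar_diff: "pstar (p - q) = pstar p - pstar q"
  by (rule poly_mapping_eqI) (simp add: lookup_pstar lookup_minus)

lemma pstar_pscale: "pstar (pscale c p) = pscale (cnj c) (pstar p)"
  by (rule poly_mapping_eqI) (simp add: lookup_pstar lookup_pscale)

lemma pstar_pstar [simp]: "pstar (pstar p) = p"
  by (rule poly_mapping_eqI) (simp add: lookup_pstar)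

lemma pstar_mult: "pstar (p * q) = pstar q * pstar p"
proof (induction p rule: star_poly_induct)
  case (single w d)
  then show ?case
    by (induction q rule: star_poly_induct)
      (simp_all add: mult_single algebra_simps pstar_add word_star_add)
qed (simp add: algebra_simps pstar_add)

lemma pstar_one [simp]: "pstar 1 = 1"
proof -
  have "word_star 0 = (0 :: 'a word)" by (simp add: word_star_def zero_word_def)
  then show ?thesis
    using pstar_single[of "0 :: 'a word" 1] by (simp del: pstar_single)
qed

lemma pstar_zero [simp]: "pstar 0 = 0"
  by (simp add: pstar_def)

lemma pstar_power: "pstar (p ^ k) = pstar p ^ k"
  by (induction k) (simp_all add: pstar_mult power_commutes)

lemma pstar_gen: "pstar (gen g) = Poly_Mapping.single (Word [(g, True)]) 1"
  by (simp add: gen_def word_star_def)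

section \<open>The unital *-subalgebra on a set of generators\<close>

abbreviation "\<A> \<equiv> free_star_algebra"

lemma free_add:
  assumes "p \<in> \<A> G" "q \<in> \<A> G"
  shows "p + q \<in> \<A> G"
  using assms keys_add[of p q] unfolding free_star_algebra_def by blast

lemma free_pscale:
  assumes "p \<in> \<A> G" shows "pscale c p \<in> \<A> G"
  using assms by (auto simp: free_star_algebra_def in_keys_iff lookup_pscale)

lemma free_diff:
  assumes "p \<in> \<A> G" "q \<in> \<A> G"
  shows "p - q \<in> \<A> G"
  using free_add[OF assms(1) free_pscale[OF assms(2), of "-1"]]
  by (simp add: pscale_minus_one)

lemma free_mult:
  assumes "p \<in> \<A> G" "q \<in> \<A> G"
  shows "p * q \<in> \<A> G"
  unfolding free_star_algebra_def
proof (intro CollectI ballI)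
  fix w assume "w \<in> Poly_Mapping.keys (p * q)"
  then obtain u v where "u \<in> Poly_Mapping.keys p" "v \<in> Poly_Mapping.keys q" "w = u + v"
    using keys_mult[of p q] by blast
  then show "fst ` set (letters w) \<subseteq> G"
    using assms by (auto simp: free_star_algebra_def plus_word_def image_Un)
qed

lemma free_pstar:
  assumes "p \<in> \<A> G" shows "pstar p \<in> \<A> G"
  unfolding free_star_algebra_def
proof (intro CollectI ballI)
  fix w assume "w \<in> Poly_Mapping.keys (pstar p)"
  then have "word_star w \<in> Poly_Mapping.keys p"
    by (simp add: in_keys_iff lookup_pstar)
  then have "fst ` set (letters (word_star w)) \<subseteq> G"
    using assms by (auto simp: free_star_algebra_def)
  also have "fst ` set (letters (word_star w)) = fst ` set (letters w)"
    by (force simp: word_star_def)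
  finally show "fst ` set (letters w) \<subseteq> G" .
qed

lemma free_single:
  "fst ` set (letters w) \<subseteq> G \<Longrightarrow> Poly_Mapping.single w c \<in> \<A> G"
  by (auto simp: free_star_algebra_def in_keys_iff lookup_single when_def)

lemma free_zero: "0 \<in> \<A> G"
  by (simp add: free_star_algebra_def)

lemma free_one: "1 \<in> \<A> G"
  by (simp add: free_star_algebra_def zero_word_def)

lemma free_gen: "g \<in> G \<Longrightarrow> gen g \<in> \<A> G"
  unfolding gen_def by (rule free_single) simp

lemma free_power: "p \<in> \<A> G \<Longrightarrow> p ^ k \<in> \<A> G"
  by (induction k) (simp_all add: free_one free_mult)

lemma free_sum:
  "(\<And>x. x \<in> A \<Longrightarrow> f x \<in> \<A> G) \<Longrightarrow> sum f A \<in> \<A> G"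
  by (induction A rule: infinite_finite_induct)
    (auto simp: free_zero free_add)

lemmas free_closed =
  free_add free_pscale free_diff free_mult
  free_pstar free_zero free_one free_gen
  free_power free_sum

lemma single_word_Cons:
  "Poly_Mapping.single (Word (x # xs)) 1 =
     (if snd x then pstar (gen (fst x)) else gen (fst x)) * (Poly_Mapping.single (Word xs) 1 :: 'g star_poly)"
  by (cases x) (auto simp: gen_def pstar_gen mult_single plus_word_def word_star_def)

text \<open>A homomorphism is known only on generators and is compatible only with the *-algebra
  operations, so the induction follows these operations instead of words with coefficients.
  Membership is carried along because homomorphisms are evaluated at members only.\<close>

lemma free_induct [consumes 1, case_names one gen gen_star scale add mult]:
  assumes p: "p \<in> \<A> G"
    and one: "P 1"
    and gen: "\<And>g. g \<in> G \<Longrightarrow> P (gen g)" and gen_star: "\<And>g. g \<in> G \<Longrightarrow> P (pstar (gen g))"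
    and scale: "\<And>c p. p \<in> \<A> G \<Longrightarrow> P p \<Longrightarrow> P (pscale c p)"
    and add: "\<And>p q. p \<in> \<A> G \<Longrightarrow> q \<in> \<A> G \<Longrightarrow> P p \<Longrightarrow> P q \<Longrightarrow> P (p + q)"
    and mult: "\<And>p q. p \<in> \<A> G \<Longrightarrow> q \<in> \<A> G \<Longrightarrow> P p \<Longrightarrow> P q \<Longrightarrow> P (p * q)"
  shows "P p"
proof -
  have word: "P (Poly_Mapping.single (Word xs) 1)" if "fst ` set xs \<subseteq> G" for xs
    using that
  proof (induction xs)
    case Nil
    then show ?case using one by (simp flip: zero_word_def)
  next
    case (Cons x xs)
    then have "fst x \<in> G" "P (Poly_Mapping.single (Word xs) 1)" by auto
    moreover have "Poly_Mapping.single (Word xs) 1 \<in> \<A> G"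
      by (rule free_single) (use Cons in auto)
    ultimately show ?case
      by (auto simp: single_word_Cons intro!: mult gen gen_star free_closed)
  qed
  have single: "P (Poly_Mapping.single w c)" "Poly_Mapping.single w c \<in> \<A> G"
    if "fst ` set (letters w) \<subseteq> G" for w c
  proof -
    show "Poly_Mapping.single w c \<in> \<A> G"
      by (rule free_single) fact
    have "Poly_Mapping.single w 1 \<in> \<A> G"
      by (rule free_single) fact
    with scale[OF _ word[of "letters w"], of c] that show "P (Poly_Mapping.single w c)"
      by simp
  qed
  have sums: "P (\<Sum>w\<in>W. Poly_Mapping.single w (Poly_Mapping.lookup p w)) \<and>
      (\<Sum>w\<in>W. Poly_Mapping.single w (Poly_Mapping.lookup p w)) \<in> \<A> G"
    if "finite W" "\<forall>w\<in>W. fst ` set (letters w) \<subseteq> G" for W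
    using that
  proof induction
    case empty
    show ?case using scale[OF free_one one, of 0] by (simp add: free_zero)
  next
    case (insert w W)
    then show ?case by (auto intro!: add free_add simp: single)
  qed
  from sums[OF finite_keys, of p] p show ?thesis
    by (simp add: free_star_algebra_def flip: star_poly_eq_sum)
qed

section \<open>C*-seminorms\<close>

locale cstar_norm =
  fixes G :: "'g set" and R :: "'g star_poly set" and \<nu> :: "'g star_poly \<Rightarrow> real"
  assumes seminorm: "cstar_seminorm G R \<nu>"
begin

lemma triangle: "p \<in> \<A> G \<Longrightarrow> q \<in> \<A> G \<Longrightarrow> \<nu> (p + q) \<le> \<nu> p + \<nu> q"
  and submult: "p \<in> \<A> G \<Longrightarrow> q \<in> \<A> G \<Longrightarrow> \<nu> (p * q) \<le> \<nu> p * \<nu> q"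
  and scale: "p \<in> \<A> G \<Longrightarrow> \<nu> (pscale c p) = cmod c * \<nu> p"
  and cstar: "p \<in> \<A> G \<Longrightarrow> \<nu> (pstar p * p) = (\<nu> p)\<^sup>2"
  and relation: "r \<in> R \<Longrightarrow> \<nu> r = 0"
  using seminorm by (auto simp: cstar_seminorm_def)

lemma zero: "\<nu> 0 = 0"
  using scale[of 0 0] by (simp add: free_zero)

lemma uminus: "p \<in> \<A> G \<Longrightarrow> \<nu> (- p) = \<nu> p"
  using scale[of p "-1"] by (simp add: pscale_minus_one)

lemma diff_commute: "p \<in> \<A> G \<Longrightarrow> q \<in> \<A> G \<Longrightarrow> \<nu> (p - q) = \<nu> (q - p)"
  using uminus[of "p - q"] by (simp add: free_diff)

lemma triangle_diff:
  assumes "p \<in> \<A> G" "q \<in> \<A> G"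
  shows "\<nu> (p - q) \<le> \<nu> p + \<nu> q"
  using triangle[of p "pscale (-1) q"] uminus[OF assms(2)] free_pscale[OF assms(2), of "-1"]
    assms by (simp add: pscale_minus_one)

text \<open>Nonnegativity is not a clause of \<open>cstar_seminorm\<close>; it follows from 0 =
  \<nu>(p - p) \<le> 2 \<nu>(p).\<close>

lemma nonneg: "p \<in> \<A> G \<Longrightarrow> 0 \<le> \<nu> p"
  using triangle_diff[of p p] by (simp add: zero)

lemma triangle_trans:
  assumes "p \<in> \<A> G" "q \<in> \<A> G" "r \<in> \<A> G"
  shows "\<nu> (p - r) \<le> \<nu> (p - q) + \<nu> (q - r)"
  using triangle[of "p - q" "q - r"] assms by (simp add: free_diff)

lemma abs_diff_le:
  assumes "p \<in> \<A> G" "q \<in> \<A> G"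
  shows "\<bar>\<nu> p - \<nu> q\<bar> \<le> \<nu> (p - q)"
  using triangle[of "p - q" q] triangle[of "q - p" p] diff_commute[of p q] assms
  by (simp add: free_diff)

text \<open>The C*-identity at 1 gives \<nu> 1 = (\<nu> 1)^2, so the value is 0 or 1; it is 0 for
  the zero seminorm.\<close>

lemma one_le: "\<nu> 1 \<le> 1"
proof (rule ccontr)
  assume "\<not> \<nu> 1 \<le> 1"
  then have "\<nu> 1 * 1 < \<nu> 1 * \<nu> 1" by (intro mult_strict_left_mono) auto
  then show False
    using cstar[of 1] by (auto simp: free_one power2_eq_square)
qed

text \<open>Cancel one factor in \<open>(\<nu> q)\<^sup>2 = \<nu> (pstar q * q) \<le> \<nu> (pstar
  q) * \<nu> q\<close>, and use the resulting inequality for p and for its adjoint.\<close>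

lemma pstar:
  assumes "p \<in> \<A> G" shows "\<nu> (pstar p) = \<nu> p"
proof -
  have le: "\<nu> q \<le> \<nu> (pstar q)" if q: "q \<in> \<A> G" for q
  proof (cases "\<nu> q = 0")
    case True
    then show ?thesis using nonneg[OF free_pstar[OF q]] by simp
  next
    case False
    have "\<nu> q * \<nu> q \<le> \<nu> (pstar q) * \<nu> q"
      using cstar[OF q] submult[OF free_pstar[OF q] q] by (simp add: power2_eq_square)
    then show ?thesis using False nonneg[OF q] by (simp add: mult_le_cancel_right)
  qed
  show ?thesis
    using le[OF assms] le[OF free_pstar[OF assms]] by simp
qed

lemma power_le:
  assumes "p \<in> \<A> G" shows "\<nu> (p ^ k) \<le> \<nu> p ^ k"
proof (induction k)
  case (Suc k)
  have "\<nu> (p * p ^ k) \<le> \<nu> p * \<nu> (p ^ k)"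
    using assms by (intro submult free_power)
  also have "\<dots> \<le> \<nu> p * \<nu> p ^ k"
    using Suc assms by (intro mult_left_mono nonneg)
  finally show ?case by simp
qed (simp add: one_le)

text \<open>Powers of a self-adjoint element are self-adjoint, so each squaring is an instance of
  the C*-identity. Equality, in place of the inequality from submultiplicativity, is what lets
  bounds on high powers be pulled back to p.\<close>

lemma selfadjoint_power:
  assumes "p \<in> \<A> G" "pstar p = p" shows "\<nu> (p ^ 2 ^ k) = \<nu> p ^ 2 ^ k"
proof (induction k)
  case (Suc k)
  have "\<nu> (p ^ 2 ^ Suc k) = \<nu> (pstar (p ^ 2 ^ k) * p ^ 2 ^ k)"
    by (simp add: pstar_power assms(2) mult_2 power_add)
  also have "\<dots> = (\<nu> (p ^ 2 ^ k))\<^sup>2"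
    using assms by (intro cstar free_power)
  finally show ?case using Suc by (simp add: power_mult [symmetric] mult.commute)
qed simp

lemma sum_le:
  assumes "\<And>x. x \<in> A \<Longrightarrow> f x \<in> \<A> G"
  shows "\<nu> (sum f A) \<le> (\<Sum>x\<in>A. \<nu> (f x))"
  using assms
proof (induction A rule: infinite_finite_induct)
  case (insert x A)
  have "\<nu> (f x + sum f A) \<le> \<nu> (f x) + \<nu> (sum f A)"
    using insert.prems by (intro triangle free_sum) auto
  with insert show ?case by fastforce
qed (simp_all add: zero)

text \<open>Together with the next two lemmas: elements of seminorm zero form a two-sided ideal, so
  a relation may be applied inside a product.\<close>

lemma eq_zero_mult_left:
  assumes "p \<in> \<A> G" "q \<in> \<A> G" "\<nu> p = 0" shows "\<nu> (q * p) = 0"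
  using submult[of q p] nonneg[of "q * p"] assms by (simp add: free_mult)

lemma eq_zero_mult_right:
  assumes "p \<in> \<A> G" "q \<in> \<A> G" "\<nu> p = 0" shows "\<nu> (p * q) = 0"
  using submult[of p q] nonneg[of "p * q"] assms by (simp add: free_mult)

lemma eq_zero_add:
  assumes "p \<in> \<A> G" "q \<in> \<A> G" "\<nu> p = 0" "\<nu> q = 0"
  shows "\<nu> (p + q) = 0"
  using triangle[of p q] nonneg[of "p + q"] assms by (simp add: free_add)

end

text \<open>Isometry of the generators bounds all C*-seminorms of a fixed *-polynomial at once,
  which makes the supremum in \<open>univ_norm\<close> finite.\<close>

locale isometric_relations =
  fixes G :: "'g set" and R :: "'g star_poly set"
  assumes isometry: "g \<in> G \<Longrightarrow> pstar (gen g) * gen g - 1 \<in> R"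
begin

lemma word_norm_le:
  assumes "cstar_seminorm G R \<nu>" "fst ` set xs \<subseteq> G"
  shows "\<nu> (Poly_Mapping.single (Word xs) 1) \<le> 1"
  using assms(2)
proof (induction xs)
  interpret cstar_norm G R \<nu> by unfold_locales fact
  case Nil
  then show ?case using one_le by (simp flip: zero_word_def)
next
  interpret cstar_norm G R \<nu> by unfold_locales fact
  \<comment> \<open>The relation makes \<nu>(g*g) equal to \<nu> 1, and the C*-identity turns this
    into a bound on \<nu> g.\<close>
  have gen_le: "\<nu> (gen g) \<le> 1" if "g \<in> G" for g
  proof -
    have g: "gen g \<in> \<A> G" using that by (rule free_gen)
    have "\<bar>\<nu> (pstar (gen g) * gen g) - \<nu> 1\<bar> \<le> \<nu> (pstar (gen g) * gen g - 1)"
      using g by (intro abs_diff_le free_mult free_pstar free_one)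
    then have "(\<nu> (gen g))\<^sup>2 = \<nu> 1"
      using relation[OF isometry[OF that]] cstar[OF g] by simp
    then show ?thesis
      using one_le by (metis abs_le_D1 abs_square_le_1)
  qed
  case (Cons x xs)
  let ?l = "if snd x then pstar (gen (fst x)) else gen (fst x)"
  have x: "fst x \<in> G" "fst ` set xs \<subseteq> G" using Cons.prems by auto
  have l: "?l \<in> \<A> G" using x by (auto intro!: free_closed)
  have xs: "Poly_Mapping.single (Word xs) 1 \<in> \<A> G"
    using x by (intro free_single) simp
  have "\<nu> (?l * Poly_Mapping.single (Word xs) 1) \<le> \<nu> ?l * \<nu> (Poly_Mapping.single (Word xs) 1)"
    using l xs by (rule submult)
  also have "\<dots> \<le> 1 * 1"
    using x gen_le Cons.IH nonneg[OF xs] nonneg[OF l]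
    by (intro mult_mono) (auto simp: pstar free_gen)
  finally show ?case by (simp only: single_word_Cons mult_1)
qed

text \<open>The right-hand side does not depend on \<nu>; it is the upper bound that the supremum
  needs.\<close>

lemma norm_le:
  assumes "cstar_seminorm G R \<nu>" "p \<in> \<A> G"
  shows "\<nu> p \<le> (\<Sum>w\<in>Poly_Mapping.keys p. cmod (Poly_Mapping.lookup p w))"
proof -
  interpret cstar_norm G R \<nu> by unfold_locales fact
  let ?f = "\<lambda>w. Poly_Mapping.single w (Poly_Mapping.lookup p w)"
  have w: "fst ` set (letters w) \<subseteq> G" if "w \<in> Poly_Mapping.keys p" for w
    using assms(2) that by (auto simp: free_star_algebra_def)
  have "\<nu> (\<Sum>w\<in>Poly_Mapping.keys p. ?f w) \<le> (\<Sum>w\<in>Poly_Mapping.keys p. \<nu> (?f w))"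
    using w by (intro sum_le free_single)
  also have "\<dots> \<le> (\<Sum>w\<in>Poly_Mapping.keys p. cmod (Poly_Mapping.lookup p w))"
  proof (rule sum_mono)
    fix v assume v: "v \<in> Poly_Mapping.keys p"
    have "\<nu> (?f v) = cmod (Poly_Mapping.lookup p v) * \<nu> (Poly_Mapping.single v 1)"
      using scale[OF free_single[OF w[OF v], of 1], of "Poly_Mapping.lookup p v"]
      by simp
    also have "\<dots> \<le> cmod (Poly_Mapping.lookup p v) * 1"
      using word_norm_le[OF assms(1) w[OF v]] by (intro mult_left_mono) simp_all
    finally show "\<nu> (?f v) \<le> cmod (Poly_Mapping.lookup p v)" by simp
  qed
  finally show ?thesis by (simp flip: star_poly_eq_sum)
qed

abbreviation "unorm \<equiv> univ_norm G R"

lemma le_univ_norm: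
  assumes "cstar_seminorm G R \<nu>" "p \<in> \<A> G"
  shows "\<nu> p \<le> unorm p"
  unfolding univ_norm_def using assms norm_le[of _ p]
  by (intro cSUP_upper bdd_aboveI2[where M = "\<Sum>w\<in>Poly_Mapping.keys p. cmod (Poly_Mapping.lookup p w)"]) auto

lemma univ_norm_le:
  assumes "\<And>\<nu>. cstar_seminorm G R \<nu> \<Longrightarrow> \<nu> p \<le> c"
  shows "unorm p \<le> c"
proof -
  \<comment> \<open>The zero seminorm makes the index set of the supremum nonempty.\<close>
  have "cstar_seminorm G R (\<lambda>_. 0)" by (simp add: cstar_seminorm_def)
  then show ?thesis unfolding univ_norm_def using assms by (intro cSUP_least) auto
qed

lemma univ_norm_nonneg: "p \<in> \<A> G \<Longrightarrow> 0 \<le> unorm p"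
  using le_univ_norm[of "\<lambda>_. 0" p] by (simp add: cstar_seminorm_def)

lemma cstar_seminorm_univ_norm: "cstar_seminorm G R unorm"
  unfolding cstar_seminorm_def
proof (intro conjI ballI allI)
  fix p q assume p: "p \<in> \<A> G" and q: "q \<in> \<A> G"
  show "unorm (p + q) \<le> unorm p + unorm q"
  proof (rule univ_norm_le)
    fix \<nu> assume \<nu>: "cstar_seminorm G R \<nu>"
    then interpret cstar_norm G R \<nu> by unfold_locales
    show "\<nu> (p + q) \<le> unorm p + unorm q"
      using triangle[OF p q] le_univ_norm[OF \<nu> p] le_univ_norm[OF \<nu> q] by simp
  qed
  show "unorm (p * q) \<le> unorm p * unorm q"
  proof (rule univ_norm_le)
    fix \<nu> assume \<nu>: "cstar_seminorm G R \<nu>"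
    then interpret cstar_norm G R \<nu> by unfold_locales
    show "\<nu> (p * q) \<le> unorm p * unorm q"
      using submult[OF p q] le_univ_norm[OF \<nu> p] le_univ_norm[OF \<nu> q] nonneg[OF p] nonneg[OF q]
        mult_mono[of "\<nu> p" "unorm p" "\<nu> q" "unorm q"] by simp
  qed
next
  fix p c assume p: "p \<in> \<A> G"
  show "unorm (pscale c p) = cmod c * unorm p"
  proof (rule antisym)
    show "unorm (pscale c p) \<le> cmod c * unorm p"
    proof (rule univ_norm_le)
      fix \<nu> assume \<nu>: "cstar_seminorm G R \<nu>"
      then interpret cstar_norm G R \<nu> by unfold_locales
      show "\<nu> (pscale c p) \<le> cmod c * unorm p"
        using scale[OF p] le_univ_norm[OF \<nu> p] by (simp add: mult_left_mono)
    qed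
    show "cmod c * unorm p \<le> unorm (pscale c p)"
    proof (cases "c = 0")
      case True
      then show ?thesis using univ_norm_nonneg[OF free_zero] by simp
    next
      case False
      have "unorm p \<le> unorm (pscale c p) / cmod c"
      proof (rule univ_norm_le)
        fix \<nu> assume \<nu>: "cstar_seminorm G R \<nu>"
        then interpret cstar_norm G R \<nu> by unfold_locales
        show "\<nu> p \<le> unorm (pscale c p) / cmod c"
          using scale[OF p, of c] le_univ_norm[OF \<nu> free_pscale[OF p, of c]] False
          by (simp add: pos_le_divide_eq mult.commute)
      qed
      then show ?thesis using False by (simp add: pos_le_divide_eq mult.commute)
    qed
  qed
next
  fix p assume p: "p \<in> \<A> G"
  show "unorm (pstar p * p) = (unorm p)\<^sup>2"
  proof (rule antisym)
    show "unorm (pstar p * p) \<le> (unorm p)\<^sup>2"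
    proof (rule univ_norm_le)
      fix \<nu> assume \<nu>: "cstar_seminorm G R \<nu>"
      then interpret cstar_norm G R \<nu> by unfold_locales
      show "\<nu> (pstar p * p) \<le> (unorm p)\<^sup>2"
        using cstar[OF p] le_univ_norm[OF \<nu> p] nonneg[OF p] by (simp add: power_mono)
    qed
    \<comment> \<open>The least upper bound property controls \<nu> p and not its square, so the
      inequality is proved with a root first.\<close>
    have "unorm p \<le> sqrt (unorm (pstar p * p))"
    proof (rule univ_norm_le)
      fix \<nu> assume \<nu>: "cstar_seminorm G R \<nu>"
      then interpret cstar_norm G R \<nu> by unfold_locales
      show "\<nu> p \<le> sqrt (unorm (pstar p * p))"
        using cstar[OF p] le_univ_norm[OF \<nu>, of "pstar p * p"] p
        by (intro real_le_rsqrt) (simp add: free_closed)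
    qed
    then show "(unorm p)\<^sup>2 \<le> unorm (pstar p * p)"
      using univ_norm_nonneg[OF p] univ_norm_nonneg[of "pstar p * p"] p
      by (metis free_mult free_pstar power_mono real_sqrt_pow2)
  qed
next
  fix r assume r: "r \<in> R"
  show "unorm r = 0"
  proof -
    have "(SUP \<nu>\<in>{\<nu>. cstar_seminorm G R \<nu>}. \<nu> r) = (SUP \<nu>\<in>{\<nu>. cstar_seminorm G R \<nu>}. 0)"
      using r by (intro SUP_cong) (auto simp: cstar_seminorm_def)
    moreover have "cstar_seminorm G R (\<lambda>_. 0)" by (simp add: cstar_seminorm_def)
    ultimately show ?thesis unfolding univ_norm_def by (subst (asm) cSUP_const) auto
  qed
qed

sublocale unorm: cstar_norm G R unorm
  by unfold_locales (rule cstar_seminorm_univ_norm)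

end

section \<open>Square-summable families and their bounded operators\<close>

lemma ell2_memD: "f \<in> ell2 I \<Longrightarrow> i \<notin> I \<Longrightarrow> f i = 0"
  by (simp add: ell2_def)

lemma ell2_summable: "f \<in> ell2 I \<Longrightarrow> (\<lambda>i. (cmod (f i))\<^sup>2) summable_on I"
  by (simp add: ell2_def)

lemma ell2_norm_nonneg [simp]: "0 \<le> ell2_norm I f"
  by (simp add: ell2_norm_def infsum_nonneg)

lemma ell2_norm_power2: "(ell2_norm I f)\<^sup>2 = (\<Sum>\<^sub>\<infinity>i\<in>I. (cmod (f i))\<^sup>2)"
  by (simp add: ell2_norm_def infsum_nonneg)

lemma L2_set_le_ell2_norm:
  assumes "f \<in> ell2 I" "finite F" "F \<subseteq> I" shows "L2_set (\<lambda>i. cmod (f i)) F \<le> ell2_norm I f"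
  unfolding L2_set_def ell2_norm_def using assms
  by (intro real_sqrt_le_mono finite_sum_le_infsum ell2_summable) auto

text \<open>Both conclusions come from one uniform bound on finite subsets, so that the finite
  inequalities for \<open>L2_set\<close> carry over without any manipulation of infinite
  sums.\<close>

lemma ell2I:
  assumes "\<And>i. i \<notin> I \<Longrightarrow> f i = 0" "\<And>F. finite F \<Longrightarrow> F \<subseteq> I \<Longrightarrow> L2_set (\<lambda>i. cmod (f i)) F \<le> C"
  shows "f \<in> ell2 I" and "ell2_norm I f \<le> C"
proof -
  have C: "0 \<le> C" using assms(2)[of "{}"] by simp
  have sums: "(\<Sum>i\<in>F. (cmod (f i))\<^sup>2) \<le> C\<^sup>2" if "finite F" "F \<subseteq> I" for F
    using assms(2)[OF that] C by (simp add: L2_set_def real_sqrt_le_iff sqrt_le_D)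
  have summable: "(\<lambda>i. (cmod (f i))\<^sup>2) summable_on I"
    using sums by (intro nonneg_bdd_above_summable_on bdd_aboveI2[where M = "C\<^sup>2"]) auto
  show "f \<in> ell2 I" using summable assms(1) by (simp add: ell2_def)
  have "(\<Sum>\<^sub>\<infinity>i\<in>I. (cmod (f i))\<^sup>2) \<le> C\<^sup>2"
    using summable sums by (rule infsum_le_finite_sums)
  then show "ell2_norm I f \<le> C"
    using C by (simp add: ell2_norm_def real_le_lsqrt infsum_nonneg)
qed

lemma ell2_add:
  assumes "f \<in> ell2 I" "g \<in> ell2 I"
  shows "(\<lambda>i. f i + g i) \<in> ell2 I" "ell2_norm I (\<lambda>i. f i + g i) \<le> ell2_norm I f + ell2_norm I g"
proof -
  have "L2_set (\<lambda>i. cmod (f i + g i)) F \<le> ell2_norm I f + ell2_norm I g"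
    if "finite F" "F \<subseteq> I" for F
  proof -
    have "L2_set (\<lambda>i. cmod (f i + g i)) F \<le> L2_set (\<lambda>i. cmod (f i) + cmod (g i)) F"
      by (intro L2_set_mono norm_triangle_ineq) auto
    also have "\<dots> \<le> L2_set (\<lambda>i. cmod (f i)) F + L2_set (\<lambda>i. cmod (g i)) F"
      by (rule L2_set_triangle_ineq)
    finally show ?thesis
      using L2_set_le_ell2_norm[OF assms(1) that] L2_set_le_ell2_norm[OF assms(2) that] by simp
  qed
  then show "(\<lambda>i. f i + g i) \<in> ell2 I" "ell2_norm I (\<lambda>i. f i + g i) \<le> ell2_norm I f + ell2_norm I g"
    using assms by (auto intro!: ell2I simp: ell2_memD)
qed

lemma ell2_norm_cmult: "ell2_norm I (\<lambda>i. c * f i) = cmod c * ell2_norm I f"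
  by (simp add: ell2_norm_def norm_mult power_mult_distrib infsum_cmult_right' real_sqrt_mult)

lemma ell2_cmult: "f \<in> ell2 I \<Longrightarrow> (\<lambda>i. c * f i) \<in> ell2 I"
  by (simp add: ell2_def norm_mult power_mult_distrib summable_on_cmult_right)

lemma ell2_zero: "(\<lambda>i. 0) \<in> ell2 I"
  by (simp add: ell2_def)

lemma ell2_norm_zero [simp]: "ell2_norm I (\<lambda>i. 0) = 0"
  by (simp add: ell2_norm_def)

lemma ell2_diff:
  assumes "f \<in> ell2 I" "g \<in> ell2 I" shows "(\<lambda>i. f i - g i) \<in> ell2 I"
  using ell2_add(1)[OF assms(1) ell2_cmult[OF assms(2), of "-1"]] by simp

lemma ell2_sum:
  assumes "\<And>x. x \<in> A \<Longrightarrow> f x \<in> ell2 I" shows "(\<lambda>i. \<Sum>x\<in>A. f x i) \<in> ell2 I"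
  using assms by (induction A rule: infinite_finite_induct) (simp_all add: ell2_zero ell2_add)

lemma cmod_le_ell2_norm:
  assumes "f \<in> ell2 I" shows "cmod (f i) \<le> ell2_norm I f"
proof (cases "i \<in> I")
  case True
  then show ?thesis using L2_set_le_ell2_norm[OF assms, of "{i}"] by simp
qed (simp add: ell2_memD[OF assms])

lemma ell2_norm_eq_zero:
  assumes "f \<in> ell2 I" "ell2_norm I f = 0" shows "f = (\<lambda>i. 0)"
proof
  fix i show "f i = 0" using cmod_le_ell2_norm[OF assms(1), of i] assms(2) by simp
qed

text \<open>A Fatou property: on a finite set the norm is continuous under pointwise convergence, so
  the bound C survives on every finite set and hence in total.\<close>

lemma ell2_limit:
  assumes "\<And>k. f k \<in> ell2 I" "\<And>k. ell2_norm I (f k) \<le> C" "\<And>i. (\<lambda>k. f k i) \<longlonglongrightarrow> g i"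
  shows "g \<in> ell2 I" "ell2_norm I g \<le> C"
proof -
  have 1: "g i = 0" if "i \<notin> I" for i
  proof -
    have "(\<lambda>k. f k i) = (\<lambda>k. 0)" using ell2_memD[OF assms(1) that] by simp
    with assms(3)[of i] show ?thesis by (simp add: LIMSEQ_const_iff)
  qed
  have 2: "L2_set (\<lambda>i. cmod (g i)) F \<le> C" if "finite F" "F \<subseteq> I" for F
  proof (rule LIMSEQ_le_const2)
    show "(\<lambda>k. L2_set (\<lambda>i. cmod (f k i)) F) \<longlonglongrightarrow> L2_set (\<lambda>i. cmod (g i)) F"
      unfolding L2_set_def by (intro tendsto_intros assms(3))
    show "\<exists>N. \<forall>k\<ge>N. L2_set (\<lambda>i. cmod (f k i)) F \<le> C"
      using L2_set_le_ell2_norm[OF assms(1) that] assms(2) order_trans by blast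
  qed
  show "g \<in> ell2 I" "ell2_norm I g \<le> C"
    by (rule ell2I[OF 1 2]; assumption)+
qed

section \<open>Inner product and coordinate vectors\<close>

lemma ell2_inner_abs_summable:
  assumes "f \<in> ell2 I" "g \<in> ell2 I"
  shows "(\<lambda>i. norm (cnj (f i) * g i)) summable_on I"
    and "(\<Sum>\<^sub>\<infinity>i\<in>I. cmod (cnj (f i) * g i)) \<le> ell2_norm I f * ell2_norm I g"
proof -
  have *: "(\<Sum>i\<in>F. cmod (cnj (f i) * g i)) \<le> ell2_norm I f * ell2_norm I g"
    if F: "finite F" "F \<subseteq> I" for F
  proof -
    have "(\<Sum>i\<in>F. cmod (cnj (f i) * g i)) \<le> L2_set (\<lambda>i. cmod (f i)) F * L2_set (\<lambda>i. cmod (g i)) F"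
      using L2_set_mult_ineq[of "\<lambda>i. cmod (f i)" "\<lambda>i. cmod (g i)" F] by (simp add: norm_mult)
    also have "\<dots> \<le> ell2_norm I f * ell2_norm I g"
      using assms F by (intro mult_mono L2_set_le_ell2_norm) auto
    finally show ?thesis .
  qed
  show "(\<lambda>i. norm (cnj (f i) * g i)) summable_on I"
    unfolding abs_summable_iff_bdd_above
    using * by (intro bdd_aboveI2[where M = "ell2_norm I f * ell2_norm I g"]) auto
  then show "(\<Sum>\<^sub>\<infinity>i\<in>I. cmod (cnj (f i) * g i)) \<le> ell2_norm I f * ell2_norm I g"
    by (rule infsum_le_finite_sums) (rule *)
qed

lemma ell2_inner_summable:
  "f \<in> ell2 I \<Longrightarrow> g \<in> ell2 I \<Longrightarrow> (\<lambda>i. cnj (f i) * g i) summable_on I"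
  by (rule abs_summable_summable) (rule ell2_inner_abs_summable)

lemma Cauchy_Schwarz_ell2:
  assumes "f \<in> ell2 I" "g \<in> ell2 I"
  shows "cmod (ell2_inner I f g) \<le> ell2_norm I f * ell2_norm I g"
  unfolding ell2_inner_def
  using norm_infsum_bound[OF ell2_inner_abs_summable(1)[OF assms]]
    ell2_inner_abs_summable(2)[OF assms] by simp

lemma ell2_inner_commute: "cnj (ell2_inner I f g) = ell2_inner I g f"
  by (simp add: ell2_inner_def mult.commute flip: infsum_cnj)

lemma ell2_inner_add_right:
  "f \<in> ell2 I \<Longrightarrow> g \<in> ell2 I \<Longrightarrow> h \<in> ell2 I \<Longrightarrow>
    ell2_inner I f (\<lambda>i. g i + h i) = ell2_inner I f g + ell2_inner I f h"
  by (simp add: ell2_inner_def distrib_left infsum_add ell2_inner_summable)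

lemma ell2_inner_cmult_right: "ell2_inner I f (\<lambda>i. c * g i) = c * ell2_inner I f g"
  by (simp add: ell2_inner_def mult.left_commute infsum_cmult_right')

lemma ell2_inner_add_left:
  "f \<in> ell2 I \<Longrightarrow> g \<in> ell2 I \<Longrightarrow> h \<in> ell2 I \<Longrightarrow>
    ell2_inner I (\<lambda>i. g i + h i) f = ell2_inner I g f + ell2_inner I h f"
  by (simp add: ell2_inner_add_right flip: ell2_inner_commute[of I f])

lemma ell2_inner_cmult_left: "ell2_inner I (\<lambda>i. c * g i) f = cnj c * ell2_inner I g f"
  by (simp add: ell2_inner_cmult_right flip: ell2_inner_commute[of I f])

lemma cnj_mult_self: "cnj z * z = of_real ((cmod z)\<^sup>2)"
  by (simp only: complex_norm_square mult.commute)

lemma ell2_inner_self: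
  assumes "f \<in> ell2 I" shows "ell2_inner I f f = of_real ((ell2_norm I f)\<^sup>2)"
  unfolding ell2_inner_def ell2_norm_power2 cnj_mult_self
  by (intro infsumI has_sum_of_real has_sum_infsum ell2_summable assms)

definition unit_vec :: "'i \<Rightarrow> 'i \<Rightarrow> complex" where
  "unit_vec k = (\<lambda>i. if i = k then 1 else 0)"

lemma unit_vec_ell2: "k \<in> I \<Longrightarrow> unit_vec k \<in> ell2 I"
  and ell2_norm_unit_vec: "k \<in> I \<Longrightarrow> ell2_norm I (unit_vec k) \<le> 1"
proof -
  assume k: "k \<in> I"
  have "L2_set (\<lambda>i. cmod (unit_vec k i)) F \<le> 1" if "finite F" for F
    using that by (simp add: L2_set_def unit_vec_def if_distrib [of "\<lambda>x. x\<^sup>2"] if_distrib [of cmod]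
        sum.delta' cong: if_cong)
  then show "unit_vec k \<in> ell2 I" "ell2_norm I (unit_vec k) \<le> 1"
    using k by (auto intro!: ell2I simp: unit_vec_def)
qed

lemma ell2_inner_unit_vec:
  assumes "k \<in> I" shows "ell2_inner I (unit_vec k) g = g k"
proof -
  have "(\<Sum>\<^sub>\<infinity>i\<in>I. cnj (unit_vec k i) * g i) = (\<Sum>\<^sub>\<infinity>i\<in>{k}. g i)"
    using assms by (intro infsum_cong_neutral) (auto simp: unit_vec_def)
  then show ?thesis by (simp add: ell2_inner_def)
qed

lemma ell2_inner_unit_vec_right:
  "k \<in> I \<Longrightarrow> ell2_inner I g (unit_vec k) = cnj (g k)"
  by (simp add: ell2_inner_unit_vec flip: ell2_inner_commute[of I "unit_vec k"])

lemma ell2_finite_approximation: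
  assumes "f \<in> ell2 I" "0 < e"
  obtains F where "finite F" "F \<subseteq> I" "ell2_norm I (\<lambda>i. f i - (if i \<in> F then f i else 0)) \<le> e"
proof -
  obtain F where F: "finite F" "F \<subseteq> I"
      "dist (\<Sum>i\<in>F. (cmod (f i))\<^sup>2) (\<Sum>\<^sub>\<infinity>i\<in>I. (cmod (f i))\<^sup>2) \<le> e\<^sup>2"
    using infsum_finite_approximation[OF ell2_summable[OF assms(1)], of "e\<^sup>2"] assms(2) by auto
  let ?g = "\<lambda>i. f i - (if i \<in> F then f i else 0)"
  have "L2_set (\<lambda>i. cmod (?g i)) E \<le> e" if E: "finite E" "E \<subseteq> I" for E
  proof -
    have "(\<Sum>i\<in>E. (cmod (?g i))\<^sup>2) = (\<Sum>i\<in>E-F. (cmod (f i))\<^sup>2)"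
      using E(1) by (intro sum.mono_neutral_cong_right) auto
    also have "\<dots> = (\<Sum>i\<in>E\<union>F. (cmod (f i))\<^sup>2) - (\<Sum>i\<in>F. (cmod (f i))\<^sup>2)"
      using E(1) F(1) sum.union_disjoint[of "E - F" F "\<lambda>i. (cmod (f i))\<^sup>2"]
      by (simp add: Diff_disjoint Int_commute)
    also have "\<dots> \<le> (\<Sum>\<^sub>\<infinity>i\<in>I. (cmod (f i))\<^sup>2) - (\<Sum>i\<in>F. (cmod (f i))\<^sup>2)"
      using E F assms(1) by (intro diff_right_mono finite_sum_le_infsum ell2_summable) auto
    also have "\<dots> \<le> e\<^sup>2" using F(3) by (simp add: dist_real_def)
    finally show ?thesis using assms(2) by (simp add: L2_set_def real_le_lsqrt)
  qed
  then have "ell2_norm I ?g \<le> e"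
    using assms(1) by (intro ell2I) (auto simp: ell2_memD)
  with F that show ?thesis by blast
qed

section \<open>Bounded operators\<close>

lemma bounded_ops_closed: "A \<in> bounded_ops I \<Longrightarrow> f \<in> ell2 I \<Longrightarrow> A f \<in> ell2 I"
  and bounded_ops_add: "A \<in> bounded_ops I \<Longrightarrow> f \<in> ell2 I \<Longrightarrow> g \<in> ell2 I \<Longrightarrow>
        A (\<lambda>i. f i + g i) = (\<lambda>i. A f i + A g i)"
  and bounded_ops_cmult: "A \<in> bounded_ops I \<Longrightarrow> f \<in> ell2 I \<Longrightarrow> A (\<lambda>i. c * f i) = (\<lambda>i. c * A f i)"
  and bounded_ops_extensional: "A \<in> bounded_ops I \<Longrightarrow> A \<in> extensional (ell2 I)"
  by (auto simp: bounded_ops_def PiE_def)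

lemma bounded_ops_zero: "A \<in> bounded_ops I \<Longrightarrow> A (\<lambda>i. 0) = (\<lambda>i. 0)"
  using bounded_ops_cmult[of A I "\<lambda>i. 0" 0] by (simp add: ell2_zero)

lemma bounded_ops_diff:
  assumes "A \<in> bounded_ops I" "f \<in> ell2 I" "g \<in> ell2 I"
  shows "A (\<lambda>i. f i - g i) = (\<lambda>i. A f i - A g i)"
  using bounded_ops_add[OF assms(1,2) ell2_cmult[OF assms(3), of "-1"]]
    bounded_ops_cmult[OF assms(1,3), of "-1"] by simp

lemma bounded_ops_sum:
  assumes "A \<in> bounded_ops I" "\<And>x. x \<in> X \<Longrightarrow> f x \<in> ell2 I"
  shows "A (\<lambda>i. \<Sum>x\<in>X. c x * f x i) = (\<lambda>i. \<Sum>x\<in>X. c x * A (f x) i)"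
  using assms(2)
proof (induction X rule: infinite_finite_induct)
  case (insert x X)
  have "(\<lambda>i. \<Sum>x\<in>X. c x * f x i) \<in> ell2 I"
    using insert.prems by (intro ell2_sum ell2_cmult) auto
  then show ?case
    using insert by (simp add: bounded_ops_add[OF assms(1)] bounded_ops_cmult[OF assms(1)] ell2_cmult)
qed (simp_all add: bounded_ops_zero[OF assms(1)])

lemma bounded_ops_bound:
  assumes "A \<in> bounded_ops I"
  obtains C where "0 \<le> C" "\<And>f. f \<in> ell2 I \<Longrightarrow> ell2_norm I (A f) \<le> C * ell2_norm I f"
proof -
  obtain C where C: "\<And>f. f \<in> ell2 I \<Longrightarrow> ell2_norm I (A f) \<le> C * ell2_norm I f"
    using assms unfolding bounded_ops_def by blast
  have "ell2_norm I (A f) \<le> \<bar>C\<bar> * ell2_norm I f" if "f \<in> ell2 I" for f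
    using C[OF that] mult_right_mono[OF abs_ge_self ell2_norm_nonneg, of C I f] by linarith
  then show ?thesis using that[of "\<bar>C\<bar>"] by simp
qed

lemma bounded_opsI:
  assumes "A \<in> extensional (ell2 I)" "\<And>f. f \<in> ell2 I \<Longrightarrow> A f \<in> ell2 I"
    "\<And>f g. f \<in> ell2 I \<Longrightarrow> g \<in> ell2 I \<Longrightarrow> A (\<lambda>i. f i + g i) = (\<lambda>i. A f i + A g i)"
    "\<And>c f. f \<in> ell2 I \<Longrightarrow> A (\<lambda>i. c * f i) = (\<lambda>i. c * A f i)"
    "\<And>f. f \<in> ell2 I \<Longrightarrow> ell2_norm I (A f) \<le> C * ell2_norm I f"
  shows "A \<in> bounded_ops I"
  unfolding bounded_ops_def using assms
  by (intro CollectI conjI PiE_I ballI allI exI[of _ C]) (auto simp: extensional_def)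

section \<open>Equality of operators, and adjoints\<close>

lemma op_eqI:
  assumes "A \<in> bounded_ops I" "B \<in> bounded_ops I" "\<And>f. f \<in> ell2 I \<Longrightarrow> A f = B f"
  shows "A = B"
  using assms bounded_ops_extensional extensionalityI by blast

text \<open>The coordinates of the adjoint are forced: the i-th one is the inner product of
  \<open>A (unit_vec i)\<close> with f. The work is to show that they are square-summable; the
  adjoint identity then holds against finitely supported vectors and extends by
  approximation.\<close>

lemma op_adj_exists:
  assumes A: "A \<in> bounded_ops I"
  obtains B where "B \<in> bounded_ops I"
    "\<And>f g. f \<in> ell2 I \<Longrightarrow> g \<in> ell2 I \<Longrightarrow> ell2_inner I (B f) g = ell2_inner I f (A g)"
proof -
  define B where "B = (\<lambda>f\<in>ell2 I. \<lambda>i. if i \<in> I then ell2_inner I (A (unit_vec i)) f else 0)"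
  obtain C where C: "0 \<le> C" "\<And>f. f \<in> ell2 I \<Longrightarrow> ell2_norm I (A f) \<le> C * ell2_norm I f"
    using bounded_ops_bound[OF A] by blast
  have Ae: "A (unit_vec i) \<in> ell2 I" if "i \<in> I" for i
    using that by (intro bounded_ops_closed[OF A] unit_vec_ell2)
  have fin: "(\<Sum>i\<in>F. cnj (B f i) * c i) = ell2_inner I f (A (\<lambda>j. \<Sum>i\<in>F. c i * unit_vec i j))"
    if "finite F" "F \<subseteq> I" "f \<in> ell2 I" for F f c
  proof -
    have "ell2_inner I f (\<lambda>j. \<Sum>i\<in>F. c i * A (unit_vec i) j) = (\<Sum>i\<in>F. cnj (B f i) * c i)"
      using that(1,2)
    proof (induction F)
      case empty
      then show ?case by (simp add: ell2_inner_def)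
    next
      case (insert i F)
      have "(\<lambda>j. \<Sum>i\<in>F. c i * A (unit_vec i) j) \<in> ell2 I"
        using insert.prems by (intro ell2_sum ell2_cmult Ae) auto
      then show ?case
        using insert that(3)
        by (simp add: ell2_inner_add_right ell2_cmult Ae ell2_inner_cmult_right B_def ell2_inner_commute)
    qed
    then show ?thesis
      using that(2) by (subst bounded_ops_sum[OF A]) (auto intro: unit_vec_ell2)
  qed
  have fin_sum: "(\<lambda>j. \<Sum>i\<in>F. c i * unit_vec i j) = (\<lambda>j. if j \<in> F then c j else 0)" if "finite F" for F c
    using that by (auto simp: unit_vec_def fun_eq_iff if_distrib cong: if_cong)
  have fin_norm: "ell2_norm I (\<lambda>j. if j \<in> F then c j else 0) = L2_set (\<lambda>i. cmod (c i)) F"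
    if "finite F" "F \<subseteq> I" for F c
  proof -
    have "(\<Sum>\<^sub>\<infinity>j\<in>I. (cmod (if j \<in> F then c j else 0))\<^sup>2) = (\<Sum>\<^sub>\<infinity>j\<in>F. (cmod (c j))\<^sup>2)"
      using that by (intro infsum_cong_neutral) auto
    then show ?thesis using that by (simp add: ell2_norm_def L2_set_def)
  qed
  have fin_mem: "(\<lambda>j. \<Sum>i\<in>F. c i * unit_vec i j) \<in> ell2 I" if "F \<subseteq> I" for F c
    using that by (intro ell2_sum ell2_cmult unit_vec_ell2) auto
  have bound: "L2_set (\<lambda>i. cmod (B f i)) F \<le> C * ell2_norm I f"
    if F: "finite F" "F \<subseteq> I" and f: "f \<in> ell2 I" for F f
  proof -
    \<comment> \<open>Test vector: the part of \<open>B f\<close> supported on F. Pairing f with its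
      image under A returns the square of \<open>?L\<close>, while Cauchy-Schwarz and the bound C
      leave a single factor \<open>?L\<close>, so one factor cancels.\<close>
    let ?g = "\<lambda>j. \<Sum>i\<in>F. B f i * unit_vec i j"
    let ?L = "L2_set (\<lambda>i. cmod (B f i)) F"
    have "?L\<^sup>2 = (\<Sum>i\<in>F. (cmod (B f i))\<^sup>2)"
      by (simp add: L2_set_def sum_nonneg)
    then have "complex_of_real (?L\<^sup>2) = (\<Sum>i\<in>F. cnj (B f i) * B f i)"
      by (simp only: cnj_mult_self of_real_sum)
    also have "\<dots> = ell2_inner I f (A ?g)" by (rule fin[OF F f])
    finally have "?L\<^sup>2 = cmod (ell2_inner I f (A ?g))"
      by (metis norm_of_real abs_of_nonneg zero_le_power2)
    also have "\<dots> \<le> ell2_norm I f * ell2_norm I (A ?g)"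
      using F(2) by (intro Cauchy_Schwarz_ell2 f bounded_ops_closed[OF A] fin_mem)
    also have "\<dots> \<le> ell2_norm I f * (C * ell2_norm I ?g)"
      using F(2) by (intro mult_left_mono C fin_mem) auto
    also have "ell2_norm I ?g = ?L" by (simp add: fin_sum F fin_norm)
    finally have "?L * ?L \<le> (C * ell2_norm I f) * ?L"
      by (simp only: power2_eq_square mult_ac)
    moreover have "0 \<le> ?L" by simp
    ultimately show ?thesis
      using C(1) by (cases "?L = 0") (auto simp: mult_le_cancel_right)
  qed
  have B_mem: "B f \<in> ell2 I" "ell2_norm I (B f) \<le> C * ell2_norm I f" if "f \<in> ell2 I" for f
    using that bound by (intro ell2I; force simp: B_def)+
  have B: "B \<in> bounded_ops I"
  proof (rule bounded_opsI)
    show "B \<in> extensional (ell2 I)" by (simp add: B_def)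
    show "B (\<lambda>i. f i + g i) = (\<lambda>i. B f i + B g i)" if "f \<in> ell2 I" "g \<in> ell2 I" for f g
      using that by (auto simp: B_def ell2_add ell2_inner_add_right Ae)
    show "B (\<lambda>i. c * f i) = (\<lambda>i. c * B f i)" if "f \<in> ell2 I" for f c
      using that by (auto simp: B_def ell2_cmult ell2_inner_cmult_right)
  qed (rule B_mem; assumption)+
  have "ell2_inner I (B f) g = ell2_inner I f (A g)" if f: "f \<in> ell2 I" and g: "g \<in> ell2 I" for f g
  proof -
    let ?d = "cmod (ell2_inner I (B f) g - ell2_inner I f (A g))"
    \<comment> \<open>Two error terms, one for B and one for A, each at most
      \<open>C * ell2_norm I f\<close> times e.\<close>
    let ?K = "2 * C * ell2_norm I f"
    have "?d \<le> ?K * e" if e: "0 < e" for e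
    proof -
      obtain F where F: "finite F" "F \<subseteq> I"
          "ell2_norm I (\<lambda>i. g i - (if i \<in> F then g i else 0)) \<le> e"
        using ell2_finite_approximation[OF g e] by blast
      let ?g = "\<lambda>j. if j \<in> F then g j else 0"
      let ?h = "\<lambda>i. g i - ?g i"
      have gF: "?g \<in> ell2 I" using fin_mem[OF F(2), of g] by (simp add: fin_sum F(1))
      have h: "?h \<in> ell2 I" using g gF by (rule ell2_diff)
      have "ell2_inner I (B f) ?g = (\<Sum>\<^sub>\<infinity>i\<in>F. cnj (B f i) * g i)"
        unfolding ell2_inner_def using F(2) by (intro infsum_cong_neutral) auto
      also have "\<dots> = ell2_inner I f (A ?g)"
        using fin[OF F(1,2) f, of g] F(1) by (simp add: fin_sum)
      finally have eq: "ell2_inner I (B f) ?g = ell2_inner I f (A ?g)" .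
      have "ell2_inner I (B f) g = ell2_inner I (B f) ?h + ell2_inner I (B f) ?g"
        using ell2_inner_add_right[OF B_mem(1)[OF f] h gF] by simp
      moreover have "ell2_inner I f (A g) = ell2_inner I f (A ?h) + ell2_inner I f (A ?g)"
        using ell2_inner_add_right[OF f bounded_ops_closed[OF A h] bounded_ops_closed[OF A gF]]
          bounded_ops_add[OF A h gF] by simp
      ultimately have "?d = cmod (ell2_inner I (B f) ?h - ell2_inner I f (A ?h))"
        using eq by simp
      also have "\<dots> \<le> cmod (ell2_inner I (B f) ?h) + cmod (ell2_inner I f (A ?h))"
        by (rule norm_triangle_ineq4)
      also have "\<dots> \<le> ell2_norm I (B f) * ell2_norm I ?h + ell2_norm I f * ell2_norm I (A ?h)"
        using f h by (intro add_mono Cauchy_Schwarz_ell2 B_mem bounded_ops_closed[OF A])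
      also have "\<dots> \<le> C * ell2_norm I f * e + ell2_norm I f * (C * e)"
        using F(3) C B_mem[OF f] h order_trans[OF C(2)[OF h] mult_left_mono[OF F(3) C(1)]]
        by (intro add_mono mult_mono mult_left_mono) auto
      finally show ?thesis by (simp add: algebra_simps)
    qed
    moreover have "0 \<le> ?K" using C(1) by simp
    ultimately have "?d \<le> 0 + e" if "0 < e" for e
    proof -
      \<comment> \<open>The summand 1 keeps the denominator positive when \<open>?K\<close> is
        zero.\<close>
      have "?d \<le> ?K * (e / (?K + 1))"
        using \<open>0 \<le> ?K\<close> that by (intro \<open>\<And>e. 0 < e \<Longrightarrow> ?d \<le> ?K * e\<close>) auto
      also have "\<dots> \<le> e"
        using \<open>0 \<le> ?K\<close> that by (simp add: field_simps)
      finally show ?thesis by simp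
    qed
    then have "?d \<le> 0" by (rule field_le_epsilon)
    then show ?thesis by simp
  qed
  with B that show ?thesis by blast
qed

lemma op_adj_eqI:
  assumes B: "B \<in> bounded_ops I"
    and adj: "\<And>f g. f \<in> ell2 I \<Longrightarrow> g \<in> ell2 I \<Longrightarrow> ell2_inner I (B f) g = ell2_inner I f (A g)"
  shows "op_adj I A = B"
  unfolding op_adj_def
proof (rule the_equality)
  fix B' assume B': "B' \<in> bounded_ops I \<and>
    (\<forall>f\<in>ell2 I. \<forall>g\<in>ell2 I. ell2_inner I (B' f) g = ell2_inner I f (A g))"
  show "B' = B"
  proof (rule op_eqI)
    fix f assume f: "f \<in> ell2 I"
    show "B' f = B f"
    proof
      fix i
      show "B' f i = B f i"
      proof (cases "i \<in> I")
        case True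
        then have "ell2_inner I (B' f) (unit_vec i) = ell2_inner I (B f) (unit_vec i)"
          using adj[OF f] B' f by (simp add: unit_vec_ell2)
        then show ?thesis using True by (simp add: ell2_inner_unit_vec_right)
      next
        case False
        then show ?thesis
          using bounded_ops_closed[OF B f] bounded_ops_closed[of B' I, OF _ f] B' by (simp add: ell2_memD)
      qed
    qed
  qed (use B B' in blast)+
qed (use assms in blast)

lemma
  assumes "A \<in> bounded_ops I"
  shows op_adj_bounded: "op_adj I A \<in> bounded_ops I"
    and op_adj_inner: "f \<in> ell2 I \<Longrightarrow> g \<in> ell2 I \<Longrightarrow>
      ell2_inner I (op_adj I A f) g = ell2_inner I f (A g)"
proof -
  obtain B where B: "B \<in> bounded_ops I"
      "\<And>f g. f \<in> ell2 I \<Longrightarrow> g \<in> ell2 I \<Longrightarrow> ell2_inner I (B f) g = ell2_inner I f (A g)"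
    using op_adj_exists[OF assms] by blast
  have "op_adj I A = B" using B by (rule op_adj_eqI)
  then show "op_adj I A \<in> bounded_ops I"
    "f \<in> ell2 I \<Longrightarrow> g \<in> ell2 I \<Longrightarrow> ell2_inner I (op_adj I A f) g = ell2_inner I f (A g)"
    using B by simp_all
qed

lemma op_adj_unit_vec:
  assumes "A \<in> bounded_ops I" "k \<in> I" "l \<in> I"
  shows "op_adj I A (unit_vec l) k = cnj (A (unit_vec k) l)"
proof -
  have "cnj (op_adj I A (unit_vec l) k) = A (unit_vec k) l"
    using op_adj_inner[OF assms(1) unit_vec_ell2[OF assms(3)] unit_vec_ell2[OF assms(2)]] assms
    by (simp add: ell2_inner_unit_vec ell2_inner_unit_vec_right)
  then show ?thesis by (metis complex_cnj_cnj)
qed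

text \<open>No density argument is made: the i-th coordinate of \<open>A f\<close> is the inner
  product of \<open>op_adj I A (unit_vec i)\<close> with f, and the adjoint is determined on unit
  vectors by the matrix entries of A.\<close>

lemma op_eqI_unit_vec:
  assumes A: "A \<in> bounded_ops I" and B: "B \<in> bounded_ops I"
    and eq: "\<And>k. k \<in> I \<Longrightarrow> A (unit_vec k) = B (unit_vec k)"
  shows "A = B"
proof (rule op_eqI[OF A B])
  fix f assume f: "f \<in> ell2 I"
  have *: "op_adj I A (unit_vec i) = op_adj I B (unit_vec i)" if i: "i \<in> I" for i
  proof
    fix k
    show "op_adj I A (unit_vec i) k = op_adj I B (unit_vec i) k"
      using A B eq i
      by (cases "k \<in> I") (simp_all add: op_adj_unit_vec
          ell2_memD[OF bounded_ops_closed[OF op_adj_bounded unit_vec_ell2]])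
  qed
  show "A f = B f"
  proof
    fix i
    show "A f i = B f i"
    proof (cases "i \<in> I")
      case True
      then show ?thesis
        using op_adj_inner[OF A unit_vec_ell2[OF True] f] op_adj_inner[OF B unit_vec_ell2[OF True] f]
        by (simp add: * ell2_inner_unit_vec)
    qed (use A B f in \<open>simp add: ell2_memD[OF bounded_ops_closed]\<close>)
  qed
qed

lemma op_adj_eqI_unit_vec:
  assumes "A \<in> bounded_ops I" "B \<in> bounded_ops I"
    "\<And>k l. k \<in> I \<Longrightarrow> l \<in> I \<Longrightarrow> B (unit_vec l) k = cnj (A (unit_vec k) l)"
  shows "op_adj I A = B"
proof (rule op_eqI_unit_vec)
  fix l assume l: "l \<in> I"
  show "op_adj I A (unit_vec l) = B (unit_vec l)"
  proof
    fix k
    show "op_adj I A (unit_vec l) k = B (unit_vec l) k"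
      using assms l by (cases "k \<in> I") (simp_all add: op_adj_unit_vec
          ell2_memD[OF bounded_ops_closed[OF op_adj_bounded unit_vec_ell2]]
          ell2_memD[OF bounded_ops_closed[OF _ unit_vec_ell2]])
  qed
qed (intro op_adj_bounded assms)+

section \<open>The *-algebra operations on bounded operators\<close>

lemma op_algebra_simps:
  "carrier (op_algebra I) = bounded_ops I"
  "monoid.mult (op_algebra I) A B = compose (ell2 I) A B"
  "one (op_algebra I) = (\<lambda>f\<in>ell2 I. f)"
  "zero (op_algebra I) = (\<lambda>f\<in>ell2 I. \<lambda>i. 0)"
  "add (op_algebra I) A B = (\<lambda>f\<in>ell2 I. \<lambda>i. A f i + B f i)"
  "smult (op_algebra I) c A = (\<lambda>f\<in>ell2 I. \<lambda>i. c * A f i)"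
  "star (op_algebra I) = op_adj I"
  by (simp_all add: op_algebra_def)

lemma compose_bounded_ops:
  assumes "A \<in> bounded_ops I" "B \<in> bounded_ops I" shows "compose (ell2 I) A B \<in> bounded_ops I"
proof -
  obtain C where C: "0 \<le> C" "\<And>f. f \<in> ell2 I \<Longrightarrow> ell2_norm I (A f) \<le> C * ell2_norm I f"
    using bounded_ops_bound[OF assms(1)] by blast
  obtain D where D: "0 \<le> D" "\<And>f. f \<in> ell2 I \<Longrightarrow> ell2_norm I (B f) \<le> D * ell2_norm I f"
    using bounded_ops_bound[OF assms(2)] by blast
  note closed = bounded_ops_closed[OF assms(1)] bounded_ops_closed[OF assms(2)]
  show ?thesis
  proof (rule bounded_opsI)
    fix f assume f: "f \<in> ell2 I"
    have "ell2_norm I (A (B f)) \<le> C * (D * ell2_norm I f)"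
      using C(2)[OF closed(2)[OF f]] mult_left_mono[OF D(2)[OF f] C(1)] by linarith
    then show "ell2_norm I (compose (ell2 I) A B f) \<le> C * D * ell2_norm I f"
      using f by (simp add: compose_def mult.assoc)
  qed (auto simp: compose_def closed ell2_add ell2_cmult bounded_ops_add[OF assms(1)]
      bounded_ops_add[OF assms(2)] bounded_ops_cmult[OF assms(1)] bounded_ops_cmult[OF assms(2)])
qed

lemma add_bounded_ops:
  assumes "A \<in> bounded_ops I" "B \<in> bounded_ops I"
  shows "(\<lambda>f\<in>ell2 I. \<lambda>i. A f i + B f i) \<in> bounded_ops I"
proof -
  obtain C where C: "0 \<le> C" "\<And>f. f \<in> ell2 I \<Longrightarrow> ell2_norm I (A f) \<le> C * ell2_norm I f"
    using bounded_ops_bound[OF assms(1)] by blast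
  obtain D where D: "0 \<le> D" "\<And>f. f \<in> ell2 I \<Longrightarrow> ell2_norm I (B f) \<le> D * ell2_norm I f"
    using bounded_ops_bound[OF assms(2)] by blast
  note closed = bounded_ops_closed[OF assms(1)] bounded_ops_closed[OF assms(2)]
  show ?thesis
  proof (rule bounded_opsI)
    fix f assume f: "f \<in> ell2 I"
    show "ell2_norm I ((\<lambda>f\<in>ell2 I. \<lambda>i. A f i + B f i) f) \<le> (C + D) * ell2_norm I f"
      using f ell2_add(2)[OF closed(1)[OF f] closed(2)[OF f]] C(2)[OF f] D(2)[OF f]
      by (simp add: distrib_right)
  qed (auto simp: closed ell2_add ell2_cmult bounded_ops_add[OF assms(1)] algebra_simps
      bounded_ops_add[OF assms(2)] bounded_ops_cmult[OF assms(1)] bounded_ops_cmult[OF assms(2)])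
qed

lemma smult_bounded_ops:
  assumes "A \<in> bounded_ops I"
  shows "(\<lambda>f\<in>ell2 I. \<lambda>i. c * A f i) \<in> bounded_ops I"
proof -
  obtain C where C: "0 \<le> C" "\<And>f. f \<in> ell2 I \<Longrightarrow> ell2_norm I (A f) \<le> C * ell2_norm I f"
    using bounded_ops_bound[OF assms] by blast
  show ?thesis
  proof (rule bounded_opsI)
    fix f assume f: "f \<in> ell2 I"
    show "ell2_norm I ((\<lambda>f\<in>ell2 I. \<lambda>i. c * A f i) f) \<le> cmod c * C * ell2_norm I f"
      using f mult_left_mono[OF C(2)[OF f] norm_ge_zero[of c]] by (simp add: ell2_norm_cmult)
  qed (auto simp: bounded_ops_closed[OF assms] ell2_add ell2_cmult bounded_ops_add[OF assms]
      bounded_ops_cmult[OF assms] algebra_simps)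
qed

lemma one_bounded_ops: "(\<lambda>f\<in>ell2 I. f) \<in> bounded_ops I"
  by (rule bounded_opsI[where C = 1]) (auto simp: ell2_add ell2_cmult)

lemma zero_bounded_ops: "(\<lambda>f\<in>ell2 I. \<lambda>i. 0) \<in> bounded_ops I"
  by (rule bounded_opsI[where C = 0]) (auto simp: ell2_add ell2_cmult ell2_zero)

lemma op_adj_compose:
  assumes "A \<in> bounded_ops I" "B \<in> bounded_ops I"
  shows "op_adj I (compose (ell2 I) A B) = compose (ell2 I) (op_adj I B) (op_adj I A)"
  using assms
  by (intro op_adj_eqI compose_bounded_ops op_adj_bounded)
    (simp_all add: compose_def op_adj_inner bounded_ops_closed[OF op_adj_bounded] bounded_ops_closed)

lemma op_adj_add:
  assumes "A \<in> bounded_ops I" "B \<in> bounded_ops I"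
  shows "op_adj I (\<lambda>f\<in>ell2 I. \<lambda>i. A f i + B f i) =
    (\<lambda>f\<in>ell2 I. \<lambda>i. op_adj I A f i + op_adj I B f i)"
  using assms
  by (intro op_adj_eqI add_bounded_ops op_adj_bounded)
    (simp_all add: ell2_inner_add_left ell2_inner_add_right op_adj_inner
      bounded_ops_closed[OF op_adj_bounded] bounded_ops_closed)

lemma op_adj_smult:
  assumes "A \<in> bounded_ops I"
  shows "op_adj I (\<lambda>f\<in>ell2 I. \<lambda>i. c * A f i) = (\<lambda>f\<in>ell2 I. \<lambda>i. cnj c * op_adj I A f i)"
  using assms
  by (intro op_adj_eqI smult_bounded_ops op_adj_bounded)
    (simp_all add: ell2_inner_cmult_left ell2_inner_cmult_right op_adj_inner)

lemma op_adj_one: "op_adj I (\<lambda>f\<in>ell2 I. f) = (\<lambda>f\<in>ell2 I. f)"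
  by (intro op_adj_eqI one_bounded_ops) simp

lemma op_adj_op_adj:
  assumes "A \<in> bounded_ops I" shows "op_adj I (op_adj I A) = A"
proof (rule op_adj_eqI)
  fix f g assume "f \<in> ell2 I" "g \<in> ell2 I"
  then have "cnj (ell2_inner I (op_adj I A g) f) = cnj (ell2_inner I g (A f))"
    using op_adj_inner[OF assms] by simp
  then show "ell2_inner I (A f) g = ell2_inner I f (op_adj I A g)"
    by (simp add: ell2_inner_commute)
qed fact

section \<open>The operator norm and its C*-identity\<close>

definition op_norm :: "'i set \<Rightarrow> 'i op \<Rightarrow> real" where
  "op_norm I A = (SUP f\<in>{f \<in> ell2 I. ell2_norm I f \<le> 1}. ell2_norm I (A f))"

lemma op_norm_le:
  assumes "0 \<le> C" "\<And>f. f \<in> ell2 I \<Longrightarrow> ell2_norm I (A f) \<le> C * ell2_norm I f"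
  shows "op_norm I A \<le> C"
  unfolding op_norm_def
proof (rule cSUP_least)
  show "{f \<in> ell2 I. ell2_norm I f \<le> 1} \<noteq> {}"
    using ell2_zero by (auto intro!: exI[of _ "\<lambda>i. 0"])
  fix f assume "f \<in> {f \<in> ell2 I. ell2_norm I f \<le> 1}"
  then show "ell2_norm I (A f) \<le> C"
    using assms(2)[of f] mult_left_mono[OF _ assms(1), of "ell2_norm I f" 1] by auto
qed

lemma ell2_norm_le_op_norm:
  assumes A: "A \<in> bounded_ops I" and f: "f \<in> ell2 I" "ell2_norm I f \<le> 1"
  shows "ell2_norm I (A f) \<le> op_norm I A"
  unfolding op_norm_def
proof (rule cSUP_upper)
  obtain C where C: "0 \<le> C" "\<And>f. f \<in> ell2 I \<Longrightarrow> ell2_norm I (A f) \<le> C * ell2_norm I f"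
    using bounded_ops_bound[OF A] by blast
  show "bdd_above ((\<lambda>f. ell2_norm I (A f)) ` {f \<in> ell2 I. ell2_norm I f \<le> 1})"
  proof (rule bdd_aboveI2)
    fix f assume "f \<in> {f \<in> ell2 I. ell2_norm I f \<le> 1}"
    then show "ell2_norm I (A f) \<le> C"
      using C(2)[of f] mult_left_mono[OF _ C(1), of "ell2_norm I f" 1] by auto
  qed
qed (use f in simp)

lemma op_norm_bound:
  assumes A: "A \<in> bounded_ops I" and f: "f \<in> ell2 I"
  shows "ell2_norm I (A f) \<le> op_norm I A * ell2_norm I f"
proof (cases "ell2_norm I f = 0")
  case True
  then show ?thesis using ell2_norm_eq_zero[OF f] bounded_ops_zero[OF A] by simp
next
  case False
  define c where "c = ell2_norm I f"
  have c: "0 < c" using False by (simp add: c_def order_less_le)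
  let ?g = "\<lambda>i. of_real (inverse c) * f i"
  have g: "?g \<in> ell2 I" "ell2_norm I ?g = 1"
    using c f by (simp_all only: ell2_cmult ell2_norm_cmult norm_of_real) (simp add: c_def)
  have "ell2_norm I (A ?g) \<le> op_norm I A" using g by (intro ell2_norm_le_op_norm A) simp_all
  moreover have "ell2_norm I (A ?g) = inverse c * ell2_norm I (A f)"
    using c by (simp only: bounded_ops_cmult[OF A f] ell2_norm_cmult norm_of_real) simp
  ultimately show ?thesis using c by (simp add: c_def field_simps)
qed

lemma op_norm_nonneg: "A \<in> bounded_ops I \<Longrightarrow> 0 \<le> op_norm I A"
  using ell2_norm_le_op_norm[of A I "\<lambda>i. 0"] by (simp add: ell2_zero bounded_ops_zero)

lemma op_norm_eq_zero:
  assumes "A \<in> bounded_ops I" "op_norm I A = 0" shows "A = (\<lambda>f\<in>ell2 I. \<lambda>i. 0)"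
proof (rule op_eqI[OF assms(1) zero_bounded_ops])
  fix f assume f: "f \<in> ell2 I"
  have "ell2_norm I (A f) = 0"
    using op_norm_bound[OF assms(1) f] assms(2) ell2_norm_nonneg[of I "A f"] by simp
  then have "A f = (\<lambda>i. 0)"
    by (rule ell2_norm_eq_zero[OF bounded_ops_closed[OF assms(1) f]])
  then show "A f = (\<lambda>f\<in>ell2 I. \<lambda>i. 0) f" using f by simp
qed

lemma op_norm_compose:
  assumes "A \<in> bounded_ops I" "B \<in> bounded_ops I"
  shows "op_norm I (compose (ell2 I) A B) \<le> op_norm I A * op_norm I B"
proof (rule op_norm_le)
  fix f assume f: "f \<in> ell2 I"
  have "ell2_norm I (A (B f)) \<le> op_norm I A * ell2_norm I (B f)"
    using assms f by (intro op_norm_bound bounded_ops_closed[OF assms(2)])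
  also have "\<dots> \<le> op_norm I A * (op_norm I B * ell2_norm I f)"
    using assms f by (intro mult_left_mono op_norm_bound op_norm_nonneg)
  finally show "ell2_norm I (compose (ell2 I) A B f) \<le> op_norm I A * op_norm I B * ell2_norm I f"
    using f by (simp add: compose_def mult.assoc)
qed (simp add: assms op_norm_nonneg)

lemma op_norm_add:
  assumes "A \<in> bounded_ops I" "B \<in> bounded_ops I"
  shows "op_norm I (\<lambda>f\<in>ell2 I. \<lambda>i. A f i + B f i) \<le> op_norm I A + op_norm I B"
proof (rule op_norm_le)
  fix f assume f: "f \<in> ell2 I"
  show "ell2_norm I ((\<lambda>f\<in>ell2 I. \<lambda>i. A f i + B f i) f) \<le> (op_norm I A + op_norm I B) * ell2_norm I f"
    using ell2_add(2)[OF bounded_ops_closed[OF assms(1) f] bounded_ops_closed[OF assms(2) f]]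
      op_norm_bound[OF assms(1) f] op_norm_bound[OF assms(2) f] f
    by (simp add: distrib_right)
qed (simp add: assms op_norm_nonneg)

lemma op_norm_smult:
  assumes "A \<in> bounded_ops I"
  shows "op_norm I (\<lambda>f\<in>ell2 I. \<lambda>i. c * A f i) = cmod c * op_norm I A"
proof (rule antisym)
  have le: "op_norm I (\<lambda>f\<in>ell2 I. \<lambda>i. c * A f i) \<le> cmod c * op_norm I A"
    if "A \<in> bounded_ops I" for A c
  proof (rule op_norm_le)
    fix f assume f: "f \<in> ell2 I"
    show "ell2_norm I ((\<lambda>f\<in>ell2 I. \<lambda>i. c * A f i) f) \<le> cmod c * op_norm I A * ell2_norm I f"
      using op_norm_bound[OF that f] f by (simp add: ell2_norm_cmult mult.assoc mult_left_mono)
  qed (simp add: that op_norm_nonneg)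
  show "op_norm I (\<lambda>f\<in>ell2 I. \<lambda>i. c * A f i) \<le> cmod c * op_norm I A"
    by (rule le) fact
  show "cmod c * op_norm I A \<le> op_norm I (\<lambda>f\<in>ell2 I. \<lambda>i. c * A f i)"
  proof (cases "c = 0")
    case False
    let ?B = "\<lambda>f\<in>ell2 I. \<lambda>i. c * A f i"
    have "(\<lambda>f\<in>ell2 I. \<lambda>i. inverse c * ?B f i) = A"
      using False by (intro op_eqI[OF smult_bounded_ops[OF smult_bounded_ops[OF assms]] assms])
        (simp add: mult.assoc[symmetric])
    then have "op_norm I A \<le> cmod (inverse c) * op_norm I ?B"
      using le[OF smult_bounded_ops[OF assms, of c], of "inverse c"] by simp
    from mult_left_mono[OF this norm_ge_zero[of c]] False show ?thesis
      by (simp only: norm_inverse) (simp add: mult.assoc[symmetric])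
  qed (simp add: op_norm_nonneg zero_bounded_ops)
qed

text \<open>With g the adjoint applied to f, the square of the norm of g is the inner product of f
  with A g, which Cauchy-Schwarz bounds by a multiple of the norm of g; one factor cancels.\<close>

lemma ell2_norm_op_adj_le:
  assumes A: "A \<in> bounded_ops I" and f: "f \<in> ell2 I"
  shows "ell2_norm I (op_adj I A f) \<le> op_norm I A * ell2_norm I f"
proof -
  let ?g = "op_adj I A f"
  have g: "?g \<in> ell2 I" by (intro bounded_ops_closed[OF op_adj_bounded] A f)
  have "(ell2_norm I ?g)\<^sup>2 = cmod (ell2_inner I ?g ?g)"
    by (simp add: ell2_inner_self[OF g] norm_power)
  also have "\<dots> = cmod (ell2_inner I f (A ?g))" by (simp add: op_adj_inner[OF A f g])
  also have "\<dots> \<le> ell2_norm I f * ell2_norm I (A ?g)"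
    by (intro Cauchy_Schwarz_ell2 f bounded_ops_closed[OF A] g)
  also have "\<dots> \<le> ell2_norm I f * (op_norm I A * ell2_norm I ?g)"
    by (intro mult_left_mono op_norm_bound A g) simp
  finally have "ell2_norm I ?g * ell2_norm I ?g \<le> (op_norm I A * ell2_norm I f) * ell2_norm I ?g"
    by (simp only: power2_eq_square mult_ac)
  then show ?thesis
    using op_norm_nonneg[OF A] ell2_norm_nonneg[of I ?g]
    by (cases "ell2_norm I ?g = 0") (auto simp: mult_le_cancel_right)
qed

lemma ell2_norm_power2_op:
  assumes A: "A \<in> bounded_ops I" and f: "f \<in> ell2 I"
  shows "ell2_inner I (op_adj I A (A f)) f = of_real ((ell2_norm I (A f))\<^sup>2)"
  using op_adj_inner[OF A bounded_ops_closed[OF A f] f] ell2_inner_self[OF bounded_ops_closed[OF A f]]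
  by simp

text \<open>For the lower bound, the square of the norm of A f is the inner product of A*A f with f,
  to which Cauchy-Schwarz applies.\<close>

lemma op_norm_cstar:
  assumes A: "A \<in> bounded_ops I"
  shows "op_norm I (compose (ell2 I) (op_adj I A) A) = (op_norm I A)\<^sup>2"
proof (rule antisym)
  have "op_norm I (compose (ell2 I) (op_adj I A) A) \<le> op_norm I (op_adj I A) * op_norm I A"
    by (intro op_norm_compose op_adj_bounded A)
  also have "\<dots> \<le> op_norm I A * op_norm I A"
    by (intro mult_right_mono op_norm_nonneg op_norm_le ell2_norm_op_adj_le A)
  finally show "op_norm I (compose (ell2 I) (op_adj I A) A) \<le> (op_norm I A)\<^sup>2"
    by (simp add: power2_eq_square)
  let ?B = "compose (ell2 I) (op_adj I A) A"
  have B: "?B \<in> bounded_ops I" by (intro compose_bounded_ops op_adj_bounded A)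
  have "op_norm I A \<le> sqrt (op_norm I ?B)"
  proof (rule op_norm_le)
    fix f assume f: "f \<in> ell2 I"
    have "(ell2_norm I (A f))\<^sup>2 = cmod (ell2_inner I (?B f) f)"
      using f by (simp add: compose_def ell2_norm_power2_op[OF A f] norm_power)
    also have "\<dots> \<le> ell2_norm I (?B f) * ell2_norm I f"
      by (intro Cauchy_Schwarz_ell2 f bounded_ops_closed[OF B])
    also have "\<dots> \<le> op_norm I ?B * ell2_norm I f * ell2_norm I f"
      by (intro mult_right_mono op_norm_bound B f) simp
    finally have "sqrt ((ell2_norm I (A f))\<^sup>2) \<le> sqrt (op_norm I ?B * (ell2_norm I f)\<^sup>2)"
      by (intro real_sqrt_le_mono) (simp add: power2_eq_square mult.assoc)
    then show "ell2_norm I (A f) \<le> sqrt (op_norm I ?B) * ell2_norm I f"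
      by (simp add: real_sqrt_mult)
  qed (simp add: op_norm_nonneg[OF B])
  then show "(op_norm I A)\<^sup>2 \<le> op_norm I ?B"
    using power_mono[of "op_norm I A" _ 2] op_norm_nonneg[OF A] op_norm_nonneg[OF B] by fastforce
qed

text \<open>\<open>\<parallel>A\<parallel>\<^sup>2\<close> is an approximate eigenvalue of \<open>A\<^sup>*A\<close>.\<close>

lemma no_left_inverse_at_op_norm:
  assumes A: "A \<in> bounded_ops I" and C: "C \<in> bounded_ops I" and pos: "0 < op_norm I A"
  shows "\<exists>f\<in>ell2 I. C (\<lambda>i. of_real ((op_norm I A)\<^sup>2) * f i - op_adj I A (A f) i) \<noteq> f"
proof (rule ccontr)
  assume "\<not> ?thesis"
  then have inv: "C (\<lambda>i. of_real ((op_norm I A)\<^sup>2) * f i - op_adj I A (A f) i) = f"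
    if "f \<in> ell2 I" for f
    using that by blast
  define \<mu> where "\<mu> = (op_norm I A)\<^sup>2"
  define K where "K = op_norm I C + 1"
  have \<mu>: "0 < \<mu>" and K: "0 < K"
    using pos op_norm_nonneg[OF C] by (simp_all add: \<mu>_def K_def)
  \<comment> \<open>A left inverse of \<mu> - A*A gives |f|^2 \<le> K^2 |(\<mu> - A*A) f|^2.
    Expanding the right side and using |A*A f|^2 \<le> \<mu> |A f|^2 leaves K^2 \<mu> (\<mu> |f|^2 -
    |A f|^2). Solving for |A f|^2 gives this constant, which lies strictly below \<mu> and so
    contradicts the choice of \<mu>.\<close>
  have less: "(ell2_norm I (A f))\<^sup>2 \<le> (\<mu> - 1 / (K\<^sup>2 * \<mu>)) * (ell2_norm I f)\<^sup>2" if f: "f \<in> ell2 I" for f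
  proof -
    let ?h = "op_adj I A (A f)" and ?g = "\<lambda>i. of_real \<mu> * f i - op_adj I A (A f) i"
    have Af: "A f \<in> ell2 I" and h: "?h \<in> ell2 I"
      using f by (intro bounded_ops_closed[OF op_adj_bounded] bounded_ops_closed[OF A] A; assumption)+
    have g: "?g \<in> ell2 I" by (intro ell2_diff ell2_cmult f h)
    have "complex_of_real ((ell2_norm I ?g)\<^sup>2) = ell2_inner I ?g ?g"
      by (rule ell2_inner_self[OF g, symmetric])
    also have "\<dots> = ell2_inner I (\<lambda>i. of_real \<mu> * f i + (-1) * ?h i) (\<lambda>i. of_real \<mu> * f i + (-1) * ?h i)"
      by simp
    also have "\<dots> = of_real (\<mu>\<^sup>2) * ell2_inner I f f - of_real \<mu> * ell2_inner I f ?h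
        - of_real \<mu> * ell2_inner I ?h f + ell2_inner I ?h ?h"
      by (subst ell2_inner_add_left ell2_inner_add_right ell2_inner_cmult_left ell2_inner_cmult_right;
          (intro ell2_add ell2_cmult f h)?)+ (simp add: algebra_simps power2_eq_square)
    also have "ell2_inner I f ?h = of_real ((ell2_norm I (A f))\<^sup>2)"
      using ell2_norm_power2_op[OF A f] ell2_inner_commute[of I ?h f] by simp
    also have "ell2_inner I ?h f = of_real ((ell2_norm I (A f))\<^sup>2)"
      by (rule ell2_norm_power2_op[OF A f])
    also have "of_real (\<mu>\<^sup>2) * ell2_inner I f f - of_real \<mu> * of_real ((ell2_norm I (A f))\<^sup>2) -
        of_real \<mu> * of_real ((ell2_norm I (A f))\<^sup>2) + ell2_inner I ?h ?h =
        complex_of_real (\<mu>\<^sup>2 * (ell2_norm I f)\<^sup>2 - 2 * \<mu> * (ell2_norm I (A f))\<^sup>2 + (ell2_norm I ?h)\<^sup>2)"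
      by (simp add: ell2_inner_self[OF f] ell2_inner_self[OF h])
    finally have g_norm: "(ell2_norm I ?g)\<^sup>2 =
        \<mu>\<^sup>2 * (ell2_norm I f)\<^sup>2 - 2 * \<mu> * (ell2_norm I (A f))\<^sup>2 + (ell2_norm I ?h)\<^sup>2"
      by (simp only: of_real_eq_iff)
    have "(ell2_norm I ?h)\<^sup>2 \<le> (op_norm I A * ell2_norm I (A f))\<^sup>2"
      by (intro power_mono ell2_norm_op_adj_le A Af) simp
    then have h_norm: "(ell2_norm I ?h)\<^sup>2 \<le> \<mu> * (ell2_norm I (A f))\<^sup>2"
      by (simp add: \<mu>_def power_mult_distrib)
    have "ell2_norm I f = ell2_norm I (C ?g)" using inv[OF f] by (simp add: \<mu>_def)
    also have "\<dots> \<le> op_norm I C * ell2_norm I ?g" by (rule op_norm_bound[OF C g])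
    also have "\<dots> \<le> K * ell2_norm I ?g" by (intro mult_right_mono) (simp_all add: K_def)
    finally have "(ell2_norm I f)\<^sup>2 \<le> (K * ell2_norm I ?g)\<^sup>2" by (intro power_mono) simp_all
    also have "\<dots> \<le> K\<^sup>2 * (\<mu> * (\<mu> * (ell2_norm I f)\<^sup>2 - (ell2_norm I (A f))\<^sup>2))"
      unfolding power_mult_distrib using g_norm h_norm
      by (intro mult_left_mono) (simp_all add: algebra_simps power2_eq_square)
    finally show ?thesis using \<mu> K by (simp add: field_simps)
  qed
  \<comment> \<open>The constant is to be put under a root; a negative one would force A =
    0.\<close>
  have nonneg: "0 \<le> \<mu> - 1 / (K\<^sup>2 * \<mu>)"
  proof (rule ccontr)
    assume neg: "\<not> 0 \<le> \<mu> - 1 / (K\<^sup>2 * \<mu>)"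
    have "ell2_norm I (A f) \<le> 0 * ell2_norm I f" if "f \<in> ell2 I" for f
    proof -
      have "(\<mu> - 1 / (K\<^sup>2 * \<mu>)) * (ell2_norm I f)\<^sup>2 \<le> 0"
        using neg by (intro mult_nonpos_nonneg) auto
      then have "(ell2_norm I (A f))\<^sup>2 \<le> 0" using less[OF that] by linarith
      then show ?thesis by simp
    qed
    then have "op_norm I A \<le> 0" by (intro op_norm_le) auto
    with pos show False by simp
  qed
  have "op_norm I A \<le> sqrt (\<mu> - 1 / (K\<^sup>2 * \<mu>))"
  proof (rule op_norm_le)
    fix f assume "f \<in> ell2 I"
    from real_sqrt_le_mono[OF less[OF this]]
    show "ell2_norm I (A f) \<le> sqrt (\<mu> - 1 / (K\<^sup>2 * \<mu>)) * ell2_norm I f"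
      by (simp add: real_sqrt_mult)
  qed (use nonneg in simp)
  then have "\<mu> \<le> (sqrt (\<mu> - 1 / (K\<^sup>2 * \<mu>)))\<^sup>2"
    unfolding \<mu>_def using op_norm_nonneg[OF A] by (intro power_mono) (simp_all add: \<mu>_def)
  then have "1 / (K\<^sup>2 * \<mu>) \<le> 0" using nonneg by simp
  moreover have "0 < 1 / (K\<^sup>2 * \<mu>)" using \<mu> K by simp
  ultimately show False by linarith
qed

text \<open>The limit is taken coordinatewise. Sending one index of the Cauchy estimate to infinity,
  \<open>ell2_limit\<close> turns it into convergence that is uniform on bounded sets of
  vectors.\<close>

lemma bounded_ops_complete:
  assumes A: "\<And>k. A k \<in> bounded_ops I"
    and cauchy: "\<And>e. 0 < e \<Longrightarrow> \<exists>N. \<forall>k\<ge>N. \<forall>l\<ge>N. \<forall>f\<in>ell2 I.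
      ell2_norm I (\<lambda>i. A k f i - A l f i) \<le> e * ell2_norm I f"
  obtains B where "B \<in> bounded_ops I"
    "\<And>f i. f \<in> ell2 I \<Longrightarrow> (\<lambda>k. A k f i) \<longlonglongrightarrow> B f i"
    "\<And>e. 0 < e \<Longrightarrow> \<exists>N. \<forall>k\<ge>N. \<forall>f\<in>ell2 I. ell2_norm I (\<lambda>i. A k f i - B f i) \<le> e * ell2_norm I f"
proof -
  define B where "B = (\<lambda>f\<in>ell2 I. \<lambda>i. lim (\<lambda>k. A k f i))"
  have mem: "A k f \<in> ell2 I" if "f \<in> ell2 I" for k f
    using that by (rule bounded_ops_closed[OF A])
  have lim: "(\<lambda>k. A k f i) \<longlonglongrightarrow> B f i" if f: "f \<in> ell2 I" for f i
  proof -
    have "Cauchy (\<lambda>k. A k f i)"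
    proof (rule metric_CauchyI)
      fix e :: real assume e: "0 < e"
      define d where "d = e / (ell2_norm I f + 1)"
      have d: "0 < d" using e by (simp add: d_def add_nonneg_pos)
      obtain N where N: "\<And>k l. k \<ge> N \<Longrightarrow> l \<ge> N \<Longrightarrow>
          ell2_norm I (\<lambda>i. A k f i - A l f i) \<le> d * ell2_norm I f"
        using cauchy[OF d] f by blast
      have "dist (A k f i) (A l f i) < e" if "k \<ge> N" "l \<ge> N" for k l
      proof -
        have "cmod (A k f i - A l f i) \<le> ell2_norm I (\<lambda>i. A k f i - A l f i)"
          by (rule cmod_le_ell2_norm[OF ell2_diff]) (intro mem f)+
        also have "\<dots> \<le> d * ell2_norm I f" using N that by blast
        also have "\<dots> < d * (ell2_norm I f + 1)" using d by simp
        also have "\<dots> = e" using add_nonneg_pos[OF ell2_norm_nonneg[of I f] zero_less_one]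
          by (simp add: d_def)
        finally show ?thesis by (simp add: dist_norm)
      qed
      then show "\<exists>N. \<forall>k\<ge>N. \<forall>l\<ge>N. dist (A k f i) (A l f i) < e" by blast
    qed
    then have "convergent (\<lambda>k. A k f i)" by (rule Cauchy_convergent)
    then show ?thesis using f by (simp add: B_def convergent_LIMSEQ_iff)
  qed
  have conv: "\<exists>N. \<forall>k\<ge>N. \<forall>f\<in>ell2 I. (\<lambda>i. A k f i - B f i) \<in> ell2 I \<and>
      ell2_norm I (\<lambda>i. A k f i - B f i) \<le> e * ell2_norm I f" if e: "0 < e" for e
  proof -
    obtain N where N: "\<And>k l f. k \<ge> N \<Longrightarrow> l \<ge> N \<Longrightarrow> f \<in> ell2 I \<Longrightarrow>
        ell2_norm I (\<lambda>i. A k f i - A l f i) \<le> e * ell2_norm I f"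
      using cauchy[OF e] by blast
    have "(\<lambda>i. A k f i - B f i) \<in> ell2 I \<and> ell2_norm I (\<lambda>i. A k f i - B f i) \<le> e * ell2_norm I f"
      if "k \<ge> N" and f: "f \<in> ell2 I" for k f
    proof -
      note limit = ell2_limit[of "\<lambda>l i. A k f i - A (l + N) f i" I "e * ell2_norm I f" "\<lambda>i. A k f i - B f i"]
      have "(\<lambda>l. A k f i - A (l + N) f i) \<longlonglongrightarrow> A k f i - B f i" for i
        using LIMSEQ_ignore_initial_segment[OF lim[OF f]] by (intro tendsto_intros) simp
      then show ?thesis
        using limit ell2_diff[OF mem[OF f] mem[OF f]] N[OF that(1) _ f] by simp
    qed
    then show ?thesis by blast
  qed
  have B: "B \<in> bounded_ops I"
  proof -
    obtain N where N: "\<And>f. f \<in> ell2 I \<Longrightarrow> (\<lambda>i. A N f i - B f i) \<in> ell2 I \<and>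
        ell2_norm I (\<lambda>i. A N f i - B f i) \<le> 1 * ell2_norm I f"
      using conv[of 1] by auto
    have sub: "B f = (\<lambda>i. A N f i + (-1) * (A N f i - B f i))" for f by simp
    show ?thesis
    proof (rule bounded_opsI)
      show "B \<in> extensional (ell2 I)" by (simp add: B_def)
      fix f assume f: "f \<in> ell2 I"
      show "B f \<in> ell2 I" by (subst sub) (intro ell2_add ell2_cmult mem f N[THEN conjunct1])
      have "ell2_norm I (B f) \<le> ell2_norm I (A N f) + ell2_norm I (\<lambda>i. (-1) * (A N f i - B f i))"
        by (subst sub) (intro ell2_add ell2_cmult mem f N[THEN conjunct1])
      also have "\<dots> \<le> op_norm I (A N) * ell2_norm I f + 1 * ell2_norm I f"
        unfolding ell2_norm_cmult using N[OF f] op_norm_bound[OF A f] by (intro add_mono) auto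
      finally show "ell2_norm I (B f) \<le> (op_norm I (A N) + 1) * ell2_norm I f"
        by (simp add: distrib_right)
      show "B (\<lambda>i. c * f i) = (\<lambda>i. c * B f i)" for c
      proof
        fix i
        have "(\<lambda>k. A k (\<lambda>i. c * f i) i) \<longlonglongrightarrow> c * B f i"
          unfolding bounded_ops_cmult[OF A f] by (intro tendsto_intros lim f)
        then show "B (\<lambda>i. c * f i) i = c * B f i"
          using lim[OF ell2_cmult[OF f]] LIMSEQ_unique by blast
      qed
      fix g assume g: "g \<in> ell2 I"
      show "B (\<lambda>i. f i + g i) = (\<lambda>i. B f i + B g i)"
      proof
        fix i
        have "(\<lambda>k. A k (\<lambda>i. f i + g i) i) \<longlonglongrightarrow> B f i + B g i"
          unfolding bounded_ops_add[OF A f g] by (intro tendsto_intros lim f g)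
        then show "B (\<lambda>i. f i + g i) i = B f i + B g i"
          using lim[OF ell2_add(1)[OF f g]] LIMSEQ_unique by blast
      qed
    qed
  qed
  show ?thesis
  proof (rule that[OF B lim])
    show "\<exists>N. \<forall>k\<ge>N. \<forall>f\<in>ell2 I. ell2_norm I (\<lambda>i. A k f i - B f i) \<le> e * ell2_norm I f"
      if "0 < e" for e
      using conv[OF that] by blast
  qed
qed

section \<open>Evaluation of *-polynomials at bounded operators\<close>

locale op_family =
  fixes I :: "'i set" and t :: "'g \<Rightarrow> 'i op"
  assumes bounded: "t g \<in> bounded_ops I"
begin

definition letter_op :: "'g \<times> bool \<Rightarrow> 'i op" where
  "letter_op x = (if snd x then op_adj I (t (fst x)) else t (fst x))"

definition word_op :: "('g \<times> bool) list \<Rightarrow> 'i op" where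
  "word_op xs = foldr (\<lambda>x A. compose (ell2 I) (letter_op x) A) xs (\<lambda>f\<in>ell2 I. f)"

definition poly_op :: "'g star_poly \<Rightarrow> 'i op" where
  "poly_op p = (\<lambda>f\<in>ell2 I. \<lambda>i. \<Sum>w\<in>Poly_Mapping.keys p.
     Poly_Mapping.lookup p w * word_op (letters w) f i)"

lemma letter_op_bounded: "letter_op x \<in> bounded_ops I"
  by (simp add: letter_op_def bounded op_adj_bounded)

lemma word_op_bounded: "word_op xs \<in> bounded_ops I"
  by (induction xs) (simp_all add: word_op_def one_bounded_ops compose_bounded_ops letter_op_bounded
      del: restrict_apply)

lemma word_op_Nil: "f \<in> ell2 I \<Longrightarrow> word_op [] f = f"
  and word_op_Cons: "f \<in> ell2 I \<Longrightarrow> word_op (x # xs) f = letter_op x (word_op xs f)"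
  by (simp_all add: word_op_def compose_def)

lemma word_op_append: "f \<in> ell2 I \<Longrightarrow> word_op (xs @ ys) f = word_op xs (word_op ys f)"
  by (induction xs) (simp_all add: word_op_Nil word_op_Cons bounded_ops_closed[OF word_op_bounded])

lemma op_adj_word_op: "op_adj I (word_op xs) = word_op (rev (map (\<lambda>(g, b). (g, \<not> b)) xs))"
proof (induction xs)
  case Nil
  then show ?case by (simp add: word_op_def op_adj_one del: restrict_apply)
next
  case (Cons x xs)
  let ?rev = "\<lambda>xs. rev (map (\<lambda>(g, b). (g, \<not> b)) xs)"
  have x: "op_adj I (letter_op x) = letter_op (fst x, \<not> snd x)"
    by (simp add: letter_op_def op_adj_op_adj bounded)
  have "op_adj I (word_op (x # xs)) = compose (ell2 I) (word_op (?rev xs)) (letter_op (fst x, \<not> snd x))"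
    unfolding Cons.IH[symmetric] x[symmetric]
    using op_adj_compose[OF letter_op_bounded word_op_bounded, of x xs] by (simp add: word_op_def)
  also have "\<dots> = word_op (?rev (x # xs))"
    by (rule op_eqI[OF compose_bounded_ops[OF word_op_bounded letter_op_bounded] word_op_bounded])
      (cases x, simp add: compose_def word_op_append word_op_Cons word_op_Nil
        bounded_ops_closed[OF letter_op_bounded])
  finally show ?case .
qed

lemma poly_op_single: "poly_op (Poly_Mapping.single w c) = (\<lambda>f\<in>ell2 I. \<lambda>i. c * word_op (letters w) f i)"
  by (cases "c = 0") (simp_all add: poly_op_def)

lemma poly_op_add: "poly_op (p + q) = (\<lambda>f\<in>ell2 I. \<lambda>i. poly_op p f i + poly_op q f i)"
proof -
  have "(\<Sum>w\<in>Poly_Mapping.keys (p + q). Poly_Mapping.lookup (p + q) w * word_op (letters w) f i) =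
      (\<Sum>w\<in>Poly_Mapping.keys p. Poly_Mapping.lookup p w * word_op (letters w) f i) +
      (\<Sum>w\<in>Poly_Mapping.keys q. Poly_Mapping.lookup q w * word_op (letters w) f i)" for f i
    by (rule setsum_keys_plus_distrib) (simp_all add: distrib_right)
  then show ?thesis by (auto simp: poly_op_def)
qed

lemma poly_op_bounded: "poly_op p \<in> bounded_ops I"
  by (induction p rule: star_poly_induct)
    (simp_all add: poly_op_single poly_op_add smult_bounded_ops add_bounded_ops word_op_bounded
      del: restrict_apply)

lemma poly_op_closed: "f \<in> ell2 I \<Longrightarrow> poly_op p f \<in> ell2 I"
  by (rule bounded_ops_closed) (rule poly_op_bounded)

lemma poly_op_mult_apply: "f \<in> ell2 I \<Longrightarrow> poly_op (p * q) f = poly_op p (poly_op q f)"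
proof (induction p rule: star_poly_induct)
  case (single v c)
  show ?case
  proof (induction q rule: star_poly_induct)
    case (single w d)
    show ?case
      using \<open>f \<in> ell2 I\<close>
      by (simp add: mult_single poly_op_single plus_word_def word_op_append ell2_cmult
          bounded_ops_closed[OF word_op_bounded] bounded_ops_cmult[OF word_op_bounded] mult.assoc)
  next
    case (add p q)
    then show ?case
      using \<open>f \<in> ell2 I\<close>
      by (simp add: distrib_left poly_op_add poly_op_closed bounded_ops_add[OF poly_op_bounded])
  qed
next
  case (add p q)
  then show ?case by (simp add: distrib_right poly_op_add poly_op_closed)
qed

lemma poly_op_mult: "poly_op (p * q) = compose (ell2 I) (poly_op p) (poly_op q)"
  by (rule op_eqI[OF poly_op_bounded compose_bounded_ops[OF poly_op_bounded poly_op_bounded]])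
    (simp add: poly_op_mult_apply compose_def)

lemma poly_op_pstar: "poly_op (pstar p) = op_adj I (poly_op p)"
  by (induction p rule: star_poly_induct)
    (simp_all add: poly_op_single op_adj_smult word_op_bounded op_adj_word_op word_star_def
      pstar_add poly_op_add op_adj_add poly_op_bounded del: restrict_apply)

lemma poly_op_one: "poly_op 1 = (\<lambda>f\<in>ell2 I. f)"
proof -
  have "letters (0 :: 'g word) = []" by (simp add: zero_word_def)
  then show ?thesis
    using poly_op_single[of 0 1]
    by (intro op_eqI[OF poly_op_bounded one_bounded_ops]) (simp add: word_op_Nil)
qed

lemma poly_op_pscale: "poly_op (pscale c p) = (\<lambda>f\<in>ell2 I. \<lambda>i. c * poly_op p f i)"
  by (induction p rule: star_poly_induct)
    (auto simp: poly_op_single pscale_add poly_op_add algebra_simps)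

lemma poly_op_diff: "f \<in> ell2 I \<Longrightarrow> poly_op (p - q) f i = poly_op p f i - poly_op q f i"
  using poly_op_add[of p "pscale (-1) q"] by (simp add: poly_op_pscale) (simp add: pscale_minus_one)

lemma poly_op_gen: "poly_op (gen g) = t g"
  by (rule op_eqI[OF poly_op_bounded bounded])
    (simp add: gen_def poly_op_single word_op_Cons word_op_Nil letter_op_def)

text \<open>Operators that satisfy the relations contribute one term to the supremum
  \<open>univ_norm\<close>; this is the easy inequality between the two norms.\<close>

lemma cstar_seminorm_poly_op:
  assumes "\<And>r. r \<in> R \<Longrightarrow> poly_op r = (\<lambda>f\<in>ell2 I. \<lambda>i. 0)"
  shows "cstar_seminorm G R (\<lambda>p. op_norm I (poly_op p))"
  unfolding cstar_seminorm_def
proof (intro conjI ballI allI)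
  fix p q
  show "op_norm I (poly_op (p + q)) \<le> op_norm I (poly_op p) + op_norm I (poly_op q)"
    by (simp only: poly_op_add op_norm_add poly_op_bounded)
  show "op_norm I (poly_op (p * q)) \<le> op_norm I (poly_op p) * op_norm I (poly_op q)"
    by (simp only: poly_op_mult op_norm_compose poly_op_bounded)
next
  fix p c
  show "op_norm I (poly_op (pscale c p)) = cmod c * op_norm I (poly_op p)"
    by (simp only: poly_op_pscale op_norm_smult poly_op_bounded)
next
  fix p
  show "op_norm I (poly_op (pstar p * p)) = (op_norm I (poly_op p))\<^sup>2"
    by (simp only: poly_op_mult poly_op_pstar op_norm_cstar poly_op_bounded)
next
  fix r assume "r \<in> R"
  then show "op_norm I (poly_op r) = 0"
    using assms op_norm_le[of 0 I "\<lambda>f\<in>ell2 I. \<lambda>i. 0"] op_norm_nonneg[OF zero_bounded_ops, of I]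
    by (intro antisym) simp_all
qed

end

section \<open>Weighted partial shifts\<close>

text \<open>A weighted composition operator cut off to D. The one-leg shifts, the operators
  \<open>T g\<close> and their adjoints all have this shape, so boundedness and adjoints are settled
  once.\<close>

definition wshift :: "'i set \<Rightarrow> 'i set \<Rightarrow> ('i \<Rightarrow> complex) \<Rightarrow> ('i \<Rightarrow> 'i) \<Rightarrow> 'i op" where
  "wshift I D u \<sigma> = (\<lambda>f\<in>ell2 I. \<lambda>k. if k \<in> D then u k * f (\<sigma> k) else 0)"

text \<open>The operator is a contraction: injectivity of \<sigma> makes a finite sum over shifted
  indices a sum over distinct indices.\<close>

lemma wshift_bounded:
  assumes D: "D \<subseteq> I" and \<sigma>: "\<sigma> ` D \<subseteq> I" "inj_on \<sigma> D" and u: "\<And>k. k \<in> D \<Longrightarrow> cmod (u k) \<le> 1"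
  shows "wshift I D u \<sigma> \<in> bounded_ops I"
proof -
  have bound: "L2_set (\<lambda>i. cmod (wshift I D u \<sigma> f i)) F \<le> ell2_norm I f"
    if f: "f \<in> ell2 I" and F: "finite F" "F \<subseteq> I" for f F
  proof -
    have le: "cmod (u k) * cmod (f (\<sigma> k)) \<le> cmod (f (\<sigma> k))" if "k \<in> D" for k
      using mult_right_mono[OF u[OF that] norm_ge_zero[of "f (\<sigma> k)"]] by simp
    have "(\<Sum>k\<in>F. (cmod (wshift I D u \<sigma> f k))\<^sup>2) \<le> (\<Sum>k\<in>F\<inter>D. (cmod (f (\<sigma> k)))\<^sup>2)"
      using f F le by (subst sum.inter_restrict)
        (auto simp: wshift_def norm_mult intro!: sum_mono power_mono)
    also have "\<dots> = (\<Sum>l\<in>\<sigma> ` (F\<inter>D). (cmod (f l))\<^sup>2)"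
      using \<sigma>(2) by (subst sum.reindex) (auto simp: inj_on_def)
    also have "sqrt \<dots> = L2_set (\<lambda>i. cmod (f i)) (\<sigma> ` (F\<inter>D))"
      by (simp add: L2_set_def)
    also have "\<dots> \<le> ell2_norm I f"
      using \<sigma>(1) F(1) by (intro L2_set_le_ell2_norm f) auto
    finally show ?thesis by (simp add: L2_set_def)
  qed
  have vanish: "wshift I D u \<sigma> f i = 0" if "f \<in> ell2 I" "i \<notin> I" for f i
    using that D by (auto simp: wshift_def)
  show ?thesis
  proof (rule bounded_opsI[where C = 1])
    fix f assume f: "f \<in> ell2 I"
    show "wshift I D u \<sigma> f \<in> ell2 I" by (rule ell2I(1)[OF vanish[OF f] bound[OF f]])
    have "ell2_norm I (wshift I D u \<sigma> f) \<le> ell2_norm I f"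
      by (rule ell2I(2)[OF vanish[OF f] bound[OF f]])
    then show "ell2_norm I (wshift I D u \<sigma> f) \<le> 1 * ell2_norm I f" by simp
  qed (auto simp: wshift_def ell2_add ell2_cmult algebra_simps)
qed

text \<open>As a matrix, the row k in D has the single entry \<open>u k\<close>, in column
  \<open>\<sigma> k\<close>. Conjugate transposition reverses the shift and conjugates the
  weights.\<close>

lemma op_adj_wshift:
  assumes D: "D \<subseteq> I" "E \<subseteq> I" and \<sigma>: "bij_betw \<sigma> D E"
    and \<tau>: "\<And>k. k \<in> D \<Longrightarrow> \<tau> (\<sigma> k) = k"
    and u: "\<And>k. k \<in> D \<Longrightarrow> cmod (u k) \<le> 1" and v: "\<And>k. k \<in> D \<Longrightarrow> v (\<sigma> k) = cnj (u k)"
  shows "op_adj I (wshift I D u \<sigma>) = wshift I E v \<tau>"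
proof (rule op_adj_eqI_unit_vec)
  have E: "E = \<sigma> ` D" using \<sigma> by (simp add: bij_betw_def)
  show "wshift I D u \<sigma> \<in> bounded_ops I"
    using D \<sigma> u by (intro wshift_bounded) (auto simp: bij_betw_def)
  show "wshift I E v \<tau> \<in> bounded_ops I"
    using D \<tau> u v by (intro wshift_bounded) (auto simp: E inj_on_def)
  fix k l assume kl: "k \<in> I" "l \<in> I"
  have iff: "k \<in> E \<and> \<tau> k = l \<longleftrightarrow> l \<in> D \<and> \<sigma> l = k"
  proof
    assume k: "k \<in> E \<and> \<tau> k = l"
    then obtain d where "d \<in> D" "k = \<sigma> d" unfolding E by blast
    with k \<tau>[of d] show "l \<in> D \<and> \<sigma> l = k" by simp
  next
    assume "l \<in> D \<and> \<sigma> l = k"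
    then show "k \<in> E \<and> \<tau> k = l" using \<tau>[of l] imageI[of l D \<sigma>] by (simp add: E)
  qed
  have "wshift I E v \<tau> (unit_vec l) k = (if k \<in> E \<and> \<tau> k = l then v k else 0)"
    using kl by (simp add: wshift_def unit_vec_ell2) (simp add: unit_vec_def)
  also have "\<dots> = cnj (if l \<in> D \<and> \<sigma> l = k then u l else 0)"
    unfolding iff using v by auto
  also have "(if l \<in> D \<and> \<sigma> l = k then u l else 0) = wshift I D u \<sigma> (unit_vec k) l"
    using kl by (simp add: wshift_def unit_vec_ell2) (simp add: unit_vec_def)
  finally show "wshift I E v \<tau> (unit_vec l) k = cnj (wshift I D u \<sigma> (unit_vec k) l)" .
qed

section \<open>Tensor products\<close>

lemma tensor_vec_unit_vec:
  assumes "finite J" "k \<in> Pi\<^sub>E J I"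
  shows "tensor_vec J I (\<lambda>j. unit_vec (k j)) = unit_vec k"
proof
  fix l
  show "tensor_vec J I (\<lambda>j. unit_vec (k j)) l = unit_vec k l"
  proof (cases "l = k")
    case True
    then show ?thesis using assms by (simp add: tensor_vec_def unit_vec_def)
  next
    case False
    have "\<exists>j\<in>J. l j \<noteq> k j" if "l \<in> Pi\<^sub>E J I"
      using False that assms(2) by (meson PiE_ext)
    then show ?thesis
      using False assms(1) by (auto simp: tensor_vec_def unit_vec_def prod_zero_iff)
  qed
qed

text \<open>Resolves the definite description in \<open>tensor_op\<close>. Uniqueness holds because
  the unit vectors of the product index set are themselves elementary tensors.\<close>

lemma tensor_op_eqI:
  assumes J: "finite J" and B: "B \<in> bounded_ops (Pi\<^sub>E J I)"
    and eq: "\<And>f. (\<And>j. j \<in> J \<Longrightarrow> f j \<in> ell2 (I j)) \<Longrightarrow>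
      B (tensor_vec J I f) = tensor_vec J I (\<lambda>j. A j (f j))"
  shows "tensor_op J I A = B"
  unfolding tensor_op_def
proof (rule the_equality)
  show "B \<in> bounded_ops (Pi\<^sub>E J I) \<and>
      (\<forall>f. (\<forall>j\<in>J. f j \<in> ell2 (I j)) \<longrightarrow> B (tensor_vec J I f) = tensor_vec J I (\<lambda>j. A j (f j)))"
    using B eq by simp
  fix B' assume B': "B' \<in> bounded_ops (Pi\<^sub>E J I) \<and>
      (\<forall>f. (\<forall>j\<in>J. f j \<in> ell2 (I j)) \<longrightarrow> B' (tensor_vec J I f) = tensor_vec J I (\<lambda>j. A j (f j)))"
  show "B' = B"
  proof (rule op_eqI_unit_vec)
    fix k assume k: "k \<in> Pi\<^sub>E J I"
    have "unit_vec (k j) \<in> ell2 (I j)" if "j \<in> J" for j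
      using k that by (auto intro: unit_vec_ell2)
    then have "B' (tensor_vec J I (\<lambda>j. unit_vec (k j))) = B (tensor_vec J I (\<lambda>j. unit_vec (k j)))"
      using B' eq by simp
    then show "B' (unit_vec k) = B (unit_vec k)"
      by (simp add: tensor_vec_unit_vec J k)
  qed (use B B' in auto)
qed

lemma tensor_vec_ell2:
  assumes J: "finite J" and f: "\<And>j. j \<in> J \<Longrightarrow> f j \<in> ell2 (I j)"
  shows "tensor_vec J I f \<in> ell2 (Pi\<^sub>E J I)"
proof (rule ell2I)
  show "tensor_vec J I f k = 0" if "k \<notin> Pi\<^sub>E J I" for k
    using that by (simp add: tensor_vec_def)
  show "L2_set (\<lambda>k. cmod (tensor_vec J I f k)) F \<le> sqrt (\<Prod>j\<in>J. (ell2_norm (I j) (f j))\<^sup>2)"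
    if F: "finite F" "F \<subseteq> Pi\<^sub>E J I" for F
  proof -
    \<comment> \<open>A finite set of multi-indices is enlarged to the box of its coordinate
      projections, where the sum of products factors into a product of sums.\<close>
    define B where "B j = (\<lambda>k. k j) ` F" for j
    have B: "finite (B j)" "j \<in> J \<Longrightarrow> B j \<subseteq> I j" for j
      using F by (auto simp: B_def)
    have sub: "F \<subseteq> Pi\<^sub>E J B"
      using F(2) by (auto simp: B_def PiE_def)
    have "(\<Sum>k\<in>F. (cmod (tensor_vec J I f k))\<^sup>2) = (\<Sum>k\<in>F. \<Prod>j\<in>J. (cmod (f j (k j)))\<^sup>2)"
      using F(2) by (intro sum.cong) (auto simp: tensor_vec_def prod_power_distrib simp flip: prod_norm)
    also have "\<dots> \<le> (\<Sum>k\<in>Pi\<^sub>E J B. \<Prod>j\<in>J. (cmod (f j (k j)))\<^sup>2)"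
      using J B sub by (intro sum_mono2 finite_PiE prod_nonneg) auto
    also have "\<dots> = (\<Prod>j\<in>J. \<Sum>l\<in>B j. (cmod (f j l))\<^sup>2)"
      using J B by (intro prod_sum_PiE[symmetric]) auto
    also have "\<dots> \<le> (\<Prod>j\<in>J. (ell2_norm (I j) (f j))\<^sup>2)"
      unfolding ell2_norm_power2 using B
      by (intro prod_mono conjI sum_nonneg finite_sum_le_infsum ell2_summable f) auto
    finally show ?thesis by (simp add: L2_set_def)
  qed
qed

lemma shift_op_eq_wshift:
  assumes "\<And>l. l \<in> I \<Longrightarrow> l + 1 \<in> I"
  shows "shift_op I = wshift I I (\<lambda>_. 1) (\<lambda>l. l + 1)"
  using assms by (auto simp: shift_op_def wshift_def intro!: restrict_ext)

text \<open>The translate of I by 1 is everything on a bilateral leg and omits 0 on a unilateral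
  one. This missing point is why only an isometry results there.\<close>

lemma op_adj_shift_op:
  assumes "\<And>l. l \<in> I \<Longrightarrow> l + 1 \<in> I"
  shows "op_adj I (shift_op I) = wshift I ((\<lambda>l. l + 1) ` I) (\<lambda>_. 1) (\<lambda>l. l - 1)"
proof -
  have eq: "shift_op I = wshift I I (\<lambda>_. 1) (\<lambda>l. l + 1)"
    by (rule shift_op_eq_wshift) (rule assms)
  show ?thesis
    unfolding eq using assms by (intro op_adj_wshift) (auto simp: bij_betw_def inj_on_def)
qed

section \<open>The twisted shifts\<close>

locale twisted_shifts =
  fixes m n :: nat and \<theta> :: "nat \<Rightarrow> nat \<Rightarrow> real"
begin

abbreviation "G \<equiv> {1..m+n}"
abbreviation "H \<equiv> H_index m n"
abbreviation "R \<equiv> twist_relations m n \<theta>"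

text \<open>The total phase that \<open>T g\<close> picks up at the index k from the legs to the
  right of g.\<close>

definition angle :: "nat \<Rightarrow> (nat \<Rightarrow> int) \<Rightarrow> real" where
  "angle g k = (\<Sum>j\<in>{g<..m+n}. 2 * pi * \<theta> g j * of_int (k j))"

text \<open>For g in G the down-move leaves H only at 0 on a unilateral leg. For g outside G the
  default value \<open>undefined\<close> in coordinate g does not survive a move, so
  \<open>dom_dn\<close> and \<open>dom_up\<close> are empty and \<open>T g\<close> is zero; the
  family is thus total, as \<open>op_family\<close> requires.\<close>

definition dom_dn :: "nat \<Rightarrow> (nat \<Rightarrow> int) set" where
  "dom_dn g = {k \<in> H. k(g := k g - 1) \<in> H}"

definition dom_up :: "nat \<Rightarrow> (nat \<Rightarrow> int) set" where
  "dom_up g = {k \<in> H. k(g := k g + 1) \<in> H}"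

text \<open>The coordinate form of \<open>T_op\<close>, as \<open>T_op_eq\<close> shows. Raising a
  basis vector by one evaluates a function one step lower, hence the down-move in the
  argument.\<close>

definition T :: "nat \<Rightarrow> (nat \<Rightarrow> int) op" where
  "T g = wshift H (dom_dn g) (\<lambda>k. cis (angle g k)) (\<lambda>k. k(g := k g - 1))"

lemma mem_H_iff: "k \<in> H \<longleftrightarrow> (\<forall>i\<in>G. m < i \<longrightarrow> 0 \<le> k i) \<and> (\<forall>i. i \<notin> G \<longrightarrow> k i = undefined)"
  by (auto simp: H_index_def leg_def PiE_iff extensional_def)

text \<open>The phase reads only the legs strictly to the right of g. Hence a move in leg g leaves
  it fixed, and the weight of the adjoint of \<open>T g\<close> is simply the one with the opposite
  angle.\<close>

lemma angle_upd [simp]: "angle g (k(g := x)) = angle g k"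
  by (simp add: angle_def)

lemma T_bounded: "T g \<in> bounded_ops H"
  unfolding T_def
proof (rule wshift_bounded)
  show "inj_on (\<lambda>k. k(g := k g - 1)) (dom_dn g)"
  proof (rule inj_on_inverseI)
    show "(\<lambda>k. k(g := k g + 1)) (k(g := k g - 1)) = k" for k :: "nat \<Rightarrow> int" by simp
  qed
qed (auto simp: dom_dn_def)

lemma op_adj_T:
  "op_adj H (T g) = wshift H (dom_up g) (\<lambda>k. cis (- angle g k)) (\<lambda>k. k(g := k g + 1))"
  unfolding T_def
proof (rule op_adj_wshift)
  show "bij_betw (\<lambda>k. k(g := k g - 1)) (dom_dn g) (dom_up g)"
    by (rule bij_betw_byWitness[where f' = "\<lambda>k. k(g := k g + 1)"]) (auto simp: dom_dn_def dom_up_def)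
qed (auto simp: dom_dn_def dom_up_def cis_cnj)

lemma T_op_eq:
  assumes i: "i \<in> G" shows "T_op m n \<theta> i = T i"
  unfolding T_op_def
proof (rule tensor_op_eqI)
  show "T i \<in> bounded_ops (Pi\<^sub>E G (leg m))"
    using T_bounded by (simp add: H_index_def)
  fix f :: "nat \<Rightarrow> int \<Rightarrow> complex" assume f: "\<And>j. j \<in> G \<Longrightarrow> f j \<in> ell2 (leg m j)"
  let ?A = "\<lambda>j. if j < i then \<lambda>f\<in>ell2 (leg m j). f
          else if j = i then op_adj (leg m j) (shift_op (leg m j)) else phase_op (leg m j) (\<theta> i j)"
  have mem: "tensor_vec G (leg m) f \<in> ell2 H"
    unfolding H_index_def using f by (intro tensor_vec_ell2) auto
  show "T i (tensor_vec G (leg m) f) = tensor_vec G (leg m) (\<lambda>j. ?A j (f j))"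
  proof
    fix k
    show "T i (tensor_vec G (leg m) f) k = tensor_vec G (leg m) (\<lambda>j. ?A j (f j)) k"
    proof (cases "k \<in> H")
      case False
      then show ?thesis
        using mem by (auto simp: T_def wshift_def tensor_vec_def dom_dn_def H_index_def)
    next
      case k: True
      let ?k' = "k(i := k i - 1)"
      \<comment> \<open>The scalar that the j-th tensor factor contributes at k: 1 to the left of i,
        the indicator of an admissible down-move in leg i itself, and a phase to the right.\<close>
      define c where "c j = (if j < i then 1 else if j = i then (if k \<in> dom_dn i then 1 else 0)
          else cis (2 * pi * \<theta> i j * of_int (k j)))" for j
      have step: "?A j (f j) (k j) = c j * f j (?k' j)" if j: "j \<in> G" for j
      proof -
        consider "j < i" | "j = i" | "i < j" by linarith
        then show ?thesis
        proof cases
          case 2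
          have up: "l \<in> leg m i \<Longrightarrow> l + 1 \<in> leg m i" for l
            by (auto simp: leg_def split: if_splits)
          have "k i \<in> (\<lambda>l. l + 1) ` leg m i \<longleftrightarrow> k \<in> dom_dn i"
          proof -
            have "k i \<in> (\<lambda>l. l + 1) ` leg m i \<longleftrightarrow> k i - 1 \<in> leg m i"
              by (auto simp: image_iff intro: bexI[of _ "k i - 1"])
            also have "\<dots> \<longleftrightarrow> k \<in> dom_dn i"
              using k i by (auto simp: dom_dn_def mem_H_iff leg_def)
            finally show ?thesis .
          qed
          then show ?thesis
            using 2 f[OF i] by (simp add: op_adj_shift_op[OF up] wshift_def c_def)
        next
          case 3
          then show ?thesis
            using f[OF j] by (simp add: phase_op_def c_def cis_conv_exp mult_ac)
        qed (use f[OF j] in \<open>simp add: c_def\<close>)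
      qed
      have "tensor_vec G (leg m) (\<lambda>j. ?A j (f j)) k = (\<Prod>j\<in>G. c j * f j (?k' j))"
        unfolding tensor_vec_def using k prod.cong[OF refl step, of G]
        by (simp only: H_index_def if_True)
      also have "\<dots> = (\<Prod>j\<in>G. c j) * (\<Prod>j\<in>G. f j (?k' j))"
        by (rule prod.distrib)
      also have "(\<Prod>j\<in>G. c j) = (if k \<in> dom_dn i then cis (angle i k) else 0)"
      proof (cases "k \<in> dom_dn i")
        case True
        have "(\<Prod>j\<in>G. c j) = (\<Prod>j\<in>{i<..m+n}. cis (2 * pi * \<theta> i j * of_int (k j)))"
          using True i by (intro prod.mono_neutral_cong_right) (auto simp: c_def)
        also have "\<dots> = cis (angle i k)"
          unfolding angle_def
          by (induction rule: infinite_finite_induct[of _ "{i<..m+n}"]) (simp_all add: cis_mult)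
        finally show ?thesis using True by simp
      next
        case False
        then show ?thesis using i by (auto simp: c_def intro!: bexI[of _ i])
      qed
      also have "(if k \<in> dom_dn i then cis (angle i k) else 0) * (\<Prod>j\<in>G. f j (?k' j)) =
          T i (tensor_vec G (leg m) f) k"
        using mem by (auto simp: T_def wshift_def tensor_vec_def dom_dn_def H_index_def)
      finally show ?thesis ..
    qed
  qed
qed simp

sublocale op_family H T
  by unfold_locales (rule T_bounded)

lemma T_apply:
  "f \<in> ell2 H \<Longrightarrow> T g f k = (if k \<in> dom_dn g then cis (angle g k) * f (k(g := k g - 1)) else 0)"
  by (simp add: T_def wshift_def)

lemma op_adj_T_apply:
  "f \<in> ell2 H \<Longrightarrow>
    op_adj H (T g) f k = (if k \<in> dom_up g then cis (- angle g k) * f (k(g := k g + 1)) else 0)"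
  by (simp add: op_adj_T wshift_def)

text \<open>The phases in the exchange rules come from here: a move in leg h is seen by exactly the
  generators of smaller index.\<close>

lemma angle_upd_diff:
  assumes "h \<in> G"
  shows "angle g (k(h := k h + c)) = angle g k + (if g < h then 2 * pi * \<theta> g h * of_int c else 0)"
proof (cases "g < h")
  case True
  then have h: "h \<in> {g<..m+n}" using assms by simp
  then show ?thesis
    unfolding angle_def using True
    by (auto simp: sum.remove[OF _ h] algebra_simps intro!: sum.cong)
next
  case False
  then show ?thesis by (auto simp: angle_def intro!: sum.cong)
qed

lemma poly_op_relation:
  assumes "r \<in> R" shows "poly_op r = (\<lambda>f\<in>ell2 H. \<lambda>i. 0)"
proof (rule op_eqI[OF poly_op_bounded zero_bounded_ops])
  fix f :: "(nat \<Rightarrow> int) \<Rightarrow> complex" assume f: "f \<in> ell2 H"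
  have Tf: "T g f \<in> ell2 H" and T'f: "op_adj H (T g) f \<in> ell2 H" for g
    by (intro bounded_ops_closed[OF T_bounded] bounded_ops_closed[OF op_adj_bounded[OF T_bounded]] f)+
  have vanish: "k \<notin> H \<Longrightarrow> f k = 0" for k by (rule ell2_memD[OF f])
  consider (comm) i j where "i \<in> G" "j \<in> G" "i < j"
      "r = pstar (gen i) * gen j - pscale (exp (- 2 * of_real pi * \<i> * of_real (\<theta> i j))) (gen j * pstar (gen i))"
    | (iso) i where "i \<in> G" "r = pstar (gen i) * gen i - 1"
    | (unit) i where "i \<in> G" "i \<le> m" "r = gen i * pstar (gen i) - 1"
    using assms by (auto simp: twist_relations_def)
  then have "poly_op r f k = 0" for k
  proof cases
    case comm
    have exp: "exp (- 2 * of_real pi * \<i> * of_real (\<theta> i j)) = cis (- (2 * pi * \<theta> i j))"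
      by (simp add: cis_conv_exp mult_ac)
    have swap: "k(i := k i + 1, j := k j - 1) = k(j := k j - 1, i := k i + 1)"
      using comm by (auto simp: fun_upd_twist)
    \<comment> \<open>Leg j lies to the right of i, so \<open>T i\<close> registers the move in leg
      j, whereas by \<open>ang'\<close> the generator j does not see leg i. This asymmetry produces
      the phase of the relation.\<close>
    have ang: "angle i (k(j := k j - 1)) = angle i k - 2 * pi * \<theta> i j"
      using angle_upd_diff[of j i k "-1"] comm by simp
    have ang': "angle j (k(i := k i + 1)) = angle j k"
      using angle_upd_diff[of i j k 1] comm by simp
    have dom: "k \<in> dom_up i \<and> k(i := k i + 1) \<in> dom_dn j \<longleftrightarrow> k \<in> dom_dn j \<and> k(j := k j - 1) \<in> dom_up i"
      using comm by (auto simp: dom_up_def dom_dn_def mem_H_iff split: if_splits)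
    have "op_adj H (T i) (T j f) k = cis (- (2 * pi * \<theta> i j)) * T j (op_adj H (T i) f) k"
    proof (cases "k \<in> dom_up i \<and> k(i := k i + 1) \<in> dom_dn j")
      case True
      have "cis (- angle i k) = cis (- (2 * pi * \<theta> i j)) * cis (- (angle i k - 2 * pi * \<theta> i j))"
        by (simp add: cis_mult)
      then show ?thesis
        using True dom comm
        by (simp add: op_adj_T_apply T_apply f Tf T'f ang ang' swap mult_ac del: cis_mult)
    next
      case False
      then show ?thesis using dom comm by (auto simp: op_adj_T_apply T_apply f Tf T'f)
    qed
    then show ?thesis
      using f exp by (simp add: comm(4) poly_op_diff poly_op_mult_apply poly_op_pscale poly_op_pstar
          poly_op_gen Tf T'f)
  next
    case iso
    have "op_adj H (T i) (T i f) k = f k"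
    proof (cases "k \<in> H")
      case True
      then have "k \<in> dom_up i" "k(i := k i + 1) \<in> dom_dn i"
        using iso by (auto simp: dom_up_def dom_dn_def mem_H_iff)
      then show ?thesis by (simp add: op_adj_T_apply T_apply f Tf cis_mult)
    next
      case False
      then show ?thesis by (simp add: op_adj_T_apply Tf vanish dom_up_def)
    qed
    then show ?thesis
      using f by (simp add: iso(2) poly_op_diff poly_op_mult_apply poly_op_pstar poly_op_gen poly_op_one)
  next
    case unit
    have "T i (op_adj H (T i) f) k = f k"
    proof (cases "k \<in> H")
      case True
      then have "k \<in> dom_dn i" "k(i := k i - 1) \<in> dom_up i"
        using unit by (auto simp: dom_up_def dom_dn_def mem_H_iff)
      then show ?thesis by (simp add: op_adj_T_apply T_apply f T'f cis_mult)
    next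
      case False
      then show ?thesis by (simp add: T_apply T'f vanish dom_dn_def)
    qed
    then show ?thesis
      using f by (simp add: unit(3) poly_op_diff poly_op_mult_apply poly_op_pstar poly_op_gen poly_op_one)
  qed
  then show "poly_op r f = (\<lambda>f\<in>ell2 H. \<lambda>i. 0) f" using f by auto
qed

lemma cstar_seminorm_poly_op_H: "cstar_seminorm G R (\<lambda>p. op_norm H (poly_op p))"
  by (rule cstar_seminorm_poly_op) (rule poly_op_relation)

text \<open>The action, up to a unimodular constant, of the normally ordered monomial with exponents
  \<open>a\<close> of the generators and \<open>b\<close> of their adjoints.\<close>

definition chi :: "(nat \<Rightarrow> int) \<Rightarrow> (nat \<Rightarrow> int) \<Rightarrow> complex" where
  "chi d k = cis (\<Sum>g\<in>G. of_int (d g) * angle g k)"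

text \<open>The cut-off at a on the unilateral legs describes the range of the isometry s^a. On the
  bilateral legs nothing is cut off, and only the net exponent a - b is visible, as it is in the
  phase.\<close>

definition normal_op :: "(nat \<Rightarrow> nat) \<Rightarrow> (nat \<Rightarrow> nat) \<Rightarrow> (nat \<Rightarrow> int) op" where
  "normal_op a b f k = (if k \<in> H \<and> (\<forall>i\<in>G. m < i \<longrightarrow> int (a i) \<le> k i)
     then chi (\<lambda>i. int (a i) - int (b i)) k *
       f (\<lambda>i. if i \<in> G then k i - int (a i) + int (b i) else undefined) else 0)"

text \<open>Moving leg g changes the angles of the generators h < g by amounts that do not depend on
  k, so carrying \<open>chi\<close> across the move costs a constant factor, whose argument is
  \<open>?s\<close>.\<close>

lemma chi_step:
  assumes "g \<in> G"
  shows "\<exists>\<kappa>. cmod \<kappa> = 1 \<and>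
    (\<forall>k. cis (of_int c * angle g k) * chi d (k(g := k g + e)) = \<kappa> * chi (d(g := d g + c)) k)"
proof (intro exI conjI allI)
  let ?s = "\<Sum>h\<in>G. of_int (d h) * (if h < g then 2 * pi * \<theta> h g * of_int e else 0)"
  show "cmod (cis ?s) = 1" by simp
  fix k
  have "(\<Sum>h\<in>G. of_int ((d(g := d g + c)) h) * angle h k) =
      (\<Sum>h\<in>G. of_int (d h) * angle h k + (if h = g then of_int c * angle g k else 0))"
    by (intro sum.cong) (auto simp: algebra_simps)
  also have "\<dots> = (\<Sum>h\<in>G. of_int (d h) * angle h k) + of_int c * angle g k"
    using assms by (simp add: sum.distrib)
  finally show "cis (of_int c * angle g k) * chi d (k(g := k g + e)) = cis ?s * chi (d(g := d g + c)) k"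
    by (simp only: chi_def angle_upd_diff[OF assms] cis_mult distrib_left sum.distrib)
      (simp add: algebra_simps)
qed

text \<open>Logical glue for the domain of a product. A and B stand for nonnegativity of k and of
  the moved point on the unilateral legs, C and D for the cut-off before and after the step, U and
  U' for the default values outside G. It reduces the equality of domains to a comparison leg by
  leg.\<close>

lemma ball_conj_regroup:
  assumes "(\<forall>i\<in>S. P i \<longrightarrow> A i \<and> B i \<and> C i) \<longleftrightarrow> (\<forall>i\<in>S. P i \<longrightarrow> A i \<and> D i)"
    and "U' \<longleftrightarrow> U"
  shows "(((\<forall>i\<in>S. P i \<longrightarrow> A i) \<and> U) \<and> (\<forall>i\<in>S. P i \<longrightarrow> B i) \<and> U') \<and> (\<forall>i\<in>S. P i \<longrightarrow> C i) \<longleftrightarrow>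
    ((\<forall>i\<in>S. P i \<longrightarrow> A i) \<and> U) \<and> (\<forall>i\<in>S. P i \<longrightarrow> D i)"
  using assms by blast

text \<open>On a bilateral leg an adjoint can be cancelled, because nothing is cut off there. On a
  unilateral leg s s* is a proper projection, so the exponent a has to grow even when adjoints are
  present.\<close>

lemma normal_op_T:
  assumes g: "g \<in> G" and step: "if m < g \<or> b g = 0 then a' = a(g := a g + 1) \<and> b' = b
      else a' = a \<and> b' = b(g := b g - 1)"
  shows "\<exists>\<kappa>. cmod \<kappa> = 1 \<and> (\<forall>f k.
    (if k \<in> dom_dn g then cis (angle g k) * normal_op a b f (k(g := k g - 1)) else 0) =
      \<kappa> * normal_op a' b' f k)"
proof -
  define d where "d = (\<lambda>i. int (a i) - int (b i))"
  have d': "(\<lambda>i. int (a' i) - int (b' i)) = d(g := d g + 1)"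
    using step by (auto simp: d_def fun_eq_iff split: if_splits)
  obtain \<kappa> where \<kappa>: "cmod \<kappa> = 1"
      "\<And>k. cis (angle g k) * chi d (k(g := k g - 1)) = \<kappa> * chi (d(g := d g + 1)) k"
    using chi_step[OF g, of 1 d "-1"] by auto
  have "(if k \<in> dom_dn g then cis (angle g k) * normal_op a b f (k(g := k g - 1)) else 0) =
      \<kappa> * normal_op a' b' f k" for f k
  proof -
    let ?k = "k(g := k g - 1)"
    have per: "0 \<le> k i \<and> 0 \<le> ?k i \<and> int (a i) \<le> ?k i \<longleftrightarrow> 0 \<le> k i \<and> int (a' i) \<le> k i"
      if "i \<in> G" "m < i" for i
      using step that by (cases "i = g") (auto split: if_splits)
    then have all_per: "(\<forall>i\<in>G. m < i \<longrightarrow> 0 \<le> k i \<and> 0 \<le> ?k i \<and> int (a i) \<le> ?k i) \<longleftrightarrow>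
        (\<forall>i\<in>G. m < i \<longrightarrow> 0 \<le> k i \<and> int (a' i) \<le> k i)"
      by (intro ball_cong) simp_all
    have all_off: "(\<forall>i. i \<notin> G \<longrightarrow> ?k i = undefined) \<longleftrightarrow> (\<forall>i. i \<notin> G \<longrightarrow> k i = undefined)"
      using g by auto
    have dom: "k \<in> dom_dn g \<and> (\<forall>i\<in>G. m < i \<longrightarrow> int (a i) \<le> ?k i) \<longleftrightarrow>
        k \<in> H \<and> (\<forall>i\<in>G. m < i \<longrightarrow> int (a' i) \<le> k i)"
      unfolding dom_dn_def mem_H_iff mem_Collect_eq by (rule ball_conj_regroup[OF all_per all_off])
    have arg: "(\<lambda>i. if i \<in> G then (k(g := k g - 1)) i - int (a i) + int (b i) else undefined) =
        (\<lambda>i. if i \<in> G then k i - int (a' i) + int (b' i) else undefined)"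
      using step by (auto simp: fun_eq_iff split: if_splits)
    define C C' where "C \<longleftrightarrow> (\<forall>i\<in>G. m < i \<longrightarrow> int (a i) \<le> ?k i)"
      and "C' \<longleftrightarrow> (\<forall>i\<in>G. m < i \<longrightarrow> int (a' i) \<le> k i)"
    have mem: "k \<in> dom_dn g \<Longrightarrow> ?k \<in> H" by (simp only: dom_dn_def mem_Collect_eq)
    show ?thesis
      using dom \<kappa>(2)[of k]
      unfolding normal_op_def d' arg d_def[symmetric] C_def[symmetric] C'_def[symmetric]
      by (cases "k \<in> dom_dn g \<and> C") (auto simp: mem mult.assoc[symmetric] simp del: fun_upd_apply)
  qed
  with \<kappa>(1) show ?thesis by blast
qed

text \<open>Since s* s = 1 on every leg, an adjoint cancels a generator whenever one is present; in
  coordinates the cut-off a \<le> k + 1 becomes a - 1 \<le> k.\<close>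

lemma normal_op_T_adj:
  assumes g: "g \<in> G" and step: "if a g = 0 then a' = a \<and> b' = b(g := b g + 1)
      else a' = a(g := a g - 1) \<and> b' = b"
  shows "\<exists>\<kappa>. cmod \<kappa> = 1 \<and> (\<forall>f k.
    (if k \<in> dom_up g then cis (- angle g k) * normal_op a b f (k(g := k g + 1)) else 0) =
      \<kappa> * normal_op a' b' f k)"
proof -
  define d where "d = (\<lambda>i. int (a i) - int (b i))"
  have d': "(\<lambda>i. int (a' i) - int (b' i)) = d(g := d g + (-1))"
    using step by (auto simp: d_def fun_eq_iff split: if_splits)
  obtain \<kappa> where \<kappa>: "cmod \<kappa> = 1"
      "\<And>k. cis (- angle g k) * chi d (k(g := k g + 1)) = \<kappa> * chi (d(g := d g + (-1))) k"
    using chi_step[OF g, of "-1" d 1] by auto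
  have "(if k \<in> dom_up g then cis (- angle g k) * normal_op a b f (k(g := k g + 1)) else 0) =
      \<kappa> * normal_op a' b' f k" for f k
  proof -
    let ?k = "k(g := k g + 1)"
    have per: "0 \<le> k i \<and> 0 \<le> ?k i \<and> int (a i) \<le> ?k i \<longleftrightarrow> 0 \<le> k i \<and> int (a' i) \<le> k i"
      if "i \<in> G" "m < i" for i
      using step that by (cases "i = g") (auto split: if_splits)
    then have all_per: "(\<forall>i\<in>G. m < i \<longrightarrow> 0 \<le> k i \<and> 0 \<le> ?k i \<and> int (a i) \<le> ?k i) \<longleftrightarrow>
        (\<forall>i\<in>G. m < i \<longrightarrow> 0 \<le> k i \<and> int (a' i) \<le> k i)"
      by (intro ball_cong) simp_all
    have all_off: "(\<forall>i. i \<notin> G \<longrightarrow> ?k i = undefined) \<longleftrightarrow> (\<forall>i. i \<notin> G \<longrightarrow> k i = undefined)"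
      using g by auto
    have dom: "k \<in> dom_up g \<and> (\<forall>i\<in>G. m < i \<longrightarrow> int (a i) \<le> ?k i) \<longleftrightarrow>
        k \<in> H \<and> (\<forall>i\<in>G. m < i \<longrightarrow> int (a' i) \<le> k i)"
      unfolding dom_up_def mem_H_iff mem_Collect_eq by (rule ball_conj_regroup[OF all_per all_off])
    have arg: "(\<lambda>i. if i \<in> G then (k(g := k g + 1)) i - int (a i) + int (b i) else undefined) =
        (\<lambda>i. if i \<in> G then k i - int (a' i) + int (b' i) else undefined)"
      using step by (auto simp: fun_eq_iff split: if_splits)
    define C C' where "C \<longleftrightarrow> (\<forall>i\<in>G. m < i \<longrightarrow> int (a i) \<le> ?k i)"
      and "C' \<longleftrightarrow> (\<forall>i\<in>G. m < i \<longrightarrow> int (a' i) \<le> k i)"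
    have mem: "k \<in> dom_up g \<Longrightarrow> ?k \<in> H" by (simp only: dom_up_def mem_Collect_eq)
    show ?thesis
      using dom \<kappa>(2)[of k]
      unfolding normal_op_def d' arg d_def[symmetric] C_def[symmetric] C'_def[symmetric]
      by (cases "k \<in> dom_up g \<and> C") (auto simp: mem mult.assoc[symmetric] simp del: fun_upd_apply)
  qed
  with \<kappa>(1) show ?thesis by blast
qed

end

section \<open>Normal forms of words\<close>

lemma pscale_uminus: "pscale (- c) p = - pscale c p"
  by (rule poly_mapping_eqI) (simp add: lookup_pscale)

context cstar_norm
begin

text \<open>The unimodular factor is hidden because the norm estimates do not depend on its value.
  What the rewriting of words uses is that this is an equivalence on the free *-algebra, compatible
  with products and adjoints.\<close>

definition phase_eq :: "'g star_poly \<Rightarrow> 'g star_poly \<Rightarrow> bool" where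
  "phase_eq p q \<longleftrightarrow> p \<in> \<A> G \<and> q \<in> \<A> G \<and>
     (\<exists>\<kappa>. cmod \<kappa> = 1 \<and> \<nu> (p - pscale \<kappa> q) = 0)"

lemma phase_eqI:
  "p \<in> \<A> G \<Longrightarrow> q \<in> \<A> G \<Longrightarrow> cmod \<kappa> = 1 \<Longrightarrow>
    \<nu> (p - pscale \<kappa> q) = 0 \<Longrightarrow> phase_eq p q"
  by (auto simp: phase_eq_def)

lemma phase_eq_refl: "p \<in> \<A> G \<Longrightarrow> phase_eq p p"
  by (rule phase_eqI[where \<kappa> = 1]) (simp_all add: zero)

lemma phase_eq_zero:
  assumes "p \<in> \<A> G" "q \<in> \<A> G" "\<nu> (p - q) = 0" shows "phase_eq p q"
  using assms by (intro phase_eqI[where \<kappa> = 1]) simp_all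

lemma phase_eq_sym:
  assumes "phase_eq p q" shows "phase_eq q p"
proof -
  obtain \<kappa> where *: "p \<in> \<A> G" "q \<in> \<A> G" "cmod \<kappa> = 1"
      "\<nu> (p - pscale \<kappa> q) = 0"
    using assms by (auto simp: phase_eq_def)
  have "\<kappa> \<noteq> 0" using *(3) by auto
  then have "q - pscale (inverse \<kappa>) p = pscale (- inverse \<kappa>) (p - pscale \<kappa> q)"
    by (simp add: pscale_diff pscale_uminus)
  then have "\<nu> (q - pscale (inverse \<kappa>) p) = 0"
    using * by (simp add: scale free_closed)
  with * show ?thesis by (intro phase_eqI[where \<kappa> = "inverse \<kappa>"]) (simp_all add: norm_inverse)
qed

lemma phase_eq_trans [trans]:
  assumes "phase_eq p q" "phase_eq q r" shows "phase_eq p r"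
proof -
  obtain \<kappa> \<kappa>' where *: "p \<in> \<A> G" "q \<in> \<A> G" "r \<in> \<A> G"
      "cmod \<kappa> = 1" "cmod \<kappa>' = 1" "\<nu> (p - pscale \<kappa> q) = 0" "\<nu> (q - pscale \<kappa>' r) = 0"
    using assms by (auto simp: phase_eq_def)
  have eq: "p - pscale (\<kappa> * \<kappa>') r = (p - pscale \<kappa> q) + pscale \<kappa> (q - pscale \<kappa>' r)"
    by (simp add: pscale_diff)
  have "\<nu> (p - pscale (\<kappa> * \<kappa>') r) = 0"
    unfolding eq using * by (intro eq_zero_add) (simp_all add: scale free_closed)
  with * show ?thesis by (intro phase_eqI[where \<kappa> = "\<kappa> * \<kappa>'"]) (simp_all add: norm_mult)
qed

lemma phase_eq_mult:
  assumes "phase_eq p q" "phase_eq p' q'" shows "phase_eq (p * p') (q * q')"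
proof -
  obtain \<kappa> \<kappa>' where *: "p \<in> \<A> G" "q \<in> \<A> G"
      "p' \<in> \<A> G" "q' \<in> \<A> G"
      "cmod \<kappa> = 1" "cmod \<kappa>' = 1" "\<nu> (p - pscale \<kappa> q) = 0" "\<nu> (p' - pscale \<kappa>' q') = 0"
    using assms by (auto simp: phase_eq_def)
  have eq: "p * p' - pscale (\<kappa> * \<kappa>') (q * q') =
      (p - pscale \<kappa> q) * p' + pscale \<kappa> (q * (p' - pscale \<kappa>' q'))"
    by (simp add: pscale_diff algebra_simps pscale_mult_left pscale_mult_right)
  have "\<nu> (p * p' - pscale (\<kappa> * \<kappa>') (q * q')) = 0"
    unfolding eq using * by (intro eq_zero_add)
      (simp_all add: scale free_closed eq_zero_mult_left eq_zero_mult_right)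
  with * show ?thesis
    by (intro phase_eqI[where \<kappa> = "\<kappa> * \<kappa>'"]) (simp_all add: norm_mult free_closed)
qed

lemma phase_eq_pstar:
  assumes "phase_eq p q" shows "phase_eq (pstar p) (pstar q)"
proof -
  obtain \<kappa> where *: "p \<in> \<A> G" "q \<in> \<A> G" "cmod \<kappa> = 1"
      "\<nu> (p - pscale \<kappa> q) = 0"
    using assms by (auto simp: phase_eq_def)
  have "\<nu> (pstar p - pscale (cnj \<kappa>) (pstar q)) = \<nu> (pstar (p - pscale \<kappa> q))"
    by (simp add: pstar_diff pstar_pscale)
  also have "\<dots> = 0" using * by (simp add: pstar free_closed)
  finally show ?thesis
    using * by (intro phase_eqI[where \<kappa> = "cnj \<kappa>"]) (simp_all add: free_closed)
qed

definition phase_commute :: "'g star_poly \<Rightarrow> 'g star_poly \<Rightarrow> bool" where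
  "phase_commute p q \<longleftrightarrow> phase_eq (p * q) (q * p)"

lemma phase_commute_one: "p \<in> \<A> G \<Longrightarrow> phase_commute p 1"
  by (simp add: phase_commute_def phase_eq_refl)

lemma phase_commute_mult:
  assumes "p \<in> \<A> G" "q \<in> \<A> G" "r \<in> \<A> G"
    "phase_commute p q" "phase_commute p r"
  shows "phase_commute p (q * r)"
proof -
  have "phase_eq (p * q * r) (q * p * r)"
    using assms by (intro phase_eq_mult[OF _ phase_eq_refl]) (simp_all add: phase_commute_def)
  also have "phase_eq (q * (p * r)) (q * (r * p))"
    using assms by (intro phase_eq_mult[OF phase_eq_refl]) (simp_all add: phase_commute_def)
  then have "phase_eq (q * p * r) (q * r * p)" by (simp add: mult.assoc)
  finally show ?thesis by (simp add: phase_commute_def mult.assoc)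
qed

lemma phase_commute_power:
  assumes "p \<in> \<A> G" "q \<in> \<A> G" "phase_commute p q"
  shows "phase_commute p (q ^ k)"
  using assms
  by (induction k) (simp_all add: phase_commute_one phase_commute_mult free_power)

lemma phase_commute_prod_list:
  assumes "p \<in> \<A> G"
    "\<And>q. q \<in> set qs \<Longrightarrow> q \<in> \<A> G \<and> phase_commute p q"
  shows "phase_commute p (prod_list qs) \<and> prod_list qs \<in> \<A> G"
  using assms(2)
  by (induction qs) (auto intro!: phase_commute_mult phase_commute_one free_closed assms(1))

lemma phase_commute_sym: "phase_commute p q \<Longrightarrow> phase_commute q p"
  unfolding phase_commute_def by (rule phase_eq_sym)

lemma phase_commute_pstar: "phase_commute p q \<Longrightarrow> phase_commute (pstar p) (pstar q)"
  unfolding phase_commute_def using phase_eq_sym[OF phase_eq_pstar] by (fastforce simp: pstar_mult)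

text \<open>Expand \<open>(st - lts)\<^sup>*(st - lts)\<close>.\<close>

lemma isometries_commute:
  assumes s: "s \<in> \<A> G" and t: "t \<in> \<A> G"
    and iso: "\<nu> (pstar s * s - 1) = 0" "\<nu> (pstar t * t - 1) = 0"
    and l: "cmod l = 1" and comm: "\<nu> (pstar s * t - pscale (cnj l) (t * pstar s)) = 0"
  shows "phase_commute s t"
proof -
  let ?s = "pstar s" and ?t = "pstar t"
  have s': "?s \<in> \<A> G" "?t \<in> \<A> G" using s t by (simp_all add: free_closed)
  have ll: "l * cnj l = 1" "cnj l * l = 1"
    using l by (simp_all add: complex_norm_square[symmetric] mult.commute)
  \<comment> \<open>\<open>d\<close>, and below \<open>u\<close> and \<open>v\<close>, are the
    defects of the three relations. In the expansion the four units cancel, and every remaining term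
    contains a defect and is therefore null.\<close>
  define d where "d = ?s * t - pscale (cnj l) (t * ?s)"
  have d: "d \<in> \<A> G" "\<nu> d = 0" using comm s t s' by (simp_all add: d_def free_closed)
  have d': "pstar d \<in> \<A> G" "\<nu> (pstar d) = 0" using d by (simp_all add: free_closed pstar)
  have st: "?s * t = d + pscale (cnj l) (t * ?s)" by (simp add: d_def)
  have ts: "?t * s = pstar d + pscale l (s * ?t)"
    by (simp add: d_def pstar_diff pstar_pscale pstar_mult)
  define u v where "u = ?s * s - 1" and "v = ?t * t - 1"
  have uv: "u \<in> \<A> G" "\<nu> u = 0" "v \<in> \<A> G" "\<nu> v = 0"
    using s t s' iso by (simp_all add: u_def v_def free_closed)
  have su: "?s * s = 1 + u" and tv: "?t * t = 1 + v" by (simp_all add: u_def v_def)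
  let ?x = "s * t - pscale l (t * s)"
  have "pstar ?x * ?x = ?t * (?s * s) * t - pscale l (?t * (?s * t) * s)
      - pscale (cnj l) (?s * (?t * s) * t) + ?s * (?t * t) * s"
    by (simp add: pstar_diff pstar_pscale pstar_mult algebra_simps pscale_mult_left pscale_mult_right
        pscale_diff ll)
  also have "?t * (?s * s) * t = 1 + v + ?t * u * t"
    unfolding su by (simp add: algebra_simps tv)
  also have "?s * (?t * t) * s = 1 + u + ?s * v * s"
    unfolding tv by (simp add: algebra_simps su)
  also have "pscale l (?t * (?s * t) * s) = pscale l (?t * d * s) + (?t * t) * (?s * s)"
    unfolding st by (simp add: algebra_simps pscale_mult_left pscale_mult_right pscale_add ll)
  also have "(?t * t) * (?s * s) = 1 + v + u + v * u"
    unfolding su tv by (simp add: algebra_simps)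
  also have "pscale (cnj l) (?s * (?t * s) * t) = pscale (cnj l) (?s * pstar d * t) + (?s * s) * (?t * t)"
    unfolding ts by (simp add: algebra_simps pscale_mult_left pscale_mult_right pscale_add ll)
  also have "(?s * s) * (?t * t) = 1 + u + v + u * v"
    unfolding su tv by (simp add: algebra_simps)
  also have "1 + v + ?t * u * t - (pscale l (?t * d * s) + (1 + v + u + v * u))
      - (pscale (cnj l) (?s * pstar d * t) + (1 + u + v + u * v)) + (1 + u + ?s * v * s) =
      ?t * u * t + (?s * v * s + (pscale (- l) (?t * d * s) + (pscale (- cnj l) (?s * pstar d * t) +
        (pscale (-1) (u + v * u) + pscale (-1) (v + u * v)))))"
    by (simp add: pscale_uminus algebra_simps)
  finally have eq: "pstar ?x * ?x = \<dots>" .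
  have "\<nu> (pstar ?x * ?x) = 0"
    unfolding eq using s t s' d d' uv
    by (intro eq_zero_add) (simp_all add: eq_zero_mult_left eq_zero_mult_right
        free_closed scale eq_zero_add)
  then have "\<nu> ?x = 0" using s t by (simp add: cstar free_closed)
  then show ?thesis
    unfolding phase_commute_def using s t l
    by (intro phase_eqI[where \<kappa> = l]) (simp_all add: free_closed)
qed

end

section \<open>Rewriting words with the twisted relations\<close>

context twisted_shifts
begin

declare One_nat_def [simp del]

sublocale isometric_relations G R
  by unfold_locales (auto simp: twist_relations_def)

definition letter_poly :: "nat \<times> bool \<Rightarrow> nat star_poly" where
  "letter_poly x = (if snd x then pstar (gen (fst x)) else gen (fst x))"

definition leg_poly :: "(nat \<Rightarrow> nat) \<Rightarrow> (nat \<Rightarrow> nat) \<Rightarrow> nat \<Rightarrow> nat star_poly" where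
  "leg_poly a b i = gen i ^ a i * pstar (gen i) ^ b i"

text \<open>A list product in increasing order of the legs, because the factors do not
  commute.\<close>

definition normal_poly :: "(nat \<Rightarrow> nat) \<Rightarrow> (nat \<Rightarrow> nat) \<Rightarrow> nat star_poly" where
  "normal_poly a b = prod_list (map (leg_poly a b) [1..<m+n+1])"

lemma letter_poly_mem: "fst x \<in> G \<Longrightarrow> letter_poly x \<in> \<A> G"
  by (auto simp: letter_poly_def intro!: free_closed)

lemma leg_poly_mem: "i \<in> G \<Longrightarrow> leg_poly a b i \<in> \<A> G"
  unfolding leg_poly_def by (intro free_closed)

lemma generator_isometry: "i \<in> G \<Longrightarrow> unorm (pstar (gen i) * gen i - 1) = 0"
  by (intro unorm.relation isometry)

text \<open>The relations cover only an adjoint with smaller index against a generator with larger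
  index. \<open>isometries_commute\<close> adds the pair of generators, taking adjoints gives the
  other two pairs, and symmetry removes the order of the indices.\<close>

lemma letters_commute:
  assumes "fst x \<in> G" "fst y \<in> G" "fst x \<noteq> fst y"
  shows "unorm.phase_commute (letter_poly x) (letter_poly y)"
proof -
  have *: "unorm.phase_commute (gen i) (gen j)" "unorm.phase_commute (pstar (gen i)) (gen j)"
    if "i \<in> G" "j \<in> G" "i < j" for i j
  proof -
    have mem: "gen i \<in> \<A> G" "gen j \<in> \<A> G"
      using that by (intro free_gen; simp)+
    let ?l = "cis (2 * pi * \<theta> i j)"
    have exp: "exp (- 2 * of_real pi * \<i> * of_real (\<theta> i j)) = cnj ?l"
      by (simp only: cis_cnj) (simp add: cis_conv_exp mult_ac)
    have "unorm (pstar (gen i) * gen j -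
        pscale (exp (- 2 * of_real pi * \<i> * of_real (\<theta> i j))) (gen j * pstar (gen i))) = 0"
      using that by (intro unorm.relation) (force simp: twist_relations_def)
    then have rel: "unorm (pstar (gen i) * gen j - pscale (cnj ?l) (gen j * pstar (gen i))) = 0"
      unfolding exp .
    show "unorm.phase_commute (gen i) (gen j)"
      using that rel by (intro unorm.isometries_commute[where l = ?l] mem generator_isometry) auto
    show "unorm.phase_commute (pstar (gen i)) (gen j)"
      unfolding unorm.phase_commute_def using mem rel that
      by (intro unorm.phase_eqI[where \<kappa> = "cnj ?l"] free_closed) simp_all
  qed
  have all: "unorm.phase_commute (letter_poly (i, c)) (letter_poly (j, c'))"
    if "i \<in> G" "j \<in> G" "i < j" for i j c c'
    using *[OF that] unorm.phase_commute_pstar[OF *(1)[OF that]]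
      unorm.phase_commute_pstar[OF *(2)[OF that]]
    by (cases c; cases c') (simp_all add: letter_poly_def)
  show ?thesis
    using assms all[of "fst x" "fst y" "snd x" "snd y"]
      unorm.phase_commute_sym[OF all[of "fst y" "fst x" "snd y" "snd x"]]
    by (cases "fst x < fst y") auto
qed

lemma letter_leg_commute:
  assumes "fst x \<in> G" "i \<in> G" "fst x \<noteq> i"
  shows "unorm.phase_commute (letter_poly x) (leg_poly a b i)"
proof -
  have "unorm.phase_commute (letter_poly x) (letter_poly (i, c))" for c
    using assms by (intro letters_commute) auto
  from this[of True] this[of False] show ?thesis
    unfolding leg_poly_def using assms(1,2)
    by (intro unorm.phase_commute_mult unorm.phase_commute_power free_closed letter_poly_mem)
      (auto simp: letter_poly_def)
qed

text \<open>The letter moves right, past the legs before its own, at the cost of a phase, and is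
  absorbed by its own leg; the legs after it are untouched.\<close>

lemma letter_normal:
  assumes x: "fst x \<in> G"
    and leg: "unorm.phase_eq (letter_poly x * leg_poly a b (fst x)) (leg_poly a' b' (fst x))"
    and eq: "\<And>i. i \<noteq> fst x \<Longrightarrow> a' i = a i \<and> b' i = b i"
  shows "unorm.phase_eq (letter_poly x * normal_poly a b) (normal_poly a' b')"
proof -
  let ?g = "fst x"
  have "?g \<in> set [1..<m+n+1]" using x by auto
  then obtain us vs where split: "[1..<m+n+1] = us @ ?g # vs" by (meson split_list)
  have "distinct (us @ ?g # vs)" unfolding split[symmetric] by simp
  then have g: "?g \<notin> set us" "?g \<notin> set vs" by auto
  have "set (us @ ?g # vs) = G"
    unfolding split[symmetric] by (auto simp del: upt_Suc)
  then have G: "set us \<subseteq> G" "set vs \<subseteq> G" by auto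
  define P where "P ws = prod_list (map (leg_poly a b) ws)" for ws
  have P: "P ws \<in> \<A> G" if "set ws \<subseteq> G" for ws
    using that by (induction ws)
      (auto simp: P_def
        intro!: free_mult free_one leg_poly_mem)
  have P': "prod_list (map (leg_poly a' b') ws) = P ws" if "?g \<notin> set ws" for ws
  proof -
    have "map (leg_poly a' b') ws = map (leg_poly a b) ws"
    proof (intro map_cong refl)
      fix i assume "i \<in> set ws"
      with that have "i \<noteq> ?g" by auto
      with eq show "leg_poly a' b' i = leg_poly a b i" by (simp add: leg_poly_def)
    qed
    then show ?thesis by (simp only: P_def)
  qed
  have comm: "unorm.phase_commute (letter_poly x) (P us)"
    unfolding P_def using g(1) G(1) x
    by (intro unorm.phase_commute_prod_list[THEN conjunct1] letter_poly_mem)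
      (auto intro!: leg_poly_mem letter_leg_commute)
  note mem = P[OF G(1)] P[OF G(2)] letter_poly_mem[OF x] leg_poly_mem[OF x]
  have "unorm.phase_eq ((letter_poly x * P us) * (leg_poly a b ?g * P vs))
      ((P us * letter_poly x) * (leg_poly a b ?g * P vs))"
    using comm mem by (intro unorm.phase_eq_mult[OF _ unorm.phase_eq_refl])
      (auto simp: unorm.phase_commute_def free_closed)
  also have "(P us * letter_poly x) * (leg_poly a b ?g * P vs) =
      P us * ((letter_poly x * leg_poly a b ?g) * P vs)"
    by (simp add: mult.assoc)
  also have "unorm.phase_eq \<dots> (P us * (leg_poly a' b' ?g * P vs))"
    using mem by (intro unorm.phase_eq_mult unorm.phase_eq_refl leg)
  finally show ?thesis
    using g by (simp add: normal_poly_def split P' del: upt_Suc) (simp add: P_def mult.assoc)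
qed

text \<open>On a unitary leg s s* = 1, so one of the two exponents can be made zero; without this
  condition the pair would not be determined by the operator. Extensionality makes the set finite
  and lets exponents be compared as functions.\<close>

definition exponents :: "nat \<Rightarrow> ((nat \<Rightarrow> nat) \<times> (nat \<Rightarrow> nat)) set" where
  "exponents D = {(a, b). a \<in> G \<rightarrow>\<^sub>E {..D} \<and> b \<in> G \<rightarrow>\<^sub>E {..D} \<and> (\<forall>i\<in>G. i \<le> m \<longrightarrow> a i = 0 \<or> b i = 0)}"

text \<open>One choice of new exponents serves both the algebra and the operators. The scalar c
  carries the phase that the rest of the word has accumulated on the operator side.\<close>

lemma letter_step:
  assumes x: "fst x \<in> G" and ab: "(a, b) \<in> exponents D"
  obtains a' b' \<kappa> where "(a', b') \<in> exponents (Suc D)"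
    "unorm.phase_eq (letter_poly x * normal_poly a b) (normal_poly a' b')" "cmod \<kappa> = 1"
    "\<And>f k. f \<in> ell2 H \<Longrightarrow> (\<lambda>k. c * normal_op a b f k) \<in> ell2 H \<Longrightarrow>
      letter_op x (\<lambda>k. c * normal_op a b f k) k = \<kappa> * c * normal_op a' b' f k"
proof -
  obtain g s where gs: "x = (g, s)" by (cases x)
  have g: "g \<in> G" using x gs by simp
  define a' b' where "a' = (if s then (if a g = 0 then a else a(g := a g - 1))
      else if m < g \<or> b g = 0 then a(g := a g + 1) else a)"
    and "b' = (if s then (if a g = 0 then b(g := b g + 1) else b)
      else if m < g \<or> b g = 0 then b else b(g := b g - 1))"
  have "(a', b') \<in> exponents (Suc D)"
  proof -
    have ab_le: "a i \<le> D" "b i \<le> D" "i \<le> m \<Longrightarrow> a i = 0 \<or> b i = 0" if "i \<in> G" for i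
      using ab that by (auto simp: exponents_def)
    have ab_off: "a i = undefined" "b i = undefined" if "i \<notin> G" for i
      using ab that PiE_arb[of a G "\<lambda>_. {..D}" i] PiE_arb[of b G "\<lambda>_. {..D}" i]
      by (simp_all only: exponents_def mem_Collect_eq case_prod_conv simp_thms)
    have le: "a' i \<le> Suc D" "b' i \<le> Suc D" if "i \<in> G" for i
      using ab_le(1,2)[OF that] by (auto simp: a'_def b'_def)
    have off: "a' i = undefined" "b' i = undefined" if "i \<notin> G" for i
      using ab_off[OF that] that g by (auto simp: a'_def b'_def)
    have canonical: "a' i = 0 \<or> b' i = 0" if "i \<in> G" "i \<le> m" for i
      using ab_le(3)[OF that] that by (cases "i = g") (auto simp: a'_def b'_def)
    show ?thesis
      unfolding exponents_def mem_Collect_eq case_prod_conv PiE_iff extensional_def atMost_iff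
      by (intro conjI ballI allI impI; (rule le off canonical; assumption))
  qed
  moreover have "unorm.phase_eq (letter_poly x * leg_poly a b g) (leg_poly a' b' g)"
  proof -
    note mem = g free_gen[OF g] free_pstar[OF free_gen[OF g]]
    have iso: "unorm.phase_eq (pstar (gen g) * gen g) 1"
      using generator_isometry[OF g] mem by (intro unorm.phase_eq_zero free_closed)
    have unit: "unorm.phase_eq (gen g * pstar (gen g)) 1" if "g \<le> m"
    proof -
      have "gen g * pstar (gen g) - 1 \<in> R" using that g by (auto simp: twist_relations_def)
      then show ?thesis
        using mem by (intro unorm.phase_eq_zero free_closed unorm.relation)
    qed
    consider (1) "s" "a g = 0" | (2) j where "s" "a g = Suc j" | (3) "\<not> s" "m < g \<or> b g = 0"
      | (4) j where "\<not> s" "g \<le> m" "b g = Suc j"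
      by (metis not_less old.nat.exhaust)
    then show ?thesis
    proof cases
      case 1
      then show ?thesis
        using mem by (simp add: gs letter_poly_def leg_poly_def a'_def b'_def power_add power_commutes)
          (intro unorm.phase_eq_refl free_mult free_power)
    next
      case 2
      have "unorm.phase_eq ((pstar (gen g) * gen g) * (gen g ^ j * pstar (gen g) ^ b g))
          (1 * (gen g ^ j * pstar (gen g) ^ b g))"
        using mem by (intro unorm.phase_eq_mult iso unorm.phase_eq_refl free_closed)
      then show ?thesis
        using 2 by (simp add: gs letter_poly_def leg_poly_def a'_def b'_def mult.assoc)
    next
      case 3
      then show ?thesis
        using mem by (simp add: gs letter_poly_def leg_poly_def a'_def b'_def mult.assoc flip: Suc_eq_plus1)
          (intro unorm.phase_eq_refl free_mult free_power)
    next
      case 4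
      \<comment> \<open>The canonical form on a unitary leg: b is positive, so a vanishes and the
        new generator meets an adjoint directly.\<close>
      then have "a g = 0" using ab g by (auto simp: exponents_def)
      have "unorm.phase_eq ((gen g * pstar (gen g)) * (pstar (gen g) ^ j)) (1 * (pstar (gen g) ^ j))"
        using mem 4 by (intro unorm.phase_eq_mult unit unorm.phase_eq_refl free_closed)
      then show ?thesis
        using 4 \<open>a g = 0\<close> by (simp add: gs letter_poly_def leg_poly_def a'_def b'_def mult.assoc)
    qed
  qed
  then have "unorm.phase_eq (letter_poly x * normal_poly a b) (normal_poly a' b')"
    by (intro letter_normal x) (auto simp: gs a'_def b'_def)
  moreover have "\<exists>\<kappa>. cmod \<kappa> = 1 \<and> (\<forall>f k. f \<in> ell2 H \<longrightarrow> (\<lambda>k. c * normal_op a b f k) \<in> ell2 H \<longrightarrow>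
      letter_op x (\<lambda>k. c * normal_op a b f k) k = \<kappa> * c * normal_op a' b' f k)"
  proof (cases s)
    case True
    have "if a g = 0 then a' = a \<and> b' = b(g := b g + 1) else a' = a(g := a g - 1) \<and> b' = b"
      using True by (simp add: a'_def b'_def)
    from normal_op_T_adj[OF g this]
    obtain \<kappa> where \<kappa>: "cmod \<kappa> = 1" "\<And>f k.
        (if k \<in> dom_up g then cis (- angle g k) * normal_op a b f (k(g := k g + 1)) else 0) =
          \<kappa> * normal_op a' b' f k"
      by blast
    have "letter_op x (\<lambda>k. c * normal_op a b f k) k = \<kappa> * c * normal_op a' b' f k"
      if "(\<lambda>k. c * normal_op a b f k) \<in> ell2 H" for f k
    proof -
      have "letter_op x (\<lambda>k. c * normal_op a b f k) k =
          c * (if k \<in> dom_up g then cis (- angle g k) * normal_op a b f (k(g := k g + 1)) else 0)"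
        using that True by (simp add: letter_op_def gs op_adj_T_apply)
      then show ?thesis unfolding \<kappa>(2) by simp
    qed
    with \<kappa>(1) show ?thesis by blast
  next
    case False
    have "if m < g \<or> b g = 0 then a' = a(g := a g + 1) \<and> b' = b else a' = a \<and> b' = b(g := b g - 1)"
      using False by (simp add: a'_def b'_def)
    from normal_op_T[OF g this]
    obtain \<kappa> where \<kappa>: "cmod \<kappa> = 1" "\<And>f k.
        (if k \<in> dom_dn g then cis (angle g k) * normal_op a b f (k(g := k g - 1)) else 0) =
          \<kappa> * normal_op a' b' f k"
      by blast
    have "letter_op x (\<lambda>k. c * normal_op a b f k) k = \<kappa> * c * normal_op a' b' f k"
      if "(\<lambda>k. c * normal_op a b f k) \<in> ell2 H" for f k
    proof -
      have "letter_op x (\<lambda>k. c * normal_op a b f k) k =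
          c * (if k \<in> dom_dn g then cis (angle g k) * normal_op a b f (k(g := k g - 1)) else 0)"
        using that False by (simp add: letter_op_def gs T_apply)
      then show ?thesis unfolding \<kappa>(2) by simp
    qed
    with \<kappa>(1) show ?thesis by blast
  qed
  ultimately show ?thesis using that by blast
qed

text \<open>Built up from the right end of the word, each letter enlarging the exponent bound by
  one. The word and its operator share the pair (a, b), but each has its own phase.\<close>

lemma word_normal_form:
  assumes "fst ` set xs \<subseteq> G"
  shows "\<exists>a b \<kappa>. (a, b) \<in> exponents (length xs) \<and>
    unorm.phase_eq (Poly_Mapping.single (Word xs) 1) (normal_poly a b) \<and>
    cmod \<kappa> = 1 \<and> (\<forall>f\<in>ell2 H. word_op xs f = (\<lambda>k. \<kappa> * normal_op a b f k))"
  using assms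
proof (induction xs)
  case Nil
  let ?z = "\<lambda>i\<in>G. 0 :: nat"
  have "(?z, ?z) \<in> exponents 0" by (auto simp: exponents_def)
  moreover have prod: "prod_list (map (leg_poly ?z ?z) ws) = 1" if "set ws \<subseteq> G" for ws
    using that by (induction ws) (auto simp: leg_poly_def)
  have "normal_poly ?z ?z = 1"
    unfolding normal_poly_def by (rule prod) (auto simp del: upt_Suc)
  then have "unorm.phase_eq (Poly_Mapping.single (Word []) 1) (normal_poly ?z ?z)"
    by (simp add: unorm.phase_eq_refl free_one flip: zero_word_def)
  moreover have "word_op [] f = (\<lambda>k. 1 * normal_op ?z ?z f k)" if f: "f \<in> ell2 H" for f
  proof
    fix k
    show "word_op [] f k = 1 * normal_op ?z ?z f k"
    proof (cases "k \<in> H")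
      case True
      then have "(\<lambda>i. if i \<in> G then k i - int (?z i) + int (?z i) else undefined) = k"
        by (auto simp: mem_H_iff)
      moreover have "\<forall>i\<in>G. m < i \<longrightarrow> int (?z i) \<le> k i" using True by (simp add: mem_H_iff)
      moreover have "chi (\<lambda>i. int (?z i) - int (?z i)) k = 1" by (simp add: chi_def)
      ultimately show ?thesis using f True by (simp only: word_op_Nil normal_op_def) simp
    next
      case False
      then show ?thesis using f by (simp add: word_op_Nil normal_op_def ell2_memD[OF f])
    qed
  qed
  ultimately show ?case by (intro exI[of _ ?z] exI[of _ 1]) (simp del: restrict_apply)
next
  case (Cons x xs)
  then obtain a b \<kappa> where IH: "(a, b) \<in> exponents (length xs)"
      "unorm.phase_eq (Poly_Mapping.single (Word xs) 1) (normal_poly a b)" "cmod \<kappa> = 1"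
      "\<And>f. f \<in> ell2 H \<Longrightarrow> word_op xs f = (\<lambda>k. \<kappa> * normal_op a b f k)"
    by fastforce
  have x: "fst x \<in> G" using Cons.prems by simp
  obtain a' b' \<kappa>' where step: "(a', b') \<in> exponents (Suc (length xs))"
    "unorm.phase_eq (letter_poly x * normal_poly a b) (normal_poly a' b')" "cmod \<kappa>' = 1"
    "\<And>f k. f \<in> ell2 H \<Longrightarrow> (\<lambda>k. \<kappa> * normal_op a b f k) \<in> ell2 H \<Longrightarrow>
      letter_op x (\<lambda>k. \<kappa> * normal_op a b f k) k = \<kappa>' * \<kappa> * normal_op a' b' f k"
    using letter_step[OF x IH(1), of \<kappa>] by blast
  have "unorm.phase_eq (letter_poly x * Poly_Mapping.single (Word xs) 1) (letter_poly x * normal_poly a b)"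
    using x by (intro unorm.phase_eq_mult unorm.phase_eq_refl letter_poly_mem IH)
  also note step(2)
  finally have "unorm.phase_eq (Poly_Mapping.single (Word (x # xs)) 1) (normal_poly a' b')"
    by (simp add: single_word_Cons letter_poly_def)
  moreover have "word_op (x # xs) f = (\<lambda>k. (\<kappa>' * \<kappa>) * normal_op a' b' f k)" if f: "f \<in> ell2 H" for f
  proof -
    have "(\<lambda>k. \<kappa> * normal_op a b f k) \<in> ell2 H"
      using bounded_ops_closed[OF word_op_bounded f, of xs] IH(4)[OF f] by simp
    then show ?thesis using step(4)[OF f] f by (auto simp: word_op_Cons IH(4)[OF f])
  qed
  ultimately show ?case using step(1,3) IH(3)
    by (intro exI[of _ a'] exI[of _ b'] exI[of _ "\<kappa>' * \<kappa>"]) (simp add: norm_mult)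
qed

end

section \<open>The operator norm is the universal norm\<close>

text \<open>If y < x, division by the power of x gives 1 \<le> K (N D + 1)^e r^N with r = y/x < 1
  and N = 2^k, whose right side tends to 0.\<close>

lemma le_of_power_le_poly:
  fixes x y K D :: real
  assumes x: "0 \<le> x" and y: "0 \<le> y" and K: "0 \<le> K" and D: "0 \<le> D"
    and le: "\<And>k. x ^ 2 ^ k \<le> K * (2 ^ k * D + 1) ^ e * y ^ 2 ^ k"
  shows "x \<le> y"
proof (rule ccontr)
  assume "\<not> x \<le> y"
  then have less: "y < x" by simp
  define r where "r = y / x"
  have r: "0 \<le> r" "r < 1" using less y by (simp_all add: r_def)
  have lim: "(\<lambda>k::nat. K * (real k * D + 1) ^ e * r ^ k) \<longlonglongrightarrow> 0"
  proof (cases "r = 0")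
    case True
    have "\<forall>\<^sub>F k::nat in sequentially. K * (real k * D + 1) ^ e * r ^ k = 0"
      using eventually_gt_at_top[of 0] by eventually_elim (simp add: True)
    then show ?thesis by (simp add: tendsto_eventually)
  next
    case False
    with r have "0 < r" by simp
    then have "(\<lambda>k::nat. (real k * D + 1) ^ e * r ^ k) \<longlonglongrightarrow> 0"
    proof -
      \<comment> \<open>The decay of r is split into e + 1 equal factors: one tames each of the e
        linear factors, and the last one still tends to zero.\<close>
      define s where "s = r powr (1 / (real e + 1))"
      have s: "0 < s" "s < 1"
        using powr_less_mono2[of "1 / (real e + 1)" r 1] r(2) \<open>0 < r\<close> by (simp_all add: s_def)
      have "s ^ (e + 1) = r"
      proof -
        have "s ^ (e + 1) = s powr (real e + 1)" using s(1) by (simp only: powr_realpow[OF s(1), symmetric]) (simp add: add.commute)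
        then show ?thesis using \<open>0 < r\<close> by (simp add: s_def powr_powr)
      qed
      have "(\<lambda>k::nat. (real k * D + 1) * s ^ k) \<longlonglongrightarrow> 0"
      proof -
        have "(\<lambda>k::nat. D * (real k * s ^ k) + s ^ k) \<longlonglongrightarrow> D * 0 + 0"
          using s by (intro tendsto_intros powser_times_n_limit_0 LIMSEQ_power_zero) auto
        then show ?thesis by (simp add: algebra_simps)
      qed
      from tendsto_mult[OF tendsto_power[OF this, of e] LIMSEQ_power_zero[of s]] s
      have "(\<lambda>k::nat. ((real k * D + 1) * s ^ k) ^ e * s ^ k) \<longlonglongrightarrow> 0" by simp
      moreover have "((real k * D + 1) * s ^ k) ^ e * s ^ k = (real k * D + 1) ^ e * r ^ k" for k
        unfolding \<open>s ^ (e + 1) = r\<close>[symmetric]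
        by (simp add: power_mult_distrib power_mult[symmetric] power_add mult_ac)
      ultimately show ?thesis by simp
    qed
    from tendsto_mult_right_zero[OF this, of K] show ?thesis by (simp add: mult.assoc)
  qed
  have "filterlim (\<lambda>k::nat. 2 ^ k :: nat) at_top sequentially"
    by (rule filterlim_at_top_mono[OF filterlim_ident]) (auto intro!: always_eventually less_imp_le)
  from filterlim_compose[OF lim this]
  have "(\<lambda>k. K * (2 ^ k * D + 1) ^ e * r ^ 2 ^ k) \<longlonglongrightarrow> 0" by simp
  then have "\<forall>\<^sub>F k in sequentially. K * (2 ^ k * D + 1) ^ e * r ^ 2 ^ k < 1"
    by (rule order_tendstoD) simp
  then obtain k where k: "K * (2 ^ k * D + 1) ^ e * r ^ 2 ^ k < 1"
    by (auto simp: eventually_sequentially)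
  have "x ^ 2 ^ k \<le> (K * (2 ^ k * D + 1) ^ e * r ^ 2 ^ k) * x ^ 2 ^ k"
    using le[of k] less y by (simp add: r_def power_divide)
  also have "\<dots> < 1 * x ^ 2 ^ k" using k less y by (intro mult_strict_right_mono) auto
  finally show False by simp
qed

lemma pscale_sum_left: "pscale (sum c A) p = (\<Sum>x\<in>A. pscale (c x) p)"
  by (induction A rule: infinite_finite_induct) (simp_all add: pscale_add_left)

definition word_length_le :: "nat \<Rightarrow> 'g star_poly \<Rightarrow> bool" where
  "word_length_le D p \<longleftrightarrow> (\<forall>w\<in>Poly_Mapping.keys p. length (letters w) \<le> D)"

lemma word_length_le_mult:
  assumes "word_length_le D p" "word_length_le E q" shows "word_length_le (D + E) (p * q)"
  unfolding word_length_le_def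
proof
  fix w assume "w \<in> Poly_Mapping.keys (p * q)"
  then obtain u v where "u \<in> Poly_Mapping.keys p" "v \<in> Poly_Mapping.keys q" "w = u + v"
    using keys_mult[of p q] by blast
  then show "length (letters w) \<le> D + E"
    using assms by (auto simp: word_length_le_def plus_word_def intro: add_mono)
qed

lemma word_length_le_power:
  assumes "word_length_le D p" shows "word_length_le (k * D) (p ^ k)"
proof (induction k)
  case 0
  then show ?case by (simp add: word_length_le_def zero_word_def)
next
  case (Suc k)
  then show ?case using word_length_le_mult[OF assms] by simp
qed

lemma ex_word_length_le: "\<exists>D. word_length_le D p"
  using finite_imageI[OF finite_keys, of "\<lambda>w. length (letters w)" p]
  by (auto simp: word_length_le_def finite_nat_set_iff_bounded_le)

section \<open>Recovering coefficients from matrix entries\<close>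

context twisted_shifts
begin

text \<open>The coefficient functional: the exponent pair \<open>(a, b)\<close> is isolated by inclusion-exclusion
  over the unilateral legs, on which a monomial with smaller exponents contributes to the
  same matrix entry.\<close>

definition point :: "(nat \<Rightarrow> nat) \<Rightarrow> nat set \<Rightarrow> nat \<Rightarrow> int" where
  "point a E = (\<lambda>i. if i \<in> G then int (a i) - of_bool (i \<in> E) else undefined)"

definition coef :: "(nat \<Rightarrow> nat) \<Rightarrow> (nat \<Rightarrow> nat) \<Rightarrow> (nat \<Rightarrow> int) op \<Rightarrow> complex" where
  "coef a b A = (\<Sum>E\<in>Pow {m<..m+n}. (-1) ^ card E * cnj (chi (\<lambda>i. int (a i) - int (b i)) (point a E)) *
     (if point a E \<in> H \<and> point b E \<in> H then A (unit_vec (point b E)) (point a E) else 0))"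

text \<open>One matrix entry for each set of unilateral legs, each with a weight of modulus
  one.\<close>

lemma coef_bound:
  assumes A: "A \<in> bounded_ops H"
  shows "cmod (coef a b A) \<le> 2 ^ n * op_norm H A"
proof -
  have "cmod (coef a b A) \<le> (\<Sum>E\<in>Pow {m<..m+n}. op_norm H A)"
    unfolding coef_def
  proof (rule sum_norm_le)
    fix E
    have "cmod (A (unit_vec l) k) \<le> op_norm H A" if "l \<in> H" for k l
    proof -
      have "cmod (A (unit_vec l) k) \<le> ell2_norm H (A (unit_vec l))"
        by (intro cmod_le_ell2_norm bounded_ops_closed[OF A] unit_vec_ell2 that)
      also have "\<dots> \<le> op_norm H A * ell2_norm H (unit_vec l)"
        by (intro op_norm_bound A unit_vec_ell2 that)
      also have "\<dots> \<le> op_norm H A * 1"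
        by (intro mult_left_mono ell2_norm_unit_vec op_norm_nonneg A that)
      finally show ?thesis by simp
    qed
    then show "cmod ((-1) ^ card E * cnj (chi (\<lambda>i. int (a i) - int (b i)) (point a E)) *
        (if point a E \<in> H \<and> point b E \<in> H then A (unit_vec (point b E)) (point a E) else 0)) \<le> op_norm H A"
      by (auto simp: norm_mult norm_power chi_def op_norm_nonneg A)
  qed
  also have "\<dots> = 2 ^ n * op_norm H A" by (simp add: card_Pow)
  finally show ?thesis .
qed

lemma coef_cong:
  assumes "\<And>l. l \<in> H \<Longrightarrow> A (unit_vec l) = B (unit_vec l)" shows "coef a b A = coef a b B"
  unfolding coef_def using assms by (intro sum.cong refl) auto

lemma coef_cmult: "coef a b (\<lambda>f k. c * A f k) = c * coef a b A"
  unfolding coef_def sum_distrib_left by (intro sum.cong) auto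

lemma coef_sum: "coef a b (\<lambda>f k. \<Sum>w\<in>W. c w * A w f k) = (\<Sum>w\<in>W. c w * coef a b (A w))"
  unfolding coef_def sum_distrib_left
  by (subst sum.swap) (intro sum.cong refl, auto simp: sum_distrib_left mult_ac)

lemma exponentsD:
  assumes "(a, b) \<in> exponents D"
  shows "i \<in> G \<Longrightarrow> i \<le> m \<Longrightarrow> a i = 0 \<or> b i = 0" "a \<in> extensional G" "b \<in> extensional G"
  using assms by (auto simp: exponents_def PiE_def)

text \<open>On a unitary leg one exponent is zero, so the difference a - b determines both; on a
  unilateral leg a is given and b follows from the difference.\<close>

lemma exponents_eqI:
  assumes "(a, b) \<in> exponents D" "(a', b') \<in> exponents D'"
    and diff: "\<And>i. i \<in> G \<Longrightarrow> int (a i) - int (a' i) + int (b' i) = int (b i)"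
    and eq: "\<And>i. i \<in> {m<..m+n} \<Longrightarrow> a' i = a i"
  shows "a' = a \<and> b' = b"
proof -
  have *: "a' i = a i \<and> b' i = b i" if i: "i \<in> G" for i
  proof (cases "m < i")
    case True
    then show ?thesis using eq[of i] diff[OF i] i by simp
  next
    case False
    then show ?thesis
      using exponentsD(1)[OF assms(1) i] exponentsD(1)[OF assms(2) i] diff[OF i] by auto
  qed
  then show ?thesis
    using exponentsD(2,3)[OF assms(1)] exponentsD(2,3)[OF assms(2)]
    by (blast intro: extensionalityI)
qed

text \<open>Entries of a monomial with other net exponents vanish. For equal net exponents the entry
  at E is a phase, which \<open>coef\<close> removes, times the indicator of a' \<le> a - 1_E on the
  unilateral legs. The alternating sum over E factors into the product of [a'_i \<le> a_i] -
  [a'_i \<le> a_i - 1] = [a'_i = a_i].\<close>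

lemma coef_normal:
  assumes ab: "(a, b) \<in> exponents D" and ab': "(a', b') \<in> exponents D'"
    and A: "\<And>f. f \<in> ell2 H \<Longrightarrow> A f = (\<lambda>k. \<kappa> * normal_op a' b' f k)"
  shows "coef a b A = (if a' = a \<and> b' = b then \<kappa> else 0)"
proof (cases "\<forall>i\<in>G. int (a i) - int (a' i) + int (b' i) = int (b i)")
  case False
  have "A (unit_vec (point b E)) (point a E) = 0" if "point b E \<in> H" for E
  proof -
    obtain i where i: "i \<in> G" "int (a i) - int (a' i) + int (b' i) \<noteq> int (b i)" using False by blast
    have "(\<lambda>i. if i \<in> G then point a E i - int (a' i) + int (b' i) else undefined) \<noteq> point b E"
    proof
      assume "(\<lambda>i. if i \<in> G then point a E i - int (a' i) + int (b' i) else undefined) = point b E"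
      from fun_cong[OF this, of i] i show False by (simp add: point_def)
    qed
    then show ?thesis using A[OF unit_vec_ell2[OF that]] by (simp add: normal_op_def unit_vec_def)
  qed
  moreover have "\<not> (a' = a \<and> b' = b)" using False by auto
  ultimately show ?thesis unfolding coef_def by (auto intro!: sum.neutral)
next
  case True
  let ?N = "{m<..m+n}"
  define f1 f2 :: "nat \<Rightarrow> complex" where "f1 i = of_bool (int (a' i) \<le> int (a i))"
    and "f2 i = of_bool (int (a' i) \<le> int (a i) - 1)" for i
  have summand: "(-1) ^ card E * cnj (chi (\<lambda>i. int (a i) - int (b i)) (point a E)) *
     (if point a E \<in> H \<and> point b E \<in> H then A (unit_vec (point b E)) (point a E) else 0) =
     \<kappa> * ((-1) ^ card E * (\<Prod>i\<in>E. f2 i) * (\<Prod>i\<in>?N - E. f1 i))" if E: "E \<subseteq> ?N" for E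
  proof -
    have "(\<Prod>i\<in>E. f2 i) * (\<Prod>i\<in>?N - E. f1 i) =
        (\<Prod>i\<in>E. of_bool (int (a' i) \<le> point a E i)) * (\<Prod>i\<in>?N - E. of_bool (int (a' i) \<le> point a E i))"
      using E by (intro arg_cong2[of _ _ _ _ "(*)"] prod.cong) (auto simp: f1_def f2_def point_def)
    also have "\<dots> = (\<Prod>i\<in>?N. of_bool (int (a' i) \<le> point a E i))"
      using E prod.subset_diff[of E ?N "\<lambda>i. of_bool (int (a' i) \<le> point a E i) :: complex"]
      by (simp add: mult.commute)
    also have "\<dots> = of_bool (\<forall>i\<in>?N. int (a' i) \<le> point a E i)"
      by (auto simp: prod_zero_iff)
    finally have prod: "(\<Prod>i\<in>E. f2 i) * (\<Prod>i\<in>?N - E. f1 i) = of_bool (\<forall>i\<in>?N. int (a' i) \<le> point a E i)" .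
    show ?thesis
    \<comment> \<open>Where the cut-off holds, both points lie in H automatically. Where it fails,
      in particular when a coordinate of \<open>point a E\<close> is -1, both sides are
      zero.\<close>
    proof (cases "\<forall>i\<in>?N. int (a' i) \<le> point a E i")
      case le: True
      have b: "point b E i = point a E i - int (a' i) + int (b' i)" if "i \<in> G" for i
        using bspec[OF True that] that by (simp add: point_def)
      have aH: "point a E \<in> H"
        unfolding mem_H_iff
      proof (intro conjI ballI impI allI)
        fix i assume "i \<in> G" "m < i"
        then have "int (a' i) \<le> point a E i" using le by simp
        then show "0 \<le> point a E i" by linarith
      qed (auto simp: point_def)
      have bH: "point b E \<in> H"
        unfolding mem_H_iff
      proof (intro conjI ballI impI allI)
        fix i assume i: "i \<in> G" "m < i"
        then have "int (a' i) \<le> point a E i" using le by simp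
        then show "0 \<le> point b E i" unfolding b[OF i(1)] by linarith
      qed (auto simp: point_def)
      have arg: "(\<lambda>i. if i \<in> G then point a E i - int (a' i) + int (b' i) else undefined) = point b E"
        using b by (auto simp: fun_eq_iff) (simp_all add: point_def)
      have "chi (\<lambda>i. int (a' i) - int (b' i)) (point a E) = chi (\<lambda>i. int (a i) - int (b i)) (point a E)"
        unfolding chi_def
      proof (intro arg_cong[of _ _ cis] sum.cong refl)
        fix i assume "i \<in> G"
        then have "int (a' i) - int (b' i) = int (a i) - int (b i)" using True by force
        then show "of_int (int (a' i) - int (b' i)) * angle i (point a E) =
            of_int (int (a i) - int (b i)) * angle i (point a E)" by presburger
      qed
      moreover have "\<forall>i\<in>G. m < i \<longrightarrow> int (a' i) \<le> point a E i" using le by simp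
      ultimately have "A (unit_vec (point b E)) (point a E) =
          \<kappa> * chi (\<lambda>i. int (a i) - int (b i)) (point a E)"
        unfolding A[OF unit_vec_ell2[OF bH]] normal_op_def arg using aH by (simp add: unit_vec_def)
      moreover have "cnj (chi d k) * chi d k = 1" for d k
        by (simp add: chi_def cis_cnj cis_mult)
      ultimately show ?thesis
        using aH bH prod le by (simp add: mult.assoc)
    next
      case False
      have "A (unit_vec (point b E)) (point a E) = 0" if "point b E \<in> H"
      proof -
        have "\<not> (\<forall>i\<in>G. m < i \<longrightarrow> int (a' i) \<le> point a E i)" using False by auto
        then show ?thesis using A[OF unit_vec_ell2[OF that]] by (simp only: normal_op_def) simp
      qed
      then show ?thesis using prod False by (simp add: mult.assoc)
    qed
  qed
  have "coef a b A = (\<Sum>E\<in>Pow ?N. \<kappa> * ((-1) ^ card E * (\<Prod>i\<in>E. f2 i) * (\<Prod>i\<in>?N - E. f1 i)))"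
    unfolding coef_def by (intro sum.cong refl summand) simp
  also have "\<dots> = \<kappa> * (\<Prod>i\<in>?N. f1 i - f2 i)"
    by (simp add: prod_diff_conv_sum sum_distrib_left)
  also have "(\<Prod>i\<in>?N. f1 i - f2 i) = (\<Prod>i\<in>?N. of_bool (a' i = a i))"
    by (intro prod.cong) (auto simp: f1_def f2_def)
  also have "\<dots> = of_bool (\<forall>i\<in>?N. a' i = a i)"
    by (auto simp: prod_zero_iff)
  also have "(\<forall>i\<in>?N. a' i = a i) \<longleftrightarrow> a' = a \<and> b' = b"
    using exponents_eqI[OF ab ab'] True by auto
  finally show ?thesis by simp
qed

lemma exponents_mono: "D \<le> D' \<Longrightarrow> exponents D \<subseteq> exponents D'"
  unfolding exponents_def by (auto simp: PiE_iff intro: order_trans)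

lemma exponents_subset: "exponents D \<subseteq> (G \<rightarrow>\<^sub>E {..D}) \<times> (G \<rightarrow>\<^sub>E {..D})"
  by (auto simp: exponents_def)

lemma finite_exponents: "finite (exponents D)"
  by (rule finite_subset[OF exponents_subset]) (intro finite_SigmaI finite_PiE; simp)

lemma card_exponents: "card (exponents D) \<le> (D + 1) ^ (2 * (m + n))"
proof -
  have "card (exponents D) \<le> card ((G \<rightarrow>\<^sub>E {..D}) \<times> (G \<rightarrow>\<^sub>E {..D}))"
    by (intro card_mono exponents_subset finite_SigmaI finite_PiE) simp_all
  also have "\<dots> = (D + 1) ^ (2 * (m + n))"
    by (simp add: card_cartesian_product card_PiE Suc_eq_plus1 flip: power_add mult_2)
  finally show ?thesis .
qed

section \<open>Comparison of the two norms\<close>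

lemma poly_op_norm_le: "p \<in> \<A> G \<Longrightarrow> op_norm H (poly_op p) \<le> unorm p"
  by (rule le_univ_norm[OF cstar_seminorm_poly_op_H])

text \<open>Grouping words by normal form writes p, modulo null elements, as a combination of normal
  monomials of norm at most one. Each coefficient is, up to a phase, a value of \<open>coef\<close>
  at \<open>poly_op p\<close>, and the number of summands is bounded by
  \<open>card_exponents\<close>.\<close>

lemma univ_norm_le_poly:
  assumes p: "p \<in> \<A> G" and D: "word_length_le D p"
  shows "unorm p \<le> 2 ^ n * real (D + 1) ^ (2 * (m + n)) * op_norm H (poly_op p)"
proof -
  define K where "K = Poly_Mapping.keys p"
  define c where "c = Poly_Mapping.lookup p"
  have K: "finite K" by (simp add: K_def)
  have p_eq: "p = (\<Sum>w\<in>K. pscale (c w) (Poly_Mapping.single w 1))"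
    using star_poly_eq_sum[of p] by (simp add: K_def c_def)
  let ?N = "\<lambda>t. normal_poly (fst t) (snd t)"
  have "\<forall>w\<in>K. \<exists>y. fst y \<in> exponents D \<and> ?N (fst y) \<in> \<A> G \<and> cmod (fst (snd y)) = 1 \<and>
      unorm (Poly_Mapping.single w 1 - pscale (fst (snd y)) (?N (fst y))) = 0 \<and> cmod (snd (snd y)) = 1 \<and>
      (\<forall>f\<in>ell2 H. word_op (letters w) f = (\<lambda>k. snd (snd y) * normal_op (fst (fst y)) (snd (fst y)) f k))"
  proof
    fix w assume w: "w \<in> K"
    then have "fst ` set (letters w) \<subseteq> G" using p by (auto simp: K_def free_star_algebra_def)
    from word_normal_form[OF this] obtain a b \<kappa>' where 1: "(a, b) \<in> exponents (length (letters w))"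
        "unorm.phase_eq (Poly_Mapping.single w 1) (normal_poly a b)" "cmod \<kappa>' = 1"
        "\<forall>f\<in>ell2 H. word_op (letters w) f = (\<lambda>k. \<kappa>' * normal_op a b f k)"
      by auto
    obtain \<kappa> where 2: "cmod \<kappa> = 1" "unorm (Poly_Mapping.single w 1 - pscale \<kappa> (normal_poly a b)) = 0"
        "normal_poly a b \<in> \<A> G"
      using 1(2) by (auto simp: unorm.phase_eq_def)
    have "(a, b) \<in> exponents D"
      using 1(1) exponents_mono D w by (auto simp: word_length_le_def K_def)
    with 1 2 show "\<exists>y. fst y \<in> exponents D \<and> ?N (fst y) \<in> \<A> G \<and> cmod (fst (snd y)) = 1 \<and>
      unorm (Poly_Mapping.single w 1 - pscale (fst (snd y)) (?N (fst y))) = 0 \<and> cmod (snd (snd y)) = 1 \<and>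
      (\<forall>f\<in>ell2 H. word_op (letters w) f = (\<lambda>k. snd (snd y) * normal_op (fst (fst y)) (snd (fst y)) f k))"
      by (intro exI[of _ "((a, b), \<kappa>, \<kappa>')"]) simp
  qed
  from bchoice[OF this] obtain y where y: "\<forall>w\<in>K. fst (y w) \<in> exponents D \<and>
      ?N (fst (y w)) \<in> \<A> G \<and> cmod (fst (snd (y w))) = 1 \<and>
      unorm (Poly_Mapping.single w 1 - pscale (fst (snd (y w))) (?N (fst (y w)))) = 0 \<and>
      cmod (snd (snd (y w))) = 1 \<and>
      (\<forall>f\<in>ell2 H. word_op (letters w) f =
        (\<lambda>k. snd (snd (y w)) * normal_op (fst (fst (y w))) (snd (fst (y w))) f k))"
    by blast
  define t \<kappa> \<kappa>' where "t w = fst (y w)" and "\<kappa> w = fst (snd (y w))" and "\<kappa>' w = snd (snd (y w))" for w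
  have t: "t w \<in> exponents D" and N: "?N (t w) \<in> \<A> G"
    and \<kappa>: "cmod (\<kappa> w) = 1" and normal: "unorm (Poly_Mapping.single w 1 - pscale (\<kappa> w) (?N (t w))) = 0"
    and \<kappa>': "cmod (\<kappa>' w) = 1"
    and op: "\<And>f. f \<in> ell2 H \<Longrightarrow>
        word_op (letters w) f = (\<lambda>k. \<kappa>' w * normal_op (fst (t w)) (snd (t w)) f k)" if "w \<in> K" for w
    using y that by (auto simp: t_def \<kappa>_def \<kappa>'_def)
  have word: "fst ` set (letters w) \<subseteq> G" if "w \<in> K" for w
    using p that by (auto simp: K_def free_star_algebra_def)
  have single: "Poly_Mapping.single w 1 \<in> \<A> G" if "w \<in> K" for w
    using word[OF that] by (rule free_single)
  define C where "C s = (\<Sum>w\<in>{w \<in> K. t w = s}. c w * \<kappa> w)" for s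
  have C_le: "cmod (C s) \<le> 2 ^ n * op_norm H (poly_op p) \<and> cmod (C s) * unorm (?N s) \<le> cmod (C s)"
    if s: "s \<in> exponents D" for s
  proof (cases "\<exists>w\<in>K. t w = s")
    case False
    then have "{w \<in> K. t w = s} = {}" by auto
    then have "C s = 0" by (simp only: C_def sum.empty)
    then show ?thesis by (simp add: op_norm_nonneg poly_op_bounded)
  next
    case True
    then obtain v where v: "v \<in> K" "t v = s" by blast
    let ?coef = "coef (fst s) (snd s)"
    \<comment> \<open>\<mu> links the two families of phases: \<kappa> comes from the algebra and
      \<kappa>' from the operators. A null element acts as zero, so \<kappa>' = \<kappa> \<mu> for
      all words with normal form s, with one common \<mu>.\<close>
    define \<mu> where "\<mu> = ?coef (poly_op (?N s))"
    have coef_word: "?coef (word_op (letters w)) = (if t w = s then \<kappa>' w else 0)" if w: "w \<in> K" for w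
      using coef_normal[of "fst s" "snd s" D "fst (t w)" "snd (t w)" D "word_op (letters w)" "\<kappa>' w"]
        s t[OF w] op[OF w] by (simp add: prod_eq_iff)
    have \<kappa>_eq: "\<kappa>' w = \<kappa> w * \<mu>" if w: "w \<in> K" "t w = s" for w
    proof -
      let ?q = "Poly_Mapping.single w 1 - pscale (\<kappa> w) (?N s)"
      have q: "?q \<in> \<A> G"
        using single[OF w(1)] N[OF w(1)] w(2) by (auto intro!: free_diff free_pscale)
      have "op_norm H (poly_op ?q) = 0"
        using poly_op_norm_le[OF q] normal[OF w(1)] w(2) op_norm_nonneg[OF poly_op_bounded, of ?q] by simp
      from op_norm_eq_zero[OF poly_op_bounded this]
      have zero: "poly_op ?q f k = 0" if "f \<in> ell2 H" for f k
        using that by simp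
      have "\<kappa>' w = ?coef (word_op (letters w))" using coef_word[OF w(1)] w(2) by simp
      also have "\<dots> = ?coef (\<lambda>f k. \<kappa> w * poly_op (?N s) f k)"
      proof (rule coef_cong)
        fix l assume "l \<in> H"
        then have l: "unit_vec l \<in> ell2 H" by (rule unit_vec_ell2)
        show "word_op (letters w) (unit_vec l) = (\<lambda>k. \<kappa> w * poly_op (?N s) (unit_vec l) k)"
        proof
          fix k
          show "word_op (letters w) (unit_vec l) k = \<kappa> w * poly_op (?N s) (unit_vec l) k"
            using zero[OF l, of k] l by (simp add: poly_op_diff poly_op_single poly_op_pscale)
        qed
      qed
      also have "\<dots> = \<kappa> w * \<mu>" by (simp only: coef_cmult \<mu>_def)
      finally show ?thesis .
    qed
    have \<mu>: "cmod \<mu> = 1" using \<kappa>_eq[OF v] \<kappa>[OF v(1)] \<kappa>'[OF v(1)] by (simp add: norm_mult)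
    have "?coef (poly_op p) = ?coef (\<lambda>f k. \<Sum>w\<in>K. c w * word_op (letters w) f k)"
      by (rule coef_cong) (simp add: poly_op_def unit_vec_ell2 K_def c_def)
    also have "\<dots> = (\<Sum>w\<in>K. c w * ?coef (word_op (letters w)))" by (rule coef_sum)
    also have "\<dots> = (\<Sum>w\<in>K. if t w = s then c w * \<kappa> w * \<mu> else 0)"
      using coef_word \<kappa>_eq by (intro sum.cong) (auto simp: mult.assoc)
    also have "\<dots> = C s * \<mu>"
      unfolding C_def sum_distrib_right using K by (rule sum.inter_filter[symmetric])
    finally have "cmod (C s) = cmod (?coef (poly_op p))" using \<mu> by (simp add: norm_mult)
    then have 1: "cmod (C s) \<le> 2 ^ n * op_norm H (poly_op p)"
      using coef_bound[OF poly_op_bounded] by simp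
    \<comment> \<open>The monomial is compared with a word of which it is the normal form; words
      have norm at most one.\<close>
    have "unorm (?N s) = unorm (pscale (\<kappa> v) (?N s))"
      using unorm.scale N[OF v(1)] v(2) \<kappa>[OF v(1)] by simp
    also have "\<dots> \<le> unorm (Poly_Mapping.single v 1) + unorm (Poly_Mapping.single v 1 - pscale (\<kappa> v) (?N s))"
      using unorm.abs_diff_le[OF single[OF v(1)] free_pscale[OF N[OF v(1)], of "\<kappa> v"]] v(2)
      by simp
    also have "\<dots> \<le> 1"
      using normal[OF v(1)] v(2) word_norm_le[OF cstar_seminorm_univ_norm word[OF v(1)]] by simp
    finally show ?thesis using 1 by (simp add: mult_left_le)
  qed
  \<comment> \<open>\<open>?N s\<close> is known to lie in the free *-algebra only when some word of
    p has normal form s; otherwise \<open>C s\<close> is an empty sum.\<close>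
  have NC: "pscale (C s) (?N s) \<in> \<A> G" if "s \<in> exponents D" for s
  proof (cases "\<exists>w\<in>K. t w = s")
    case False
    then have "{w \<in> K. t w = s} = {}" by auto
    then show ?thesis by (simp only: C_def sum.empty pscale_zero free_zero)
  qed (use N in \<open>auto intro: free_pscale\<close>)
  let ?q = "\<Sum>s\<in>exponents D. pscale (C s) (?N s)"
  have q: "?q \<in> \<A> G" using NC by (rule free_sum)
  have q_eq: "?q = (\<Sum>w\<in>K. pscale (c w * \<kappa> w) (?N (t w)))"
  proof -
    have "?q = (\<Sum>s\<in>exponents D. \<Sum>w\<in>{w \<in> K. t w = s}. pscale (c w * \<kappa> w) (?N (t w)))"
      unfolding C_def pscale_sum_left by (intro sum.cong) auto
    also have "\<dots> = (\<Sum>w\<in>K. pscale (c w * \<kappa> w) (?N (t w)))"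
      using t by (intro sum.group K finite_exponents) auto
    finally show ?thesis .
  qed
  define d where "d w = pscale (c w) (Poly_Mapping.single w 1 - pscale (\<kappa> w) (?N (t w)))" for w
  have d: "d w \<in> \<A> G" "unorm (d w) = 0" if "w \<in> K" for w
    using single[OF that] N[OF that] normal[OF that]
    by (simp_all add: d_def unorm.scale free_pscale free_diff)
  have "p - ?q = (\<Sum>w\<in>K. d w)"
    unfolding q_eq d_def
    by (subst p_eq) (simp only: sum_subtractf[symmetric] pscale_diff pscale_pscale)
  moreover have "unorm (\<Sum>w\<in>K. d w) \<le> (\<Sum>w\<in>K. unorm (d w))"
    using d(1) by (rule unorm.sum_le)
  ultimately have "unorm p \<le> unorm ?q"
    using unorm.abs_diff_le[OF p q] d(2) by simp
  also have "\<dots> \<le> (\<Sum>s\<in>exponents D. unorm (pscale (C s) (?N s)))"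
    using NC by (rule unorm.sum_le)
  also have "\<dots> \<le> (\<Sum>s\<in>exponents D. 2 ^ n * op_norm H (poly_op p))"
  proof (rule sum_mono)
    fix s assume s: "s \<in> exponents D"
    have "unorm (pscale (C s) (?N s)) \<le> cmod (C s)"
    proof (cases "\<exists>w\<in>K. t w = s")
      case False
      then have "{w \<in> K. t w = s} = {}" by auto
      then show ?thesis by (simp only: C_def sum.empty pscale_zero unorm.zero norm_zero)
    next
      case True
      then have "?N s \<in> \<A> G" using N by auto
      then show ?thesis using C_le[OF s] by (simp add: unorm.scale)
    qed
    then show "unorm (pscale (C s) (?N s)) \<le> 2 ^ n * op_norm H (poly_op p)"
      using C_le[OF s] by simp
  qed
  also have "\<dots> = real (card (exponents D)) * (2 ^ n * op_norm H (poly_op p))" by simp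
  also have "\<dots> \<le> real ((D + 1) ^ (2 * (m + n))) * (2 ^ n * op_norm H (poly_op p))"
    using card_exponents by (intro mult_right_mono of_nat_mono) (simp_all add: op_norm_nonneg poly_op_bounded)
  finally show ?thesis by (simp only: of_nat_power mult_ac)
qed

lemma univ_norm_eq_op_norm:
  assumes p: "p \<in> \<A> G"
  shows "unorm p = op_norm H (poly_op p)"
proof (rule antisym)
  interpret op: cstar_norm G R "\<lambda>p. op_norm H (poly_op p)"
    by unfold_locales (rule cstar_seminorm_poly_op_H)
  let ?q = "pstar p * p"
  have q: "?q \<in> \<A> G" "pstar ?q = ?q"
    using p by (simp_all add: free_mult free_pstar pstar_mult)
  obtain D where D: "word_length_le D ?q" using ex_word_length_le by blast
  have "unorm ?q \<le> op_norm H (poly_op ?q)"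
  proof (rule le_of_power_le_poly)
    fix k
    have "unorm ?q ^ 2 ^ k = unorm (?q ^ 2 ^ k)"
      by (rule unorm.selfadjoint_power[symmetric, OF q])
    also have "\<dots> \<le> 2 ^ n * real (2 ^ k * D + 1) ^ (2 * (m + n)) * op_norm H (poly_op (?q ^ 2 ^ k))"
      by (rule univ_norm_le_poly[OF free_power[OF q(1)] word_length_le_power[OF D]])
    also have "op_norm H (poly_op (?q ^ 2 ^ k)) = op_norm H (poly_op ?q) ^ 2 ^ k"
      by (rule op.selfadjoint_power[OF q])
    finally show "unorm ?q ^ 2 ^ k \<le>
        2 ^ n * (2 ^ k * real D + 1) ^ (2 * (m + n)) * op_norm H (poly_op ?q) ^ 2 ^ k" by simp
  qed (use q in \<open>simp_all add: unorm.nonneg op.nonneg\<close>)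
  then have "(unorm p)\<^sup>2 \<le> (op_norm H (poly_op p))\<^sup>2"
    using unorm.cstar[OF p] op.cstar[OF p] by simp
  then show "unorm p \<le> op_norm H (poly_op p)"
    by (rule power2_le_imp_le) (rule op.nonneg[OF p])
qed (rule poly_op_norm_le[OF p])

end

section \<open>Arithmetic in the completion\<close>

context isometric_relations
begin

abbreviation "CS \<equiv> cauchy_seqs G R"
abbreviation "NR \<equiv> null_rel G R"

definition cls :: "(nat \<Rightarrow> 'g star_poly) \<Rightarrow> (nat \<Rightarrow> 'g star_poly) set" where
  "cls x = NR `` {x}"

lemma CS_mem: "x \<in> CS \<Longrightarrow> x k \<in> \<A> G"
  by (auto simp: cauchy_seqs_def)

lemma CS_Cauchy: "x \<in> CS \<Longrightarrow> 0 < e \<Longrightarrow> \<exists>N. \<forall>k\<ge>N. \<forall>l\<ge>N. unorm (x k - x l) < e"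
  by (auto simp: cauchy_seqs_def)

lemma CS_bounded:
  assumes "x \<in> CS" obtains B where "0 < B" "\<And>k. unorm (x k) \<le> B"
proof -
  note mem = CS_mem[OF assms]
  obtain N where N: "\<And>k. k \<ge> N \<Longrightarrow> unorm (x k - x N) < 1"
    using CS_Cauchy[OF assms, of 1] by auto
  define B where "B = Max ((\<lambda>k. unorm (x k)) ` {..N}) + 1"
  have le: "unorm (x k) \<le> B - 1" if "k \<le> N" for k
    using that by (simp add: B_def)
  have "unorm (x k) \<le> B" for k
  proof (cases "k \<le> N")
    case False
    then have "unorm (x k - x N) < 1" using N by simp
    then show ?thesis using unorm.abs_diff_le[OF mem mem, of k N] le[of N] by simp
  qed (use le in fastforce)
  moreover have "0 < B" using le[of 0] unorm.nonneg[OF mem, of 0] by simp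
  ultimately show ?thesis using that by blast
qed

lemma CSI:
  assumes "\<And>k. x k \<in> \<A> G"
    and "\<And>e. 0 < e \<Longrightarrow> \<exists>N. \<forall>k\<ge>N. \<forall>l\<ge>N. unorm (x k - x l) < e"
  shows "x \<in> CS"
  using assms by (auto simp: cauchy_seqs_def)

lemma CS_const: "p \<in> \<A> G \<Longrightarrow> (\<lambda>k. p) \<in> CS"
  by (rule CSI) (simp_all add: unorm.zero)

lemma CS_add:
  assumes x: "x \<in> CS" and y: "y \<in> CS" shows "(\<lambda>k. x k + y k) \<in> CS"
proof (rule CSI)
  note mem = CS_mem[OF x] CS_mem[OF y]
  show "x k + y k \<in> \<A> G" for k by (intro free_add mem)
  fix e :: real assume "0 < e"
  then have e: "0 < e / 2" by simp
  obtain M where M: "\<And>k l. k \<ge> M \<Longrightarrow> l \<ge> M \<Longrightarrow> unorm (x k - x l) < e / 2"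
    using CS_Cauchy[OF x e] by blast
  obtain N where N: "\<And>k l. k \<ge> N \<Longrightarrow> l \<ge> N \<Longrightarrow> unorm (y k - y l) < e / 2"
    using CS_Cauchy[OF y e] by blast
  have "unorm (x k + y k - (x l + y l)) < e" if "k \<ge> max M N" "l \<ge> max M N" for k l
  proof -
    have "x k + y k - (x l + y l) = (x k - x l) + (y k - y l)" by simp
    then have "unorm (x k + y k - (x l + y l)) \<le> unorm (x k - x l) + unorm (y k - y l)"
      using unorm.triangle[of "x k - x l" "y k - y l"] mem by (simp only: free_diff)
    also have "\<dots> < e" using M[of k l] N[of k l] that by simp
    finally show ?thesis .
  qed
  then show "\<exists>N. \<forall>k\<ge>N. \<forall>l\<ge>N. unorm (x k + y k - (x l + y l)) < e" by blast
qed

text \<open>One estimate for two purposes: products of Cauchy sequences are Cauchy, and the class of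
  a product depends only on the classes of the factors.\<close>

lemma unorm_mult_diff_le:
  assumes "p \<in> \<A> G" "q \<in> \<A> G"
    "p' \<in> \<A> G" "q' \<in> \<A> G" "unorm p \<le> B" "unorm q' \<le> C"
  shows "unorm (p * q - p' * q') \<le> B * unorm (q - q') + C * unorm (p - p')"
proof -
  have eq: "p * q - p' * q' = p * (q - q') + (p - p') * q'" by (simp add: algebra_simps)
  have "unorm (p * q - p' * q') \<le> unorm (p * (q - q')) + unorm ((p - p') * q')"
    unfolding eq using assms by (intro unorm.triangle free_mult free_diff)
  also have "\<dots> \<le> unorm p * unorm (q - q') + unorm (p - p') * unorm q'"
    using assms by (intro add_mono unorm.submult free_diff)
  also have "\<dots> \<le> B * unorm (q - q') + unorm (p - p') * C"
    using assms by (intro add_mono mult_right_mono mult_left_mono unorm.nonneg free_diff)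
  finally show ?thesis by (simp add: mult.commute)
qed

lemma CS_mult:
  assumes x: "x \<in> CS" and y: "y \<in> CS" shows "(\<lambda>k. x k * y k) \<in> CS"
proof (rule CSI)
  note mem = CS_mem[OF x] CS_mem[OF y]
  show "x k * y k \<in> \<A> G" for k by (intro free_mult mem)
  obtain B where B: "0 < B" "\<And>k. unorm (x k) \<le> B" using CS_bounded[OF x] by blast
  obtain C where C: "0 < C" "\<And>k. unorm (y k) \<le> C" using CS_bounded[OF y] by blast
  fix e :: real assume e: "0 < e"
  obtain M where M: "\<And>k l. k \<ge> M \<Longrightarrow> l \<ge> M \<Longrightarrow> unorm (x k - x l) < e / (2 * C)"
    using CS_Cauchy[OF x, of "e / (2 * C)"] e C by auto
  obtain N where N: "\<And>k l. k \<ge> N \<Longrightarrow> l \<ge> N \<Longrightarrow> unorm (y k - y l) < e / (2 * B)"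
    using CS_Cauchy[OF y, of "e / (2 * B)"] e B by auto
  have "unorm (x k * y k - x l * y l) < e" if "k \<ge> max M N" "l \<ge> max M N" for k l
  proof -
    have "unorm (x k * y k - x l * y l) \<le> B * unorm (y k - y l) + C * unorm (x k - x l)"
      by (intro unorm_mult_diff_le mem B C)
    also have "\<dots> < B * (e / (2 * B)) + C * (e / (2 * C))"
      using B(1) C(1) M[of k l] N[of k l] that by (intro add_strict_mono mult_strict_left_mono) auto
    also have "\<dots> = e" using B(1) C(1) by simp
    finally show ?thesis .
  qed
  then show "\<exists>N. \<forall>k\<ge>N. \<forall>l\<ge>N. unorm (x k * y k - x l * y l) < e" by blast
qed

lemma CS_pscale: "x \<in> CS \<Longrightarrow> (\<lambda>k. pscale c (x k)) \<in> CS"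
  using CS_mult[OF CS_const[of "pscale c 1"], of x]
  by (simp add: pscale_mult_left free_pscale free_one)

lemma CS_pstar:
  assumes x: "x \<in> CS" shows "(\<lambda>k. pstar (x k)) \<in> CS"
proof (rule CSI)
  show "pstar (x k) \<in> \<A> G" for k by (intro free_pstar CS_mem[OF x])
  have "unorm (pstar (x k) - pstar (x l)) = unorm (x k - x l)" for k l
    using unorm.pstar[of "x k - x l"] by (simp add: pstar_diff free_diff CS_mem[OF x])
  then show "\<exists>N. \<forall>k\<ge>N. \<forall>l\<ge>N. unorm (pstar (x k) - pstar (x l)) < e" if "0 < e" for e
    using CS_Cauchy[OF x that] by simp
qed

section \<open>Null sequences and operations on classes\<close>

lemma NR_iff: "(x, y) \<in> NR \<longleftrightarrow> x \<in> CS \<and> y \<in> CS \<and> (\<lambda>k. unorm (x k - y k)) \<longlonglongrightarrow> 0"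
  by (auto simp: null_rel_def)

lemma null_seqI:
  assumes "\<And>k. x k \<in> \<A> G" "\<And>k. unorm (x k) \<le> r k" "r \<longlonglongrightarrow> 0"
  shows "(\<lambda>k. unorm (x k)) \<longlonglongrightarrow> 0"
  by (rule tendsto_sandwich[OF _ _ tendsto_const assms(3)]) (simp_all add: assms unorm.nonneg)

lemma equiv_NR: "equiv CS NR"
proof (rule equivI)
  show "NR \<subseteq> CS \<times> CS" by (auto simp: NR_iff)
  show "refl_on CS NR" by (auto simp: refl_on_def NR_iff unorm.zero)
  show "sym NR"
  proof (rule symI)
    fix x y assume xy: "(x, y) \<in> NR"
    then have "unorm (y k - x k) = unorm (x k - y k)" for k
      using CS_mem by (intro unorm.diff_commute) (auto simp: NR_iff)
    with xy show "(y, x) \<in> NR" by (simp add: NR_iff)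
  qed
  show "trans NR"
  proof (rule transI)
    fix x y z assume xyz: "(x, y) \<in> NR" "(y, z) \<in> NR"
    then have mem: "x k \<in> \<A> G" "y k \<in> \<A> G" "z k \<in> \<A> G" for k
      by (auto simp: NR_iff CS_mem)
    have "(\<lambda>k. unorm (x k - y k) + unorm (y k - z k)) \<longlonglongrightarrow> 0 + 0"
      using xyz by (intro tendsto_add) (auto simp: NR_iff)
    then have "(\<lambda>k. unorm (x k - z k)) \<longlonglongrightarrow> 0"
      by (intro null_seqI[where r = "\<lambda>k. unorm (x k - y k) + unorm (y k - z k)"]
          unorm.triangle_trans free_diff mem) simp
    with xyz show "(x, z) \<in> NR" by (simp add: NR_iff)
  qed
qed

lemma cls_eq_iff: "x \<in> CS \<Longrightarrow> y \<in> CS \<Longrightarrow> cls x = cls y \<longleftrightarrow> (\<lambda>k. unorm (x k - y k)) \<longlonglongrightarrow> 0"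
  unfolding cls_def using eq_equiv_class_iff[OF equiv_NR, of x y] by (simp add: NR_iff)

lemma carrier_univ_cstar: "carrier (univ_cstar G R) = cls ` CS"
  by (auto simp: univ_cstar_def quotient_def cls_def)

lemma cls_carrier: "x \<in> CS \<Longrightarrow> cls x \<in> carrier (univ_cstar G R)"
  by (simp add: carrier_univ_cstar)

lemma cls_congI:
  assumes "x \<in> CS" "y \<in> CS" "\<And>k. unorm (x k - y k) \<le> r k" "r \<longlonglongrightarrow> 0"
  shows "cls x = cls y"
  using assms by (simp add: cls_eq_iff null_seqI[of "\<lambda>k. x k - y k" r] free_diff CS_mem)

text \<open>The operations of \<open>univ_cstar\<close> are unions over all representatives; such a
  union collapses to a single class once the operation respects null sequences.\<close>

lemma univ_cstar_binop:
  assumes closed: "\<And>x y. x \<in> CS \<Longrightarrow> y \<in> CS \<Longrightarrow> (\<lambda>k. f (x k) (y k)) \<in> CS"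
    and cong: "\<And>x x' y y'. (x, x') \<in> NR \<Longrightarrow> (y, y') \<in> NR \<Longrightarrow>
      (\<lambda>k. unorm (f (x k) (y k) - f (x' k) (y' k))) \<longlonglongrightarrow> 0"
    and "x \<in> CS" "y \<in> CS"
  shows "(\<Union>x\<in>cls x. \<Union>y\<in>cls y. NR `` {\<lambda>k. f (x k) (y k)}) = cls (\<lambda>k. f (x k) (y k))"
proof -
  have "congruent2 NR NR (\<lambda>x y. cls (\<lambda>k. f (x k) (y k)))"
  proof (rule congruent2I')
    fix x x' y y' assume 1: "(x, x') \<in> NR" "(y, y') \<in> NR"
    then show "cls (\<lambda>k. f (x k) (y k)) = cls (\<lambda>k. f (x' k) (y' k))"
      using cong[OF 1] by (subst cls_eq_iff) (auto simp: NR_iff closed)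
  qed
  from UN_equiv_class2[OF equiv_NR equiv_NR this assms(3,4)] show ?thesis
    by (simp only: cls_def)
qed

lemma univ_cstar_unop:
  assumes closed: "\<And>x. x \<in> CS \<Longrightarrow> (\<lambda>k. f (x k)) \<in> CS"
    and cong: "\<And>x x'. (x, x') \<in> NR \<Longrightarrow> (\<lambda>k. unorm (f (x k) - f (x' k))) \<longlonglongrightarrow> 0"
    and "x \<in> CS"
  shows "(\<Union>x\<in>cls x. NR `` {\<lambda>k. f (x k)}) = cls (\<lambda>k. f (x k))"
proof -
  have "congruent NR (\<lambda>x. cls (\<lambda>k. f (x k)))"
  proof (rule congruentI)
    fix x x' assume 1: "(x, x') \<in> NR"
    then show "cls (\<lambda>k. f (x k)) = cls (\<lambda>k. f (x' k))"
      using cong[OF 1] by (subst cls_eq_iff) (auto simp: NR_iff closed)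
  qed
  from UN_equiv_class[OF equiv_NR this assms(3)] show ?thesis
    by (simp only: cls_def)
qed

lemma univ_cstar_simps:
  "monoid.mult (univ_cstar G R) X Y = (\<Union>x\<in>X. \<Union>y\<in>Y. NR `` {\<lambda>k. x k * y k})"
  "add (univ_cstar G R) X Y = (\<Union>x\<in>X. \<Union>y\<in>Y. NR `` {\<lambda>k. x k + y k})"
  "smult (univ_cstar G R) c X = (\<Union>x\<in>X. NR `` {\<lambda>k. pscale c (x k)})"
  "star (univ_cstar G R) X = (\<Union>x\<in>X. NR `` {\<lambda>k. pstar (x k)})"
  unfolding univ_cstar_def by simp_all

lemma univ_cstar_mult:
  assumes "x \<in> CS" "y \<in> CS"
  shows "monoid.mult (univ_cstar G R) (cls x) (cls y) = cls (\<lambda>k. x k * y k)"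
proof -
  have "(\<lambda>k. unorm (x k * y k - x' k * y' k)) \<longlonglongrightarrow> 0" if "(x, x') \<in> NR" "(y, y') \<in> NR" for x x' y y'
  proof -
    have CS: "x \<in> CS" "x' \<in> CS" "y \<in> CS" "y' \<in> CS"
      and lim: "(\<lambda>k. unorm (x k - x' k)) \<longlonglongrightarrow> 0" "(\<lambda>k. unorm (y k - y' k)) \<longlonglongrightarrow> 0"
      using that by (auto simp: NR_iff)
    note mem = CS[THEN CS_mem]
    obtain B where B: "0 < B" "\<And>k. unorm (x k) \<le> B" using CS_bounded[OF CS(1)] by blast
    obtain C where C: "0 < C" "\<And>k. unorm (y' k) \<le> C" using CS_bounded[OF CS(4)] by blast
    have "(\<lambda>k. B * unorm (y k - y' k) + C * unorm (x k - x' k)) \<longlonglongrightarrow> B * 0 + C * 0"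
      by (intro tendsto_intros lim)
    then show ?thesis
      by (intro null_seqI[where r = "\<lambda>k. B * unorm (y k - y' k) + C * unorm (x k - x' k)"]
          unorm_mult_diff_le mem B C free_diff free_mult) simp
  qed
  then show ?thesis
    unfolding univ_cstar_simps using assms by (intro univ_cstar_binop CS_mult) auto
qed

lemma univ_cstar_add:
  assumes "x \<in> CS" "y \<in> CS"
  shows "add (univ_cstar G R) (cls x) (cls y) = cls (\<lambda>k. x k + y k)"
proof -
  have "(\<lambda>k. unorm (x k + y k - (x' k + y' k))) \<longlonglongrightarrow> 0" if "(x, x') \<in> NR" "(y, y') \<in> NR" for x x' y y'
  proof -
    have mem: "x k \<in> \<A> G" "x' k \<in> \<A> G"
        "y k \<in> \<A> G" "y' k \<in> \<A> G" for k
      using that by (auto simp: NR_iff CS_mem)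
    have lim: "(\<lambda>k. unorm (x k - x' k)) \<longlonglongrightarrow> 0" "(\<lambda>k. unorm (y k - y' k)) \<longlonglongrightarrow> 0"
      using that by (auto simp: NR_iff)
    have "unorm (x k + y k - (x' k + y' k)) \<le> unorm (x k - x' k) + unorm (y k - y' k)" for k
      using unorm.triangle[of "x k - x' k" "y k - y' k"] mem
      by (simp add: free_diff algebra_simps)
    moreover have "(\<lambda>k. unorm (x k - x' k) + unorm (y k - y' k)) \<longlonglongrightarrow> 0 + 0"
      by (intro tendsto_intros lim)
    ultimately show ?thesis
      using mem by (intro null_seqI[where r = "\<lambda>k. unorm (x k - x' k) + unorm (y k - y' k)"]
          free_diff free_add) simp_all
  qed
  then show ?thesis
    unfolding univ_cstar_simps using assms by (intro univ_cstar_binop CS_add) auto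
qed

lemma univ_cstar_smult:
  assumes "x \<in> CS"
  shows "smult (univ_cstar G R) c (cls x) = cls (\<lambda>k. pscale c (x k))"
proof -
  have "(\<lambda>k. unorm (pscale c (x k) - pscale c (x' k))) \<longlonglongrightarrow> 0" if "(x, x') \<in> NR" for x x'
  proof -
    have "unorm (pscale c (x k) - pscale c (x' k)) = cmod c * unorm (x k - x' k)" for k
      using that unorm.scale[of "x k - x' k" c] by (simp add: NR_iff CS_mem free_diff pscale_diff)
    moreover have "(\<lambda>k. cmod c * unorm (x k - x' k)) \<longlonglongrightarrow> cmod c * 0"
      using that by (intro tendsto_intros) (simp add: NR_iff)
    ultimately show ?thesis by simp
  qed
  then show ?thesis
    unfolding univ_cstar_simps using assms by (intro univ_cstar_unop CS_pscale) auto
qed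

lemma univ_cstar_star:
  assumes "x \<in> CS"
  shows "star (univ_cstar G R) (cls x) = cls (\<lambda>k. pstar (x k))"
proof -
  have "(\<lambda>k. unorm (pstar (x k) - pstar (x' k))) \<longlonglongrightarrow> 0" if "(x, x') \<in> NR" for x x'
  proof -
    have "unorm (pstar (x k) - pstar (x' k)) = unorm (x k - x' k)" for k
      using that unorm.pstar[of "x k - x' k"] by (simp add: NR_iff CS_mem free_diff pstar_diff)
    then show ?thesis using that by (simp add: NR_iff)
  qed
  then show ?thesis
    unfolding univ_cstar_simps using assms by (intro univ_cstar_unop CS_pstar) auto
qed

lemma univ_cstar_one: "one (univ_cstar G R) = cls (\<lambda>k. 1)"
  by (simp add: univ_cstar_def cls_def)

lemma univ_gen_eq: "univ_gen G R g = cls (\<lambda>k. gen g)"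
  by (simp add: univ_gen_def cls_def)

section \<open>Inverses by partial sums of the Neumann series\<close>

definition neumann :: "real \<Rightarrow> nat \<Rightarrow> 'g star_poly \<Rightarrow> 'g star_poly" where
  "neumann \<mu> k y = (\<Sum>i<k. pscale (of_real (inverse \<mu> ^ Suc i)) (y ^ i))"

text \<open>The product telescopes; the other order follows because the partial sum commutes with
  y.\<close>

lemma neumann_mult:
  assumes "\<mu> \<noteq> 0"
  shows "neumann \<mu> k y * (pscale (of_real \<mu>) 1 - y) = 1 - pscale (of_real (inverse \<mu> ^ k)) (y ^ k)"
    and "(pscale (of_real \<mu>) 1 - y) * neumann \<mu> k y = 1 - pscale (of_real (inverse \<mu> ^ k)) (y ^ k)"
proof -
  have c: "complex_of_real (inverse \<mu> ^ Suc k) * of_real \<mu> = of_real (inverse \<mu> ^ k)" for k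
    using assms by (simp add: field_simps)
  have "neumann \<mu> k y * (pscale (of_real \<mu>) 1 - y) = 1 - pscale (of_real (inverse \<mu> ^ k)) (y ^ k)"
  proof (induction k)
    case (Suc k)
    have "neumann \<mu> (Suc k) y * (pscale (of_real \<mu>) 1 - y) =
        neumann \<mu> k y * (pscale (of_real \<mu>) 1 - y) +
        (pscale (of_real (inverse \<mu> ^ Suc k) * of_real \<mu>) (y ^ k) -
          pscale (of_real (inverse \<mu> ^ Suc k)) (y ^ Suc k))"
      by (simp add: neumann_def distrib_right right_diff_distrib pscale_mult_left pscale_mult_right
          power_commutes mult.commute pscale_add del: of_real_power power_Suc) (simp add: power_commutes)
    then show ?case unfolding Suc.IH c by simp
  qed (simp add: neumann_def)
  moreover have "y * neumann \<mu> k y = neumann \<mu> k y * y"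
    by (simp add: neumann_def sum_distrib_left sum_distrib_right pscale_mult_left pscale_mult_right
        power_commutes)
  ultimately show "neumann \<mu> k y * (pscale (of_real \<mu>) 1 - y) = 1 - pscale (of_real (inverse \<mu> ^ k)) (y ^ k)"
    "(pscale (of_real \<mu>) 1 - y) * neumann \<mu> k y = 1 - pscale (of_real (inverse \<mu> ^ k)) (y ^ k)"
    by (simp_all add: algebra_simps pscale_mult_left pscale_mult_right)
qed

text \<open>The Neumann series is summed diagonally, so that no completeness of the completion is used.\<close>

lemma univ_cstar_left_inverse:
  assumes y: "y \<in> CS" and le: "\<And>k. unorm (y k) \<le> s" and s: "0 \<le> s" "s < \<mu>"
  obtains z where "z \<in> CS"
    "monoid.mult (univ_cstar G R) (cls z) (cls (\<lambda>k. pscale (of_real \<mu>) 1 + pscale (-1) (y k))) =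
      one (univ_cstar G R)"
proof -
  note mem = CS_mem[OF y]
  have \<mu>: "0 < \<mu>" using s by simp
  define \<rho> where "\<rho> = s / \<mu>"
  have \<rho>: "0 \<le> \<rho>" "\<rho> < 1" using s \<mu> by (simp_all add: \<rho>_def)
  define z where "z k = neumann \<mu> k (y k)" for k
  define d where "d k = pscale (of_real (inverse \<mu> ^ k)) (y k ^ k)" for k
  have z_mem: "z k \<in> \<A> G" and d_mem: "d k \<in> \<A> G" for k
    unfolding z_def d_def neumann_def
    by (intro free_sum free_pscale free_power mem)+
  have pow: "unorm (y k ^ i) \<le> s ^ i" for k i
    using unorm.power_le[OF mem, of k i] power_mono[OF le[of k] unorm.nonneg[OF mem], of i] by simp
  have d_le: "unorm (d k) \<le> \<rho> ^ k" for k
  proof -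
    have "unorm (d k) = inverse \<mu> ^ k * unorm (y k ^ k)"
      unfolding d_def using \<mu> by (simp only: unorm.scale free_power mem norm_of_real) simp
    also have "\<dots> \<le> inverse \<mu> ^ k * s ^ k" using \<mu> by (intro mult_left_mono pow) simp
    also have "\<dots> = \<rho> ^ k" by (simp add: \<rho>_def power_divide field_simps)
    finally show ?thesis .
  qed
  have z_le: "unorm (z k) \<le> inverse \<mu> * (1 / (1 - \<rho>))" for k
  proof -
    have "unorm (z k) \<le> (\<Sum>i<k. unorm (pscale (of_real (inverse \<mu> ^ Suc i)) (y k ^ i)))"
      unfolding z_def neumann_def
      by (intro unorm.sum_le free_pscale free_power mem)
    also have "\<dots> \<le> (\<Sum>i<k. inverse \<mu> * \<rho> ^ i)"
    proof (rule sum_mono)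
      fix i
      have "unorm (pscale (of_real (inverse \<mu> ^ Suc i)) (y k ^ i)) = inverse \<mu> ^ Suc i * unorm (y k ^ i)"
        using \<mu> by (simp only: unorm.scale free_power mem norm_of_real) simp
      also have "\<dots> \<le> inverse \<mu> ^ Suc i * s ^ i"
        using \<mu> by (intro mult_left_mono pow) simp
      also have "\<dots> = inverse \<mu> * \<rho> ^ i" by (simp add: \<rho>_def power_divide field_simps)
      finally show "unorm (pscale (of_real (inverse \<mu> ^ Suc i)) (y k ^ i)) \<le> inverse \<mu> * \<rho> ^ i" .
    qed
    also have "\<dots> = inverse \<mu> * ((1 - \<rho> ^ k) / (1 - \<rho>))"
      using \<rho> by (simp add: sum_distrib_left[symmetric] sum_gp_strict)
    also have "\<dots> \<le> inverse \<mu> * (1 / (1 - \<rho>))"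
      using \<rho> \<mu> by (intro mult_left_mono divide_right_mono) simp_all
    finally show ?thesis .
  qed
  \<comment> \<open>The sum of the full geometric series, equal to 1/(\<mu> - s); it bounds all
    \<open>z k\<close> uniformly.\<close>
  define B where "B = inverse \<mu> * (1 / (1 - \<rho>))"
  have B: "0 < B" using \<mu> \<rho> by (simp add: B_def)
  note z_le = z_le[folded B_def]
  have inv: "z k * (pscale (of_real \<mu>) 1 - y k) = 1 - d k" "(pscale (of_real \<mu>) 1 - y k) * z k = 1 - d k" for k
    unfolding z_def d_def using \<mu> by (intro neumann_mult; simp)+
  \<comment> \<open>The resolvent identity for approximate inverses, where \<open>d k\<close> is the
    error of \<open>z k\<close>: z_k - z_l = z_k (y_k - y_l) z_l + z_k d_l - d_k z_l.\<close>
  have z_diff: "unorm (z k - z l) \<le> B * B * unorm (y k - y l) + B * \<rho> ^ l + B * \<rho> ^ k" for k l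
  proof -
    have "z k * (y k - y l) * z l = z k * ((pscale (of_real \<mu>) 1 - y l) * z l) -
        (z k * (pscale (of_real \<mu>) 1 - y k)) * z l"
      by (simp add: algebra_simps pscale_mult_left pscale_mult_right)
    then have "z k - z l = z k * (y k - y l) * z l + z k * d l - d k * z l"
      unfolding inv by (simp add: algebra_simps)
    then have "unorm (z k - z l) \<le> unorm (z k * (y k - y l) * z l + z k * d l) + unorm (d k * z l)"
      by (simp only:) (intro unorm.triangle_diff free_add free_mult
          free_diff z_mem d_mem mem)
    also have "\<dots> \<le> unorm (z k * (y k - y l) * z l) + unorm (z k * d l) + unorm (d k * z l)"
      by (intro add_right_mono unorm.triangle free_mult free_diff z_mem d_mem mem)
    also have "\<dots> \<le> (B * unorm (y k - y l)) * B + B * \<rho> ^ l + \<rho> ^ k * B"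
    proof (intro add_mono)
      have "unorm (z k * (y k - y l) * z l) \<le> unorm (z k * (y k - y l)) * unorm (z l)"
        by (intro unorm.submult free_mult free_diff z_mem mem)
      also have "\<dots> \<le> (unorm (z k) * unorm (y k - y l)) * B"
        using B by (intro mult_mono z_le unorm.submult unorm.nonneg free_mult
            free_diff z_mem mem mult_nonneg_nonneg)
      also have "\<dots> \<le> (B * unorm (y k - y l)) * B"
        using B by (intro mult_right_mono z_le unorm.nonneg free_diff mem) simp
      finally show "unorm (z k * (y k - y l) * z l) \<le> (B * unorm (y k - y l)) * B" .
      show "unorm (z k * d l) \<le> B * \<rho> ^ l"
        using B \<rho> by (intro order_trans[OF unorm.submult] mult_mono z_le d_le z_mem d_mem unorm.nonneg) simp_all
      show "unorm (d k * z l) \<le> \<rho> ^ k * B"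
        using B \<rho> by (intro order_trans[OF unorm.submult] mult_mono z_le d_le z_mem d_mem unorm.nonneg) simp_all
    qed
    finally show ?thesis by (simp add: mult_ac)
  qed
  have z: "z \<in> CS"
  proof (rule CSI[OF z_mem])
    fix e :: real assume e: "0 < e"
    obtain M where M: "\<And>k l. k \<ge> M \<Longrightarrow> l \<ge> M \<Longrightarrow> unorm (y k - y l) < e / (2 * (B * B))"
      using CS_Cauchy[OF y, of "e / (2 * (B * B))"] e B by auto
    have lim: "(\<lambda>k. \<rho> ^ k) \<longlonglongrightarrow> 0" using \<rho> by (intro LIMSEQ_power_zero) simp
    have "0 < e / (4 * B)" using e B by simp
    with lim have "\<forall>\<^sub>F k in sequentially. \<rho> ^ k < e / (4 * B)"
      by (rule order_tendstoD(2))
    then obtain N where N: "\<And>k. k \<ge> N \<Longrightarrow> \<rho> ^ k < e / (4 * B)"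
      by (auto simp: eventually_sequentially)
    have "unorm (z k - z l) < e" if "k \<ge> max M N" "l \<ge> max M N" for k l
    proof -
      have "B * B * unorm (y k - y l) < B * B * (e / (2 * (B * B)))"
        using B M[of k l] that by (intro mult_strict_left_mono) simp_all
      moreover have "B * \<rho> ^ l < B * (e / (4 * B))" "B * \<rho> ^ k < B * (e / (4 * B))"
        using B N[of k] N[of l] that by (intro mult_strict_left_mono; simp)+
      moreover have "B * B * (e / (2 * (B * B))) = e / 2" "B * (e / (4 * B)) = e / 4" using B by simp_all
      ultimately show ?thesis using z_diff[of k l] by linarith
    qed
    then show "\<exists>N. \<forall>k\<ge>N. \<forall>l\<ge>N. unorm (z k - z l) < e" by blast
  qed
  let ?w = "\<lambda>k. pscale (of_real \<mu>) 1 + pscale (-1) (y k)"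
  have w: "?w \<in> CS"
    by (intro CS_add CS_pscale y CS_const free_pscale free_one)
  have "cls (\<lambda>k. z k * ?w k) = cls (\<lambda>k. 1)"
  proof (rule cls_congI)
    have "z k * ?w k - 1 = - d k" for k
      using inv(1)[of k] by (simp add: pscale_minus_one)
    then show "unorm (z k * ?w k - 1) \<le> \<rho> ^ k" for k
      using d_le by (simp add: unorm.uminus d_mem)
    show "(\<lambda>k. \<rho> ^ k) \<longlonglongrightarrow> 0" using \<rho> by (intro LIMSEQ_power_zero) simp
  qed (intro CS_mult z w CS_const free_one)+
  then show ?thesis
    using that[OF z] univ_cstar_mult[OF z w] by (simp add: univ_cstar_one)
qed

end

section \<open>The representation\<close>

context twisted_shifts
begin

section \<open>Extension of the evaluation to Cauchy sequences\<close>

lemma poly_op_diff_norm_le: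
  assumes p: "p \<in> \<A> G" and q: "q \<in> \<A> G" and f: "f \<in> ell2 H"
  shows "ell2_norm H (\<lambda>i. poly_op p f i - poly_op q f i) \<le> unorm (p - q) * ell2_norm H f"
proof -
  have "(\<lambda>i. poly_op p f i - poly_op q f i) = poly_op (p - q) f"
    by (rule ext) (rule poly_op_diff[OF f, symmetric])
  then show ?thesis
    using op_norm_bound[OF poly_op_bounded f, of "p - q"] univ_norm_eq_op_norm[OF free_diff[OF p q]]
    by simp
qed

definition seq_op :: "(nat \<Rightarrow> nat star_poly) \<Rightarrow> (nat \<Rightarrow> int) op" where
  "seq_op x = (\<lambda>f\<in>ell2 H. \<lambda>i. lim (\<lambda>k. poly_op (x k) f i))"

text \<open>The operator norm of \<open>poly_op\<close> is bounded by the universal norm, so Cauchy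
  sequences of *-polynomials become Cauchy sequences of operators, and
  \<open>bounded_ops_complete\<close> applies.\<close>

lemma
  assumes x: "x \<in> CS"
  shows seq_op_bounded: "seq_op x \<in> bounded_ops H"
    and seq_op_limit: "f \<in> ell2 H \<Longrightarrow> (\<lambda>k. poly_op (x k) f i) \<longlonglongrightarrow> seq_op x f i"
    and seq_op_norm_limit: "0 < e \<Longrightarrow> \<exists>N. \<forall>k\<ge>N. \<forall>f\<in>ell2 H.
      ell2_norm H (\<lambda>i. poly_op (x k) f i - seq_op x f i) \<le> e * ell2_norm H f"
proof -
  note mem = CS_mem[OF x]
  have cauchy: "\<exists>N. \<forall>k\<ge>N. \<forall>l\<ge>N. \<forall>f\<in>ell2 H.
      ell2_norm H (\<lambda>i. poly_op (x k) f i - poly_op (x l) f i) \<le> e * ell2_norm H f" if e: "0 < e" for e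
  proof -
    obtain N where N: "\<And>k l. k \<ge> N \<Longrightarrow> l \<ge> N \<Longrightarrow> unorm (x k - x l) < e"
      using CS_Cauchy[OF x e] by blast
    have "ell2_norm H (\<lambda>i. poly_op (x k) f i - poly_op (x l) f i) \<le> e * ell2_norm H f"
      if "k \<ge> N" "l \<ge> N" "f \<in> ell2 H" for k l f
    proof -
      have "ell2_norm H (\<lambda>i. poly_op (x k) f i - poly_op (x l) f i) \<le> unorm (x k - x l) * ell2_norm H f"
        by (intro poly_op_diff_norm_le mem that)
      also have "\<dots> \<le> e * ell2_norm H f"
        using N[OF that(1,2)] by (intro mult_right_mono) simp_all
      finally show ?thesis .
    qed
    then show ?thesis by blast
  qed
  obtain B where B: "B \<in> bounded_ops H"
    "\<And>f i. f \<in> ell2 H \<Longrightarrow> (\<lambda>k. poly_op (x k) f i) \<longlonglongrightarrow> B f i"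
    "\<And>e. 0 < e \<Longrightarrow> \<exists>N. \<forall>k\<ge>N. \<forall>f\<in>ell2 H. ell2_norm H (\<lambda>i. poly_op (x k) f i - B f i) \<le> e * ell2_norm H f"
    using bounded_ops_complete[of "\<lambda>k. poly_op (x k)", OF poly_op_bounded cauchy] by blast
  have "seq_op x = B"
  proof (rule extensionalityI)
    show "seq_op x \<in> extensional (ell2 H)" by (simp add: seq_op_def)
    show "B \<in> extensional (ell2 H)" by (rule bounded_ops_extensional[OF B(1)])
    show "seq_op x f = B f" if "f \<in> ell2 H" for f
      using that limI[OF B(2)[OF that]] by (simp add: seq_op_def)
  qed
  with B show "seq_op x \<in> bounded_ops H"
    "f \<in> ell2 H \<Longrightarrow> (\<lambda>k. poly_op (x k) f i) \<longlonglongrightarrow> seq_op x f i"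
    "0 < e \<Longrightarrow> \<exists>N. \<forall>k\<ge>N. \<forall>f\<in>ell2 H.
      ell2_norm H (\<lambda>i. poly_op (x k) f i - seq_op x f i) \<le> e * ell2_norm H f"
    by simp_all
qed

lemma seq_op_eqI:
  assumes x: "x \<in> CS" and A: "A \<in> bounded_ops H"
    and lim: "\<And>f i. f \<in> ell2 H \<Longrightarrow> (\<lambda>k. poly_op (x k) f i) \<longlonglongrightarrow> A f i"
  shows "seq_op x = A"
proof (rule op_eqI[OF seq_op_bounded[OF x] A])
  fix f assume f: "f \<in> ell2 H"
  show "seq_op x f = A f"
    by (rule ext) (rule LIMSEQ_unique[OF seq_op_limit[OF x f] lim[OF f]])
qed

lemma seq_op_const: "p \<in> \<A> G \<Longrightarrow> seq_op (\<lambda>k. p) = poly_op p"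
  by (rule seq_op_eqI) (simp_all add: CS_const poly_op_bounded)

lemma seq_op_add:
  assumes x: "x \<in> CS" and y: "y \<in> CS"
  shows "seq_op (\<lambda>k. x k + y k) = (\<lambda>f\<in>ell2 H. \<lambda>i. seq_op x f i + seq_op y f i)"
proof (rule seq_op_eqI)
  fix f i assume f: "f \<in> ell2 H"
  then show "(\<lambda>k. poly_op (x k + y k) f i) \<longlonglongrightarrow> (\<lambda>f\<in>ell2 H. \<lambda>i. seq_op x f i + seq_op y f i) f i"
    by (simp add: poly_op_add tendsto_add seq_op_limit[OF x f] seq_op_limit[OF y f])
qed (intro CS_add add_bounded_ops seq_op_bounded x y)+

lemma seq_op_pscale:
  assumes x: "x \<in> CS"
  shows "seq_op (\<lambda>k. pscale c (x k)) = (\<lambda>f\<in>ell2 H. \<lambda>i. c * seq_op x f i)"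
proof (rule seq_op_eqI)
  fix f i assume f: "f \<in> ell2 H"
  then show "(\<lambda>k. poly_op (pscale c (x k)) f i) \<longlonglongrightarrow> (\<lambda>f\<in>ell2 H. \<lambda>i. c * seq_op x f i) f i"
    by (simp add: poly_op_pscale tendsto_mult_left seq_op_limit[OF x f])
qed (intro CS_pscale smult_bounded_ops seq_op_bounded x)+

text \<open>Compared through matrix entries, where taking the adjoint is transposition with
  conjugation and passes to the coordinatewise limit.\<close>

lemma seq_op_pstar:
  assumes x: "x \<in> CS" shows "seq_op (\<lambda>k. pstar (x k)) = op_adj H (seq_op x)"
proof (rule op_adj_eqI_unit_vec[OF seq_op_bounded[OF x] seq_op_bounded[OF CS_pstar[OF x]], symmetric])
  fix k l assume kl: "k \<in> H" "l \<in> H"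
  note u = unit_vec_ell2[OF kl(1)] unit_vec_ell2[OF kl(2)]
  have "(\<lambda>j. poly_op (pstar (x j)) (unit_vec l) k) \<longlonglongrightarrow> cnj (seq_op x (unit_vec k) l)"
    unfolding poly_op_pstar op_adj_unit_vec[OF poly_op_bounded kl]
    by (intro tendsto_cnj seq_op_limit[OF x] u)
  then show "seq_op (\<lambda>k. pstar (x k)) (unit_vec l) k = cnj (seq_op x (unit_vec k) l)"
    by (rule LIMSEQ_unique[OF seq_op_limit[OF CS_pstar[OF x] u(2)]])
qed

text \<open>Coordinatewise limits alone do not multiply. The vectors \<open>poly_op (y k) f\<close>
  converge in norm and the operators of the x k are uniformly bounded, so the inner vector may be
  replaced by its limit.\<close>

lemma seq_op_mult:
  assumes x: "x \<in> CS" and y: "y \<in> CS"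
  shows "seq_op (\<lambda>k. x k * y k) = compose (ell2 H) (seq_op x) (seq_op y)"
proof (rule seq_op_eqI)
  fix f i assume f: "f \<in> ell2 H"
  let ?g = "seq_op y f"
  have g: "?g \<in> ell2 H" by (rule bounded_ops_closed[OF seq_op_bounded[OF y] f])
  have yf: "poly_op (y k) f \<in> ell2 H" for k by (rule poly_op_closed[OF f])
  obtain B where B: "0 < B" "\<And>k. unorm (x k) \<le> B" using CS_bounded[OF x] by blast
  let ?d = "\<lambda>k. \<lambda>j. poly_op (y k) f j - ?g j"
  have d: "?d k \<in> ell2 H" for k by (rule ell2_diff[OF yf g])
  have "(\<lambda>k. ell2_norm H (?d k)) \<longlonglongrightarrow> 0"
  proof (rule LIMSEQ_I)
    fix r :: real assume r: "0 < r"
    define c where "c = ell2_norm H f + 1"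
    define e where "e = r / (2 * c)"
    have c: "0 < c" by (simp add: c_def add_nonneg_pos)
    have e: "0 < e" using r c by (simp add: e_def)
    obtain N where N: "\<And>k. k \<ge> N \<Longrightarrow> ell2_norm H (?d k) \<le> e * ell2_norm H f"
      using seq_op_norm_limit[OF y e] f by blast
    have "e * ell2_norm H f \<le> e * c" using e by (simp add: c_def)
    also have "\<dots> = r / 2" using c by (simp add: e_def)
    also have "\<dots> < r" using r by simp
    finally have "e * ell2_norm H f < r" .
    then have "norm (ell2_norm H (?d k) - 0) < r" if "k \<ge> N" for k
      using N[OF that] by simp
    then show "\<exists>N. \<forall>k\<ge>N. norm (ell2_norm H (?d k) - 0) < r" by blast
  qed
  then have lim: "(\<lambda>k. B * ell2_norm H (?d k)) \<longlonglongrightarrow> 0" by (rule tendsto_mult_right_zero)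
  have "cmod (poly_op (x k) (?d k) i) \<le> B * ell2_norm H (?d k)" for k
  proof -
    have "cmod (poly_op (x k) (?d k) i) \<le> ell2_norm H (poly_op (x k) (?d k))"
      by (intro cmod_le_ell2_norm poly_op_closed d)
    also have "\<dots> \<le> op_norm H (poly_op (x k)) * ell2_norm H (?d k)"
      by (intro op_norm_bound poly_op_bounded d)
    also have "\<dots> \<le> B * ell2_norm H (?d k)"
      using B(2)[of k] univ_norm_eq_op_norm[OF CS_mem[OF x, of k]] by (intro mult_right_mono) simp_all
    finally show ?thesis .
  qed
  then have "(\<lambda>k. poly_op (x k) (?d k) i) \<longlonglongrightarrow> 0"
    by (intro Lim_null_comparison[OF _ lim] always_eventually allI)
  then have "(\<lambda>k. poly_op (x k) (?d k) i + poly_op (x k) ?g i) \<longlonglongrightarrow> 0 + seq_op x ?g i"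
    by (intro tendsto_add seq_op_limit[OF x g])
  then show "(\<lambda>k. poly_op (x k * y k) f i) \<longlonglongrightarrow> compose (ell2 H) (seq_op x) (seq_op y) f i"
    using f by (simp add: compose_def poly_op_mult_apply bounded_ops_diff[OF poly_op_bounded yf g])
qed (intro CS_mult compose_bounded_ops seq_op_bounded x y)+

text \<open>From right to left this makes \<open>rep\<close> independent of the representative; from
  left to right it is faithfulness, and there the equality of the two norms is essential: operators
  that become close in norm force the *-polynomials to become close in the universal norm.\<close>

lemma seq_op_eq_iff:
  assumes x: "x \<in> CS" and y: "y \<in> CS"
  shows "seq_op x = seq_op y \<longleftrightarrow> cls x = cls y"
proof
  note mem = CS_mem[OF x] CS_mem[OF y]
  assume "cls x = cls y"
  then have lim: "(\<lambda>k. unorm (x k - y k)) \<longlonglongrightarrow> 0" using cls_eq_iff[OF x y] by simp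
  show "seq_op x = seq_op y"
  proof (rule seq_op_eqI[OF x seq_op_bounded[OF y]])
    fix f i assume f: "f \<in> ell2 H"
    have lim_f: "(\<lambda>k. unorm (x k - y k) * ell2_norm H f) \<longlonglongrightarrow> 0"
      by (rule tendsto_mult_left_zero[OF lim])
    have le: "\<forall>k. norm (poly_op (x k) f i - poly_op (y k) f i) \<le> unorm (x k - y k) * ell2_norm H f"
    proof
      fix k
      show "norm (poly_op (x k) f i - poly_op (y k) f i) \<le> unorm (x k - y k) * ell2_norm H f"
        using cmod_le_ell2_norm[OF ell2_diff[OF poly_op_closed[OF f, of "x k"] poly_op_closed[OF f, of "y k"]], of i]
          poly_op_diff_norm_le[OF mem f, of k k] by (rule order_trans)
    qed
    have "(\<lambda>k. poly_op (x k) f i - poly_op (y k) f i) \<longlonglongrightarrow> 0"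
      by (rule Lim_null_comparison[OF always_eventually[OF le] lim_f])
    from tendsto_add[OF this seq_op_limit[OF y f, of i]]
    show "(\<lambda>k. poly_op (x k) f i) \<longlonglongrightarrow> seq_op y f i" by simp
  qed
next
  note mem = CS_mem[OF x] CS_mem[OF y]
  assume eq: "seq_op x = seq_op y"
  have "(\<lambda>k. unorm (x k - y k)) \<longlonglongrightarrow> 0"
  proof (rule LIMSEQ_I)
    fix r :: real assume r: "0 < r"
    \<comment> \<open>Two errors of a third each leave room for the strict inequality.\<close>
    then have r3: "0 < r / 3" by simp
    obtain M where M: "\<And>k f. k \<ge> M \<Longrightarrow> f \<in> ell2 H \<Longrightarrow>
        ell2_norm H (\<lambda>i. poly_op (x k) f i - seq_op x f i) \<le> r / 3 * ell2_norm H f"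
      using seq_op_norm_limit[OF x r3] by blast
    obtain N where N: "\<And>k f. k \<ge> N \<Longrightarrow> f \<in> ell2 H \<Longrightarrow>
        ell2_norm H (\<lambda>i. poly_op (y k) f i - seq_op x f i) \<le> r / 3 * ell2_norm H f"
      using seq_op_norm_limit[OF y r3] unfolding eq by blast
    have "unorm (x k - y k) < r" if k: "k \<ge> max M N" for k
    proof -
      have "op_norm H (poly_op (x k - y k)) \<le> 2 * (r / 3)"
      proof (rule op_norm_le)
        fix f assume f: "f \<in> ell2 H"
        let ?u = "\<lambda>i. poly_op (x k) f i - seq_op x f i" and ?v = "\<lambda>i. poly_op (y k) f i - seq_op x f i"
        have uv: "?u \<in> ell2 H" "?v \<in> ell2 H"
          by (intro ell2_diff poly_op_closed f bounded_ops_closed[OF seq_op_bounded[OF x]])+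
        have "poly_op (x k - y k) f = (\<lambda>i. ?u i + (-1) * ?v i)"
          by (simp add: poly_op_diff f fun_eq_iff)
        then have "ell2_norm H (poly_op (x k - y k) f) \<le> ell2_norm H ?u + ell2_norm H (\<lambda>i. (-1) * ?v i)"
          by (simp only:) (intro ell2_add ell2_cmult uv)
        also have "\<dots> \<le> 2 * (r / 3) * ell2_norm H f"
          unfolding ell2_norm_cmult using M[OF _ f, of k] N[OF _ f, of k] k by simp
        finally show "ell2_norm H (poly_op (x k - y k) f) \<le> 2 * (r / 3) * ell2_norm H f" .
      qed (use r in simp)
      then show ?thesis
        using r univ_norm_eq_op_norm[OF free_diff[OF mem], of k k] by simp
    qed
    then have "norm (unorm (x k - y k) - 0) < r" if "k \<ge> max M N" for k
      using that unorm.nonneg[OF free_diff[OF mem], of k k] by simp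
    then show "\<exists>N. \<forall>k\<ge>N. norm (unorm (x k - y k) - 0) < r" by blast
  qed
  then show "cls x = cls y" using cls_eq_iff[OF x y] by simp
qed

section \<open>Existence and injectivity of the representation\<close>

definition rep :: "(nat \<Rightarrow> nat star_poly) set \<Rightarrow> (nat \<Rightarrow> int) op" where
  "rep = (\<lambda>X\<in>cls ` CS. seq_op (SOME x. x \<in> CS \<and> cls x = X))"

lemma rep_cls:
  assumes x: "x \<in> CS" shows "rep (cls x) = seq_op x"
proof -
  let ?y = "SOME y. y \<in> CS \<and> cls y = cls x"
  have y: "?y \<in> CS \<and> cls ?y = cls x" by (rule someI[where x = x and P = "\<lambda>y. y \<in> CS \<and> cls y = cls x"]) (use x in simp)
  then have "seq_op ?y = seq_op x" using seq_op_eq_iff x by blast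
  then show ?thesis using x by (simp add: rep_def)
qed

lemma rep_twist_rep: "rep \<in> twist_reps m n \<theta>"
proof -
  have "rep \<in> ring_hom (univ_cstar G R) (op_algebra H)"
  proof (rule ring_hom_memI)
    fix X assume "X \<in> carrier (univ_cstar G R)"
    then obtain x where x: "x \<in> CS" "X = cls x" by (auto simp: carrier_univ_cstar)
    then show "rep X \<in> carrier (op_algebra H)"
      by (simp add: rep_cls seq_op_bounded op_algebra_simps)
    fix Y assume "Y \<in> carrier (univ_cstar G R)"
    then obtain y where y: "y \<in> CS" "Y = cls y" by (auto simp: carrier_univ_cstar)
    show "rep (monoid.mult (univ_cstar G R) X Y) = monoid.mult (op_algebra H) (rep X) (rep Y)"
      using x y by (simp add: univ_cstar_mult rep_cls CS_mult seq_op_mult op_algebra_simps)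
    show "rep (add (univ_cstar G R) X Y) = add (op_algebra H) (rep X) (rep Y)"
      using x y by (simp add: univ_cstar_add rep_cls CS_add seq_op_add op_algebra_simps)
  next
    show "rep (one (univ_cstar G R)) = one (op_algebra H)"
      by (simp add: univ_cstar_one rep_cls CS_const free_one seq_op_const poly_op_one
          op_algebra_simps)
  qed
  moreover have "rep (smult (univ_cstar G R) c X) = smult (op_algebra H) c (rep X)"
    if "X \<in> carrier (univ_cstar G R)" for c X
    using that by (auto simp: carrier_univ_cstar univ_cstar_smult rep_cls CS_pscale seq_op_pscale
        op_algebra_simps)
  moreover have "rep (star (univ_cstar G R) X) = star (op_algebra H) (rep X)"
    if "X \<in> carrier (univ_cstar G R)" for X
    using that by (auto simp: carrier_univ_cstar univ_cstar_star rep_cls CS_pstar seq_op_pstar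
        op_algebra_simps)
  moreover have "rep \<in> extensional (carrier (univ_cstar G R))"
    by (simp add: rep_def carrier_univ_cstar)
  moreover have "rep (univ_gen G R i) = T_op m n \<theta> i" if "i \<in> G" for i
    using that by (simp add: univ_gen_eq rep_cls CS_const free_gen seq_op_const
        poly_op_gen T_op_eq)
  ultimately show ?thesis
    unfolding twist_reps_def star_hom_def C_Theta_def s_gen_def by blast
qed

lemma inj_on_rep: "inj_on rep (carrier (C_Theta m n \<theta>))"
  unfolding C_Theta_def carrier_univ_cstar
  by (rule inj_onI) (auto simp: rep_cls seq_op_eq_iff)

section \<open>Uniqueness of the representation\<close>

context
  fixes \<Phi> assumes \<Phi>: "\<Phi> \<in> twist_reps m n \<theta>"
begin

lemma hom_ring_hom: "\<Phi> \<in> ring_hom (univ_cstar G R) (op_algebra H)"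
  using \<Phi> by (auto simp: twist_reps_def star_hom_def C_Theta_def)

lemma hom_bounded: "x \<in> CS \<Longrightarrow> \<Phi> (cls x) \<in> bounded_ops H"
  using ring_hom_closed[OF hom_ring_hom cls_carrier] by (simp add: op_algebra_simps)

lemma hom_mult: "x \<in> CS \<Longrightarrow> y \<in> CS \<Longrightarrow>
    \<Phi> (cls (\<lambda>k. x k * y k)) = compose (ell2 H) (\<Phi> (cls x)) (\<Phi> (cls y))"
  using ring_hom_mult[OF hom_ring_hom cls_carrier cls_carrier, of x y]
  by (simp add: univ_cstar_mult op_algebra_simps)

lemma hom_add: "x \<in> CS \<Longrightarrow> y \<in> CS \<Longrightarrow>
    \<Phi> (cls (\<lambda>k. x k + y k)) = (\<lambda>f\<in>ell2 H. \<lambda>i. \<Phi> (cls x) f i + \<Phi> (cls y) f i)"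
  using ring_hom_add[OF hom_ring_hom cls_carrier cls_carrier, of x y]
  by (simp add: univ_cstar_add op_algebra_simps)

lemma hom_one: "\<Phi> (cls (\<lambda>k. 1)) = (\<lambda>f\<in>ell2 H. f)"
  using ring_hom_one[OF hom_ring_hom] by (simp add: univ_cstar_one op_algebra_simps)

lemma hom_pscale:
  assumes "x \<in> CS" shows "\<Phi> (cls (\<lambda>k. pscale c (x k))) = (\<lambda>f\<in>ell2 H. \<lambda>i. c * \<Phi> (cls x) f i)"
proof -
  have "\<Phi> (smult (univ_cstar G R) c (cls x)) = smult (op_algebra H) c (\<Phi> (cls x))"
    using \<Phi> cls_carrier[OF assms] by (auto simp: twist_reps_def star_hom_def C_Theta_def)
  then show ?thesis by (simp add: univ_cstar_smult assms op_algebra_simps)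
qed

lemma hom_pstar:
  assumes "x \<in> CS" shows "\<Phi> (cls (\<lambda>k. pstar (x k))) = op_adj H (\<Phi> (cls x))"
proof -
  have "\<Phi> (star (univ_cstar G R) (cls x)) = star (op_algebra H) (\<Phi> (cls x))"
    using \<Phi> cls_carrier[OF assms] by (auto simp: twist_reps_def star_hom_def C_Theta_def)
  then show ?thesis by (simp add: univ_cstar_star assms op_algebra_simps)
qed

lemma hom_gen:
  assumes "g \<in> G" shows "\<Phi> (cls (\<lambda>k. gen g)) = T g"
proof -
  have "\<Phi> (univ_gen G R g) = T_op m n \<theta> g"
    using \<Phi> assms by (auto simp: twist_reps_def s_gen_def)
  then show ?thesis using assms by (simp add: univ_gen_eq T_op_eq)
qed

lemma hom_const: "p \<in> \<A> G \<Longrightarrow> \<Phi> (cls (\<lambda>k. p)) = poly_op p"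
proof (induction p rule: free_induct)
  case one
  show ?case by (simp only: hom_one poly_op_one)
next
  case (gen g)
  then show ?case by (simp only: hom_gen poly_op_gen)
next
  case (gen_star g)
  then show ?case
    by (simp only: hom_pstar[OF CS_const[OF free_gen]] hom_gen poly_op_gen poly_op_pstar)
next
  case (scale c p)
  then show ?case by (simp only: hom_pscale[OF CS_const] poly_op_pscale)
next
  case (add p q)
  then show ?case by (simp only: hom_add[OF CS_const CS_const] poly_op_add)
next
  case (mult p q)
  then show ?case by (simp only: hom_mult[OF CS_const CS_const] poly_op_mult)
qed

text \<open>Continuity is not part of \<open>star_hom\<close> and has to be derived. The bound is
  asked of every term of the representing sequence, because the diagonal Neumann sums are built from
  the terms and not from the class.\<close>

lemma hom_contractive:
  assumes x: "x \<in> CS" and le: "\<And>k. unorm (x k) \<le> r"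
  shows "op_norm H (\<Phi> (cls x)) \<le> r"
proof (rule ccontr)
  let ?A = "\<Phi> (cls x)"
  assume "\<not> op_norm H ?A \<le> r"
  then have less: "r < op_norm H ?A" by simp
  note mem = CS_mem[OF x]
  have r: "0 \<le> r" using unorm.nonneg[OF mem, of 0] le[of 0] by simp
  define \<mu> where "\<mu> = (op_norm H ?A)\<^sup>2"
  have A: "?A \<in> bounded_ops H" by (rule hom_bounded[OF x])
  let ?y = "\<lambda>k. pstar (x k) * x k"
  have y: "?y \<in> CS" by (intro CS_mult CS_pstar x)
  have y_le: "unorm (?y k) \<le> r\<^sup>2" for k
    using le[of k] unorm.nonneg[OF mem] unorm.cstar[OF mem] by (simp add: power_mono)
  have "r\<^sup>2 < \<mu>" unfolding \<mu>_def using less r by (intro power_strict_mono) simp_all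
  from univ_cstar_left_inverse[OF y y_le _ this] obtain z where z: "z \<in> CS" and
    inv: "monoid.mult (univ_cstar G R) (cls z) (cls (\<lambda>k. pscale (of_real \<mu>) 1 + pscale (-1) (?y k))) =
      one (univ_cstar G R)"
    by auto
  let ?w = "\<lambda>k. pscale (of_real \<mu>) 1 + pscale (-1) (?y k)"
  have one: "(\<lambda>k. 1) \<in> CS" by (intro CS_const free_one)
  have w: "?w \<in> CS" by (intro CS_add CS_pscale one y)
  have \<Phi>w: "\<Phi> (cls ?w) f = (\<lambda>i. of_real \<mu> * f i - op_adj H ?A (?A f) i)" if f: "f \<in> ell2 H" for f
  proof -
    have "\<Phi> (cls ?w) f = (\<lambda>i. of_real \<mu> * f i + (-1) * compose (ell2 H) (op_adj H ?A) ?A f i)"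
      using f by (simp add: hom_add[OF CS_pscale[OF one] CS_pscale[OF y]] hom_pscale[OF one] hom_one
          hom_pscale[OF y] hom_mult[OF CS_pstar[OF x] x] hom_pstar[OF x])
    then show ?thesis using f by (simp add: compose_def)
  qed
  have "compose (ell2 H) (\<Phi> (cls z)) (\<Phi> (cls ?w)) = (\<lambda>f\<in>ell2 H. f)"
    using inv unfolding univ_cstar_mult[OF z w] univ_cstar_one hom_mult[OF z w, symmetric]
    by (simp only: hom_one)
  then have "compose (ell2 H) (\<Phi> (cls z)) (\<Phi> (cls ?w)) f = f" if "f \<in> ell2 H" for f
    using that by simp
  then have zw: "\<Phi> (cls z) (\<Phi> (cls ?w) f) = f" if "f \<in> ell2 H" for f
    using that by (simp add: compose_def)
  have "\<Phi> (cls z) (\<lambda>i. of_real \<mu> * f i - op_adj H ?A (?A f) i) = f" if "f \<in> ell2 H" for f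
    using zw[OF that] unfolding \<Phi>w[OF that] .
  moreover have "0 < op_norm H ?A" using less r by simp
  ultimately show False
    using no_left_inverse_at_op_norm[OF A hom_bounded[OF z]] unfolding \<mu>_def by blast
qed

text \<open>The class of x is close to the constant class of \<open>x k\<close> for large k.
  Contractivity carries this closeness to the operators, where the constant class has the known
  value \<open>poly_op (x k)\<close>.\<close>

lemma hom_eq_seq_op:
  assumes x: "x \<in> CS" shows "\<Phi> (cls x) = seq_op x"
proof (rule seq_op_eqI[OF x hom_bounded[OF x], symmetric])
  fix f i assume f: "f \<in> ell2 H"
  note mem = CS_mem[OF x]
  have nf: "0 < ell2_norm H f + 1" by (simp add: add_nonneg_pos)
  show "(\<lambda>k. poly_op (x k) f i) \<longlonglongrightarrow> \<Phi> (cls x) f i"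
  proof (rule LIMSEQ_I)
    fix r :: real assume r: "0 < r"
    define e where "e = r / (ell2_norm H f + 1)"
    have e: "0 < e" using r nf by (simp add: e_def)
    obtain N where N: "\<And>k l. k \<ge> N \<Longrightarrow> l \<ge> N \<Longrightarrow> unorm (x k - x l) < e"
      using CS_Cauchy[OF x e] by blast
    have "norm (poly_op (x k) f i - \<Phi> (cls x) f i) < r" if k: "k \<ge> N" for k
    proof -
      \<comment> \<open>Starting the sequence at N changes the representative but not the class, and
        puts every term within e of \<open>x k\<close>, as \<open>hom_contractive\<close>
        demands.\<close>
      let ?d = "\<lambda>l. x (l + N) + pscale (-1) (x k)"
      have xN: "(\<lambda>l. x (l + N)) \<in> CS"
      proof (rule CSI)
        fix e' :: real assume "0 < e'"
        then obtain M where "\<And>k l. k \<ge> M \<Longrightarrow> l \<ge> M \<Longrightarrow> unorm (x k - x l) < e'"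
          using CS_Cauchy[OF x] by blast
        then show "\<exists>M. \<forall>k\<ge>M. \<forall>l\<ge>M. unorm (x (k + N) - x (l + N)) < e'"
          by (intro exI[of _ M]) simp
      qed (rule mem)
      have const: "(\<lambda>l. x k) \<in> CS" by (intro CS_const mem)
      have d: "?d \<in> CS" by (intro CS_add CS_pscale xN const)
      have cls_eq: "cls (\<lambda>l. x (l + N)) = cls x"
        unfolding cls_eq_iff[OF xN x]
      proof (rule LIMSEQ_I)
        fix e' :: real assume "0 < e'"
        then obtain M where M: "\<And>k l. k \<ge> M \<Longrightarrow> l \<ge> M \<Longrightarrow> unorm (x k - x l) < e'"
          using CS_Cauchy[OF x] by blast
        show "\<exists>M. \<forall>l\<ge>M. norm (unorm (x (l + N) - x l) - 0) < e'"
          using M unorm.nonneg[OF free_diff[OF mem mem]] by (intro exI[of _ M]) simp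
      qed
      have d_le: "unorm (?d l) \<le> e" for l
        using N[of "l + N" k] k by (simp add: pscale_minus_one less_imp_le)
      have \<Phi>d: "\<Phi> (cls ?d) f = (\<lambda>i. \<Phi> (cls x) f i - poly_op (x k) f i)"
        using f by (simp add: hom_add[OF xN CS_pscale[OF const]] hom_pscale[OF const] hom_const[OF mem] cls_eq)
      have "cmod (\<Phi> (cls ?d) f i) \<le> ell2_norm H (\<Phi> (cls ?d) f)"
        by (intro cmod_le_ell2_norm bounded_ops_closed[OF hom_bounded[OF d]] f)
      also have "\<dots> \<le> op_norm H (\<Phi> (cls ?d)) * ell2_norm H f"
        by (intro op_norm_bound hom_bounded d f)
      also have "\<dots> \<le> e * ell2_norm H f"
        by (intro mult_right_mono hom_contractive d d_le) simp
      also have "\<dots> < e * (ell2_norm H f + 1)" using e by simp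
      also have "\<dots> = r" using nf by (simp add: e_def)
      finally show ?thesis unfolding \<Phi>d by (simp add: norm_minus_commute)
    qed
    then show "\<exists>N. \<forall>k\<ge>N. norm (poly_op (x k) f i - \<Phi> (cls x) f i) < r" by blast
  qed
qed

lemma hom_eq_rep: "\<Phi> = rep"
proof (rule extensionalityI)
  show "\<Phi> \<in> extensional (cls ` CS)"
    using \<Phi> by (auto simp: twist_reps_def C_Theta_def carrier_univ_cstar)
  show "rep \<in> extensional (cls ` CS)" by (simp add: rep_def)
  show "\<Phi> X = rep X" if "X \<in> cls ` CS" for X
    using that hom_eq_seq_op rep_cls by auto
qed

end

end

theorem theorem2p10:
  fixes m n :: nat and \<theta> :: "nat \<Rightarrow> nat \<Rightarrow> real"
  assumes "m + n > 1"
  shows "\<exists>\<Psi>. twist_reps m n \<theta> = {\<Psi>} \<and> inj_on \<Psi> (carrier (C_Theta m n \<theta>))"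
proof -
  interpret twisted_shifts m n \<theta> .
  have "twist_reps m n \<theta> = {rep}"
    using rep_twist_rep hom_eq_rep by blast
  then show ?thesis using inj_on_rep by blast
qed

end
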